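(* There exist absolute constants $c,C>0$ such that the following holds. Let $n\ge 3$ be an integer, let $\varepsilon$ be a real number with $1/\log n<\varepsilon\le 1$, and let $A\subseteq A_n$ be a generating set of the alternating group $A_n$ with $A=A^{-1}$ and $\mu(A)\ge e^{-cn^{1-\varepsilon}}$. Then $$\mathrm{cn}(A)\le 8\varepsilon^{-1}+C\varepsilon^{-2}\big(\log_n(1/\mu(A))\big)^2 .$$
   Context: $A_n$ is the alternating group on $[n]=\{1,\dots,n\}$ and $\mu(A)=|A|/|A_n|$. $\log$ is the natural logarithm and $\log_n$ is the logarithm to base $n$. $A^{-1}=\{a^{-1}:a\in A\}$ and $A^m=\{a_1\cdots a_m: a_1,\dots,a_m\in A\}$. The covering number $\mathrm{cn}(A)$ is the smallest positive integer $m$ with $A^m=A_n$ (in particular the claim asserts that such $m$ exists). *)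

theory Defs
  imports Complex_Main "HOL-Algebra.Sym_Groups"
begin

definition set_density :: "('a, 'b) monoid_scheme \<Rightarrow> 'a set \<Rightarrow> real"
  where "set_density G A = real (card A) / real (order G)"

(* the product set {a_1 ... a_m | a_1, ..., a_m in A}, each list being one tuple of factors *)
definition set_power :: "('a, 'b) monoid_scheme \<Rightarrow> 'a set \<Rightarrow> nat \<Rightarrow> 'a set"
  where "set_power G A m =
    {foldr (\<lambda>x y. x \<otimes>\<^bsub>G\<^esub> y) as \<one>\<^bsub>G\<^esub> | as. length as = m \<and> set as \<subseteq> A}"

lemma set_power_0: "set_power G A 0 = {\<one>\<^bsub>G\<^esub>}"
  by (auto simp: set_power_def)

lemma set_power_Suc: "set_power G A (Suc m) = A <#>\<^bsub>G\<^esub> set_power G A m"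
proof (intro equalityI subsetI)
  fix z assume "z \<in> set_power G A (Suc m)"
  then obtain as where "length as = Suc m" "set as \<subseteq> A"
    "z = foldr (\<lambda>x y. x \<otimes>\<^bsub>G\<^esub> y) as \<one>\<^bsub>G\<^esub>"
    by (auto simp: set_power_def)
  then show "z \<in> A <#>\<^bsub>G\<^esub> set_power G A m"
    by (cases as) (auto simp: set_power_def set_mult_def)
next
  fix z assume "z \<in> A <#>\<^bsub>G\<^esub> set_power G A m"
  then obtain a as where "a \<in> A" "length as = m" "set as \<subseteq> A"
    "z = a \<otimes>\<^bsub>G\<^esub> foldr (\<lambda>x y. x \<otimes>\<^bsub>G\<^esub> y) as \<one>\<^bsub>G\<^esub>"
    by (auto simp: set_power_def set_mult_def)
  then show "z \<in> set_power G A (Suc m)"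
    unfolding set_power_def by (intro CollectI exI[of _ "a # as"]) auto
qed

definition is_covering_exponent :: "('a, 'b) monoid_scheme \<Rightarrow> 'a set \<Rightarrow> nat \<Rightarrow> bool"
  where "is_covering_exponent G A m \<longleftrightarrow> 0 < m \<and> set_power G A m = carrier G"

(* LEAST is unspecified when no covering exponent exists, so a bound on this number
   is only meaningful together with the existence of one *)
definition covering_number :: "('a, 'b) monoid_scheme \<Rightarrow> 'a set \<Rightarrow> nat"
  where "covering_number G A = (LEAST m. is_covering_exponent G A m)"

end

theory Submission
  imports Defs "HOL-Analysis.L2_Norm"
begin

text \<open>
  Let \<open>t = ln (1 / \<mu> A)\<close> and \<open>L = \<epsilon> * ln n\<close>.

  If \<open>\<mu> A\<close> is at least a small negative power of \<open>n\<close>, then \<open>A\<^sup>3\<close> is the whole group by Gowers' argument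
  for quasirandom groups. The required spectral gap is obtained without representation theory. The
  elementary abelian 2-group spanned by disjoint transpositions splits any function on the group into
  components, and the nontrivial characters have large orbits under permutations of these
  transpositions.

  Otherwise \<open>t\<close> is at least a constant times \<open>L\<close>. Arrange disjoint transpositions into blocks of size
  about \<open>exp (c * L)\<close>. Some translate of \<open>A\<close> has density \<open>exp (- t)\<close> in the product, over the blocks, of
  the groups spanned by the transpositions of a block and their permutations. Fixing the coordinates in
  \<open>O(t / L)\<close> blocks makes it global: no further restriction to \<open>d\<close> blocks increases its density by more
  than a factor \<open>exp (c' * L * d)\<close>. For a global set the Fourier coefficients on average decay
  by a factor \<open>exp (- c'' * L)\<close> per factor of a product, so a product of \<open>O(t / L)\<close> factors contains every
  even flip of transpositions in the remaining blocks. Since the blocks are arbitrary, \<open>A\<^sup>m\<close> with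
  \<open>m = O(t / L)\<close> contains all double transpositions off a set of \<open>O(t / L)\<close> points. Conjugating with
  words of length \<open>O(t / L)\<close> yields all double transpositions. Finally every permutation is a product of
  two involutions, and each of these is, up to \<open>O(t / L)\<close> double transpositions, a product of boundedly
  many elements of \<open>A\<^sup>m\<close>. Hence \<open>O((t / L)\<^sup>2)\<close> factors suffice.
\<close>

section \<open>Characters of the group of subsets\<close>

text \<open>The block argument never uses fewer than about a thousand factors, more than
  \<open>8 / \<epsilon>\<close> may allow; so when \<open>t\<close> is small against
  \<open>L\<close> a separate argument with three factors has to step in. Characters that are empty
  or full on every block are fixed by all permutations inside the blocks, so nothing makes their
  coefficients decay. This is why only sets that are even in every block are produced. Each
  convolution uses a difference of two elements, so every coefficient is multiplied by a square and
  stays nonnegative, and the fixed characters cannot cancel each other. \<open>A\<close> itself may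
  miss the group spanned by the flips; only a translate meets it densely. The translate disappears
  because the words used are quotients of two elements of \<open>A\<close>, conjugated by a third.
  Double transpositions left over from bad blocks are put into fresh blocks of their own. With
  blocks of \<open>N\<close> pairs this takes a multiple of \<open>N\<^sup>2\<close> points per bad
  block, that is about \<open>t * exp L\<close> points in all. The hypothesis on the density says
  that these fit into \<open>n\<close>.\<close>

definition chi :: "'a set \<Rightarrow> 'a set \<Rightarrow> real"
  where "chi U z = (- 1) ^ card (U \<inter> z)"

lemma chi_commute: "chi U z = chi z U"
  by (simp add: chi_def Int_commute)

lemma chi_empty [simp]: "chi U {} = 1" "chi {} z = 1"
  by (simp_all add: chi_def)

lemma chi_mult_self [simp]: "chi U z * chi U z = 1"
  by (simp add: chi_def power_mult_distrib [symmetric])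

lemma chi_abs [simp]: "\<bar>chi U z\<bar> = 1"
  by (simp add: chi_def power_abs)

lemma chi_union:
  assumes "finite U" "finite V" "U \<inter> V = {}"
  shows "chi (U \<union> V) z = chi U z * chi V z"
proof -
  have "(U \<union> V) \<inter> z = (U \<inter> z) \<union> (V \<inter> z)" by blast
  moreover have "card ((U \<inter> z) \<union> (V \<inter> z)) = card (U \<inter> z) + card (V \<inter> z)"
    using assms by (intro card_Un_disjoint) auto
  ultimately show ?thesis by (simp add: chi_def power_add)
qed

lemma chi_sym_diff:
  assumes "finite y" "finite z"
  shows "chi U (sym_diff y z) = chi U y * chi U z"
proof -
  have "chi U ((y - z) \<union> (y \<inter> z)) = chi U (y - z) * chi U (y \<inter> z)"
    "chi U ((z - y) \<union> (y \<inter> z)) = chi U (z - y) * chi U (y \<inter> z)"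
    "chi U ((y - z) \<union> (z - y)) = chi U (y - z) * chi U (z - y)"
    unfolding chi_commute[of U] using assms by (auto intro!: chi_union)
  moreover have "(y - z) \<union> (y \<inter> z) = y" "(z - y) \<union> (y \<inter> z) = z" by auto
  ultimately have "chi U y = chi U (y - z) * chi U (y \<inter> z)" "chi U z = chi U (z - y) * chi U (y \<inter> z)"
    "chi U (sym_diff y z) = chi U (y - z) * chi U (z - y)" by simp_all
  then show ?thesis
    using chi_mult_self[of U "y \<inter> z"] by (metis (no_types, lifting) mult.assoc mult.commute mult_1_right)
qed

lemma sum_chi:
  assumes "finite J" "z \<subseteq> J"
  shows "(\<Sum>U\<in>Pow J. chi U z) = (if z = {} then 2 ^ card J else 0)"
proof (cases "z = {}")
  case True
  then show ?thesis using assms by (simp add: card_Pow)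
next
  case False
  then obtain x where x: "x \<in> z" "x \<in> J" using assms by auto
  define J' where "J' = J - {x}"
  have J: "J = insert x J'" "x \<notin> J'" "finite J'" using x assms by (auto simp: J'_def)
  have "Pow J = Pow J' \<union> insert x ` Pow J'" using J Pow_insert by simp
  then have "(\<Sum>U\<in>Pow J. chi U z) = (\<Sum>U\<in>Pow J'. chi U z) + (\<Sum>U\<in>insert x ` Pow J'. chi U z)"
    using J by (simp add: sum.union_disjoint disjoint_iff) (rule sum.union_disjoint, auto)
  also have "(\<Sum>U\<in>insert x ` Pow J'. chi U z) = (\<Sum>U\<in>Pow J'. chi (insert x U) z)"
    using J by (intro sum.reindex_cong[of "insert x"]) (auto intro!: inj_onI)
  also have "\<dots> = (\<Sum>U\<in>Pow J'. - chi U z)"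
  proof (rule sum.cong[OF refl])
    fix U assume "U \<in> Pow J'"
    then have "chi ({x} \<union> U) z = chi {x} z * chi U z"
      using J by (intro chi_union) (auto intro: finite_subset)
    then show "chi (insert x U) z = - chi U z" using x by (simp add: chi_def)
  qed
  finally show ?thesis using False by (simp add: sum_negf)
qed

text \<open>Expanding the square and summing over \<open>U\<close> leaves, by orthogonality, only
  the pairs whose sets agree on \<open>J\<close>; there \<open>V\<close> contributes signs, bounded
  by one. \<open>V\<close> is the portion of a character that stays fixed while the rest runs
  through an orbit.\<close>

lemma bessel:
  assumes "finite J" "finite Y" "\<And>y. y \<in> Y \<Longrightarrow> finite (z y)" "finite V" "V \<inter> J = {}"
  shows "(\<Sum>U\<in>Pow J. (\<Sum>y\<in>Y. chi (U \<union> V) (z y))\<^sup>2)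
           \<le> 2 ^ card J * real (card {(y, y'). y \<in> Y \<and> y' \<in> Y \<and> z y \<inter> J = z y' \<inter> J})"
proof -
  let ?P = "{(y, y'). y \<in> Y \<and> y' \<in> Y \<and> z y \<inter> J = z y' \<inter> J}"
  have "(\<Sum>y\<in>Y. chi (U \<union> V) (z y))\<^sup>2 = (\<Sum>(y,y')\<in>Y \<times> Y. chi V (z y) * chi V (z y') * chi U (sym_diff (z y \<inter> J) (z y' \<inter> J)))"
    if U: "U \<in> Pow J" for U
  proof -
    have *: "chi (U \<union> V) (z y) = chi U (z y \<inter> J) * chi V (z y)" for y
    proof -
      have "U \<inter> z y = U \<inter> (z y \<inter> J)" using U by auto
      then have "chi U (z y) = chi U (z y \<inter> J)" by (simp add: chi_def)
      moreover have "chi (U \<union> V) (z y) = chi U (z y) * chi V (z y)"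
        using U assms by (intro chi_union) (auto intro: finite_subset)
      ultimately show ?thesis by simp
    qed
    have "(\<Sum>y\<in>Y. chi (U \<union> V) (z y))\<^sup>2 = (\<Sum>(y,y')\<in>Y \<times> Y. chi (U \<union> V) (z y) * chi (U \<union> V) (z y'))"
      by (simp add: power2_eq_square sum_product sum.cartesian_product)
    also have "\<dots> = (\<Sum>(y,y')\<in>Y \<times> Y. chi V (z y) * chi V (z y') * chi U (sym_diff (z y \<inter> J) (z y' \<inter> J)))"
    proof (rule sum.cong[OF refl], clarify)
      fix y y' assume "y \<in> Y" "y' \<in> Y"
      then show "chi (U \<union> V) (z y) * chi (U \<union> V) (z y') = chi V (z y) * chi V (z y') * chi U (sym_diff (z y \<inter> J) (z y' \<inter> J))"
        using assms by (subst chi_sym_diff) (auto simp: *)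
    qed
    finally show ?thesis .
  qed
  then have "(\<Sum>U\<in>Pow J. (\<Sum>y\<in>Y. chi (U \<union> V) (z y))\<^sup>2)
     = (\<Sum>U\<in>Pow J. \<Sum>(y,y')\<in>Y \<times> Y. chi V (z y) * chi V (z y') * chi U (sym_diff (z y \<inter> J) (z y' \<inter> J)))"
    by simp
  also have "\<dots> = (\<Sum>(y,y')\<in>Y \<times> Y. chi V (z y) * chi V (z y') * (\<Sum>U\<in>Pow J. chi U (sym_diff (z y \<inter> J) (z y' \<inter> J))))"
    by (subst sum.swap) (simp add: sum_distrib_left case_prod_unfold)
  also have "\<dots> \<le> (\<Sum>p\<in>Y \<times> Y. if p \<in> ?P then 2 ^ card J else 0)"
  proof (rule sum_mono, clarify)
    fix y y' assume y: "y \<in> Y" "y' \<in> Y"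
    have "(\<Sum>U\<in>Pow J. chi U (sym_diff (z y \<inter> J) (z y' \<inter> J))) = (if sym_diff (z y \<inter> J) (z y' \<inter> J) = {} then 2 ^ card J else 0)"
      using assms by (intro sum_chi) auto
    moreover have "sym_diff (z y \<inter> J) (z y' \<inter> J) = {} \<longleftrightarrow> (y, y') \<in> ?P" using y by auto
    moreover have "chi V (z y) * chi V (z y') \<le> 1"
      using abs_le_D1[of "chi V (z y) * chi V (z y')" 1] by (simp add: abs_mult)
    ultimately show "chi V (z y) * chi V (z y') * (\<Sum>U\<in>Pow J. chi U (sym_diff (z y \<inter> J) (z y' \<inter> J))) \<le> (if (y,y') \<in> ?P then 2 ^ card J else 0)"
      by (auto simp: mult_le_cancel_right)
  qed
  also have "\<dots> = 2 ^ card J * real (card ?P)"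
  proof -
    have "?P \<subseteq> Y \<times> Y" by auto
    then have "(Y \<times> Y) \<inter> ?P = ?P" by blast
    then show ?thesis using assms by (subst sum.If_cases) auto
  qed
  finally show ?thesis .
qed

lemma chi_image:
  assumes "inj_on f z"
  shows "chi U (f ` z) = chi (f -` U) z"
proof -
  have "U \<inter> f ` z = f ` (f -` U \<inter> z)" by auto
  moreover have "card (f ` (f -` U \<inter> z)) = card (f -` U \<inter> z)"
    using assms by (intro card_image) (auto intro: inj_on_subset)
  ultimately show ?thesis by (simp add: chi_def)
qed

section \<open>Globalization\<close>

lemma pigeonhole_fibre:
  assumes "finite W" "W \<noteq> {}" "f ` W \<subseteq> B" "finite B"
  shows "\<exists>w\<in>W. card W \<le> card B * card {w'\<in>W. f w' = f w}"
proof (rule ccontr)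
  assume "\<not> ?thesis"
  then have less: "card B * card {w'\<in>W. f w' = f w} < card W" if "w \<in> W" for w
    using that by force
  have "card W = (\<Sum>b\<in>f ` W. card {w'\<in>W. f w' = b})"
    unfolding card_eq_sum using assms(1) by (rule sum.image_gen)
  then have "card (f ` W) * card W = (\<Sum>b\<in>f ` W. card (f ` W) * card {w'\<in>W. f w' = b})"
    by (simp add: sum_distrib_left)
  also have "\<dots> < (\<Sum>b\<in>f ` W. card W)"
  proof (rule sum_strict_mono)
    fix b assume "b \<in> f ` W"
    then obtain w where w: "w \<in> W" "b = f w" by auto
    have "card (f ` W) \<le> card B" using assms card_mono by blast
    then have "card (f ` W) * card {w'\<in>W. f w' = b} \<le> card B * card {w'\<in>W. f w' = f w}"
      using w by (simp add: mult_right_mono)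
    then show "card (f ` W) * card {w'\<in>W. f w' = b} < card W"
      using less[OF w(1)] by linarith
  qed (use assms in auto)
  finally show False by simp
qed

text \<open>Restriction of \<open>W\<close> to a subcube. The fixed coordinates are kept, so
  iterated restrictions stay in the same function space.\<close>

definition cell :: "('i \<Rightarrow> 'x) set \<Rightarrow> 'i set \<Rightarrow> ('i \<Rightarrow> 'x) \<Rightarrow> ('i \<Rightarrow> 'x) set"
  where "cell W S w0 = {w \<in> W. \<forall>i\<in>S. w i = w0 i}"

lemma card_cell_le:
  assumes "finite I" "finite X" "W \<subseteq> PiE I (\<lambda>_. X)" "S \<subseteq> I"
  shows "card (cell W S w0) \<le> card X ^ (card I - card S)"
proof -
  have "card (cell W S w0) \<le> card (PiE (I - S) (\<lambda>_. X))"
  proof (rule card_inj_on_le[of "\<lambda>w. restrict w (I - S)"])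
    show "inj_on (\<lambda>w. restrict w (I - S)) (cell W S w0)"
    proof (rule inj_onI)
      fix w w' assume w: "w \<in> cell W S w0" "w' \<in> cell W S w0" "restrict w (I - S) = restrict w' (I - S)"
      show "w = w'"
      proof (rule PiE_ext[of w I "\<lambda>_. X" w'])
        fix i assume "i \<in> I"
        have eq: "restrict w (I - S) i = restrict w' (I - S) i" using w(3) by simp
        show "w i = w' i"
        proof (cases "i \<in> S")
          case False
          then show ?thesis using eq \<open>i \<in> I\<close> by simp
        qed (use w in \<open>auto simp: cell_def\<close>)
      qed (use w assms in \<open>auto simp: cell_def\<close>)
    qed
    show "(\<lambda>w. restrict w (I - S)) ` cell W S w0 \<subseteq> PiE (I - S) (\<lambda>_. X)"
      using assms(3) by (fastforce simp: cell_def)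
    show "finite (PiE (I - S) (\<lambda>_. X))" using assms by (intro finite_PiE) auto
  qed
  also have "\<dots> = card X ^ (card I - card S)"
    using assms by (simp add: card_PiE card_Diff_subset finite_subset)
  finally show ?thesis .
qed

lemma quotient_le_cancel:
  fixes a b c1 c2 x y :: real
  assumes "c1 * (a * b) / (x * y) \<le> c2 * a / x" "0 < a" "0 < x" "0 < y"
  shows "c1 * b \<le> y * c2"
proof -
  have "c1 * (a * b) / (x * y) * (x * y) \<le> c2 * a / x * (x * y)"
    using assms by (intro mult_right_mono) auto
  then have "a * (c1 * b) \<le> a * (y * c2)" using assms by (simp add: mult_ac)
  then show ?thesis using assms(2) by simp
qed

text \<open>The cell is chosen to maximize its density divided by \<open>2 ^ (j * card S)\<close>.\<close>

lemma globalise: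
  fixes W :: "('i \<Rightarrow> 'x) set"
  assumes fin: "finite I" "finite X" and W: "W \<subseteq> PiE I (\<lambda>_. X)" "W \<noteq> {}"
    and dense: "card X ^ card I \<le> card W * 2 ^ a" and S2: "S2 \<subseteq> I"
  obtains S w0 where "S2 \<subseteq> S" "S \<subseteq> I" "j * (card S - card S2) \<le> a" "w0 \<in> W"
    "card X ^ (card I - card S) \<le> card (cell W S w0) * 2 ^ a"
    "\<And>S' s. S' \<subseteq> I - S \<Longrightarrow>
       card (cell (cell W S w0) S' s) * card X ^ card S' \<le> 2 ^ (j * card S') * card (cell W S w0)"
proof -
  define k where "k = card X"
  have finW: "finite W" using W fin by (meson finite_PiE finite_subset)
  have kI: "0 < k ^ card I"
  proof -
    have "card (PiE I (\<lambda>_. X)) = k ^ card I" using fin by (simp add: card_PiE k_def)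
    moreover have "0 < card (PiE I (\<lambda>_. X))" using W fin by (metis card_gt_0_iff finite_PiE subset_empty)
    ultimately show ?thesis by simp
  qed
  \<comment> \<open>\<open>X\<close> may be empty when \<open>I\<close> is; then
    \<open>0 ^ 0 = 1\<close> keeps the powers positive.\<close>
  then have kpos: "0 < k ^ d" if "d \<le> card I" for d using that by (cases "k = 0") (auto simp: power_0_left split: if_splits)
  have finS: "finite S" if "S \<subseteq> I" for S using that fin finite_subset by blast
  define val :: "'i set \<Rightarrow> ('i \<Rightarrow> 'x) \<Rightarrow> real"
    where "val S w = card (cell W S w) * k ^ card S / 2 ^ (j * card S)" for S w
  let ?C = "{S. S2 \<subseteq> S \<and> S \<subseteq> I} \<times> W"
  have "finite ?C" using finW fin by auto
  moreover have "?C \<noteq> {}" using W S2 by auto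
  ultimately have "Max ((\<lambda>(S,w). val S w) ` ?C) \<in> (\<lambda>(S,w). val S w) ` ?C"
    by (intro Max_in) auto
  then obtain S w0 where S: "S2 \<subseteq> S" "S \<subseteq> I" "w0 \<in> W" "val S w0 = Max ((\<lambda>(S,w). val S w) ` ?C)"
    by auto
  have max: "val S' w \<le> val S w0" if "S2 \<subseteq> S'" "S' \<subseteq> I" "w \<in> W" for S' w
    unfolding S(4) using that \<open>finite ?C\<close> by (intro Max_ge) auto
  \<comment> \<open>Some cell over \<open>S2\<close> is at least as dense as \<open>W\<close>. It is
    the competitor that keeps the maximum from being too small.\<close>
  obtain w1 where w1: "w1 \<in> W" "card W \<le> k ^ card S2 * card (cell W S2 w1)"
  proof -
    have "(\<lambda>w. restrict w S2) ` W \<subseteq> PiE S2 (\<lambda>_. X)" using W S2 by fastforce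
    from pigeonhole_fibre[OF finW W(2) this] obtain w where w: "w \<in> W"
      "card W \<le> card (PiE S2 (\<lambda>_. X)) * card {w'\<in>W. restrict w' S2 = restrict w S2}"
      using finS[OF S2] fin by (auto intro: finite_PiE)
    moreover have "{w'\<in>W. restrict w' S2 = restrict w S2} = cell W S2 w"
      by (auto simp: cell_def fun_eq_iff restrict_def)
    ultimately show ?thesis using that finS[OF S2] by (simp add: card_PiE k_def)
  qed
  have le: "card S2 \<le> card S" "card S \<le> card I" using S finS fin by (auto intro!: card_mono)
  have "real (card W) / 2 ^ (j * card S2) \<le> val S2 w1"
    unfolding val_def using of_nat_mono[OF w1(2), where 'a = real] by (simp add: divide_right_mono mult.commute)
  also have "\<dots> \<le> val S w0" using max S2 w1 by auto
  finally have "real (card W) * 2 ^ (j * card S) / 2 ^ (j * card S2) \<le> card (cell W S w0) * k ^ card S"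
    by (simp add: val_def field_simps)
  moreover have "(2::real) ^ (j * card S) / 2 ^ (j * card S2) = 2 ^ (j * (card S - card S2))"
    using le by (simp add: power_diff right_diff_distrib' mult_left_mono)
  ultimately have "real (card W * 2 ^ (j * (card S - card S2))) \<le> real (card (cell W S w0) * k ^ card S)"
    by (simp add: field_simps)
  then have *: "card W * 2 ^ (j * (card S - card S2)) \<le> card (cell W S w0) * k ^ card S"
    by (simp only: of_nat_le_iff)
  have split: "k ^ card I = k ^ (card I - card S) * k ^ card S"
    using le by (simp flip: power_add)
  show ?thesis
  proof
    have "k ^ card I * 2 ^ (j * (card S - card S2)) \<le> card W * 2 ^ a * 2 ^ (j * (card S - card S2))"
      using dense by (simp add: k_def)
    also have "\<dots> \<le> (card (cell W S w0) * k ^ card S) * 2 ^ a" using * by (simp add: mult.commute)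
    finally have 1: "k ^ card I * 2 ^ (j * (card S - card S2)) \<le> (card (cell W S w0) * k ^ card S) * 2 ^ a" .
    also have "\<dots> \<le> (k ^ (card I - card S) * k ^ card S) * 2 ^ a"
      using card_cell_le[OF fin W(1) S(2), of w0] by (simp add: k_def)
    finally have "k ^ card I * 2 ^ (j * (card S - card S2)) \<le> k ^ card I * 2 ^ a"
      unfolding split .
    \<comment> \<open>The density started from at least \<open>1 / 2 ^ a\<close>, grew by
      \<open>2 ^ (j * (card S - card S2))\<close> and is still at most one. This bounds the number
      of fixed coordinates.\<close>
    then have "(2::nat) ^ (j * (card S - card S2)) \<le> 2 ^ a"
      using kI nat_mult_le_cancel1 by blast
    then show "j * (card S - card S2) \<le> a" by simp
    have "k ^ card I \<le> k ^ card I * 2 ^ (j * (card S - card S2))" by simp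
    also note 1
    finally have "k ^ card S * k ^ (card I - card S) \<le> k ^ card S * (card (cell W S w0) * 2 ^ a)"
      unfolding split by (simp only: mult_ac)
    then show "card X ^ (card I - card S) \<le> card (cell W S w0) * 2 ^ a"
      using kpos[of "card S"] le nat_mult_le_cancel1 unfolding k_def by blast
    fix S' s assume S': "S' \<subseteq> I - S"
    have disj: "card (S \<union> S') = card S + card S'"
      using S' S finS[of S] finS[of S'] by (intro card_Un_disjoint) auto
    show "card (cell (cell W S w0) S' s) * card X ^ card S' \<le> 2 ^ (j * card S') * card (cell W S w0)"
    proof (cases "cell (cell W S w0) S' s = {}")
      case False
      \<comment> \<open>The maximum ranges over base points in \<open>W\<close>, which
        \<open>s\<close> need not be; any element of the nonempty cell serves instead.\<close>
      then obtain w2 where w2: "w2 \<in> W" "\<forall>i\<in>S. w2 i = w0 i" "\<forall>i\<in>S'. w2 i = s i" by (auto simp: cell_def)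
      then have "cell (cell W S w0) S' s = cell W (S \<union> S') w2" by (auto simp: cell_def)
      moreover have "val (S \<union> S') w2 \<le> val S w0" using S S' w2 by (intro max) auto
      ultimately have "real (card (cell (cell W S w0) S' s)) * (real k ^ card S * real k ^ card S') / (2 ^ (j * card S) * 2 ^ (j * card S'))
          \<le> card (cell W S w0) * real k ^ card S / 2 ^ (j * card S)"
        by (simp only: val_def disj power_add distrib_left of_nat_mult of_nat_power)
      moreover have "0 < real k ^ card S" using kpos[of "card S"] le by (simp flip: of_nat_power)
      ultimately have "real (card (cell (cell W S w0) S' s)) * real k ^ card S' \<le> 2 ^ (j * card S') * real (card (cell W S w0))"
        by (rule quotient_le_cancel) simp_all
      then have "real (card (cell (cell W S w0) S' s) * k ^ card S') \<le> real (2 ^ (j * card S') * card (cell W S w0))"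
        by simp
      then show ?thesis unfolding of_nat_le_iff k_def .
    qed simp
  qed (use S in auto)
qed

section \<open>Sumsets in products of blocks\<close>

text \<open>One of \<open>U\<close> and its complement has at least \<open>m\<close> elements. The
  transpositions of a fixed \<open>a\<close> on the other side with the elements \<open>x\<close> of
  this one exchange different single elements. Being involutions, they spare the distinction between
  images and preimages of \<open>U\<close>.\<close>

lemma many_swaps:
  assumes "finite K" "U \<subseteq> K" "U \<noteq> {}" "U \<noteq> K" "2 * m \<le> card K"
  shows "\<exists>\<Gamma>. \<Gamma> \<subseteq> {p. p permutes K} \<and> finite \<Gamma> \<and> m \<le> card \<Gamma> \<and> (\<forall>\<gamma>\<in>\<Gamma>. \<gamma> \<circ> \<gamma> = id)
           \<and> inj_on (\<lambda>\<gamma>. {k\<in>K. \<gamma> k \<in> U}) \<Gamma>"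
proof -
  have *: ?thesis if X: "X \<subseteq> K" "a \<in> K" "m \<le> card X"
    and inj: "inj_on (\<lambda>x. {k\<in>K. transpose a x k \<in> U}) X" for X a
  proof (intro exI conjI)
    have "inj_on (transpose a) X"
      by (rule inj_onI) (metis transpose_apply_first)
    then show "m \<le> card (transpose a ` X)" using X by (simp add: card_image)
    show "inj_on (\<lambda>\<gamma>. {k \<in> K. \<gamma> k \<in> U}) (transpose a ` X)"
      using inj unfolding inj_on_def by auto
    show "transpose a ` X \<subseteq> {p. p permutes K}" using X by (auto intro!: permutes_swap_id)
    show "finite (transpose a ` X)" using X assms by (auto intro: finite_subset)
  qed auto
  have "card K = card U + card (K - U)" using assms by (metis card_Diff_subset card_mono finite_subset le_add_diff_inverse)
  then consider "m \<le> card (K - U)" | "m \<le> card U" using assms by linarith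
  then show ?thesis
  proof cases
    case 1
    obtain a where a: "a \<in> U" using assms by blast
    have "{k\<in>K. transpose a x k \<in> U} = insert x (U - {a})" if "x \<in> K - U" for x
      using that a assms by (auto simp: transpose_def)
    then have "inj_on (\<lambda>x. {k\<in>K. transpose a x k \<in> U}) (K - U)"
      by (intro inj_onI) (simp, blast)
    then show ?thesis using a assms 1 by (intro *[of "K - U" a]) auto
  next
    case 2
    obtain a where a: "a \<in> K" "a \<notin> U" using assms by blast
    have "{k\<in>K. transpose a x k \<in> U} = insert a (U - {x})" if "x \<in> U" for x
      using that a assms by (auto simp: transpose_def)
    moreover have "inj_on (\<lambda>x. insert a (U - {x})) U"
      using a by (intro inj_onI) (metis Diff_iff insert_iff empty_iff)
    ultimately have "inj_on (\<lambda>x. {k\<in>K. transpose a x k \<in> U}) U"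
      by (simp cong: inj_on_cong)
    then show ?thesis using a assms 2 by (intro *[of U a]) auto
  qed
qed

text \<open>Composing \<open>s\<close> with blockwise swaps permutes the index set of the sum, while
  for a fixed \<open>s\<close> these at least \<open>m ^ card S\<close> compositions give distinct
  sets. So no set arises from more than a fraction \<open>1 / m ^ card S\<close> of all
  \<open>s\<close>.\<close>

lemma sum_over_permuted_le:
  fixes F :: "('i \<times> 'k) set \<Rightarrow> real"
  assumes "finite S" "finite K" "2 * m \<le> card K" and F: "\<And>U. 0 \<le> F U"
    and u: "\<And>i. i \<in> S \<Longrightarrow> u i \<subseteq> K \<and> u i \<noteq> {} \<and> u i \<noteq> K"
  shows "real m ^ card S * (\<Sum>s\<in>PiE S (\<lambda>_. {p. p permutes K}). F {(i,k). i \<in> S \<and> k \<in> K \<and> s i k \<in> u i})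
           \<le> fact (card K) ^ card S * (\<Sum>U\<in>Pow (S \<times> K). F U)"
proof -
  let ?P = "PiE S (\<lambda>_. {p. p permutes K})"
  define Q where "Q s = {(i,k). i \<in> S \<and> k \<in> K \<and> s i k \<in> u i}" for s :: "'i \<Rightarrow> 'k \<Rightarrow> 'k"
  have "\<forall>i\<in>S. \<exists>\<Gamma>. \<Gamma> \<subseteq> {p. p permutes K} \<and> finite \<Gamma> \<and> m \<le> card \<Gamma> \<and> (\<forall>\<gamma>\<in>\<Gamma>. \<gamma> \<circ> \<gamma> = id)
           \<and> inj_on (\<lambda>\<gamma>. {k\<in>K. \<gamma> k \<in> u i}) \<Gamma>"
    using u assms by (intro ballI many_swaps) auto
  from bchoice[OF this] obtain \<Gamma> where \<Gamma>: "\<And>i. i \<in> S \<Longrightarrow> \<Gamma> i \<subseteq> {p. p permutes K}"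
    "\<And>i. i \<in> S \<Longrightarrow> finite (\<Gamma> i)" "\<And>i. i \<in> S \<Longrightarrow> m \<le> card (\<Gamma> i)"
    "\<And>i \<gamma>. i \<in> S \<Longrightarrow> \<gamma> \<in> \<Gamma> i \<Longrightarrow> \<gamma> \<circ> \<gamma> = id"
    "\<And>i. i \<in> S \<Longrightarrow> inj_on (\<lambda>\<gamma>. {k\<in>K. \<gamma> k \<in> u i}) (\<Gamma> i)" by blast
  let ?G = "PiE S \<Gamma>"
  define comp where "comp \<gamma> s = (\<lambda>i\<in>S. \<gamma> i \<circ> s i)" for \<gamma> s :: "'i \<Rightarrow> 'k \<Rightarrow> 'k"
  have comp_mem: "comp \<gamma> s \<in> ?P" if "\<gamma> \<in> ?G" "s \<in> ?P" for \<gamma> s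
    using that \<Gamma>(1) unfolding comp_def by (auto intro!: permutes_compose dest!: PiE_mem[of s] PiE_mem[of \<gamma>])
  have comp_comp: "comp \<gamma> (comp \<gamma> s) = s" if "\<gamma> \<in> ?G" "s \<in> ?P" for \<gamma> s
  proof (rule PiE_ext[of _ S "\<lambda>_. {p. p permutes K}"])
    fix i assume i: "i \<in> S"
    then have "\<gamma> i \<circ> (\<gamma> i \<circ> s i) = s i" using \<Gamma>(4)[OF i, of "\<gamma> i"] that by (simp add: o_assoc PiE_mem)
    then show "comp \<gamma> (comp \<gamma> s) i = s i" using i by (simp add: comp_def)
  qed (use that comp_mem in auto)
  have "real m ^ card S \<le> real (card ?G)"
  proof -
    have "m ^ card S \<le> (\<Prod>i\<in>S. card (\<Gamma> i))"
      using \<Gamma>(3) by (metis prod_constant prod_mono zero_le)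
    then have "m ^ card S \<le> card ?G" using assms by (simp add: card_PiE)
    then show ?thesis by (metis of_nat_le_iff of_nat_power)
  qed
  then have "real m ^ card S * (\<Sum>s\<in>?P. F (Q s)) \<le> (\<Sum>\<gamma>\<in>?G. \<Sum>s\<in>?P. F (Q s))"
    using F by (simp add: mult_right_mono sum_nonneg)
  also have "\<dots> = (\<Sum>\<gamma>\<in>?G. \<Sum>s\<in>?P. F (Q (comp \<gamma> s)))"
  proof (rule sum.cong[OF refl])
    fix \<gamma> assume \<gamma>: "\<gamma> \<in> ?G"
    show "(\<Sum>s\<in>?P. F (Q s)) = (\<Sum>s\<in>?P. F (Q (comp \<gamma> s)))"
      by (rule sum.reindex_bij_witness[of _ "comp \<gamma>" "comp \<gamma>"]) (use \<gamma> comp_mem comp_comp in auto)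
  qed
  also have "\<dots> = (\<Sum>s\<in>?P. \<Sum>\<gamma>\<in>?G. F (Q (comp \<gamma> s)))" by (rule sum.swap)
  also have "\<dots> \<le> (\<Sum>s\<in>?P. \<Sum>U\<in>Pow (S \<times> K). F U)"
  proof (rule sum_mono)
    fix s assume s: "s \<in> ?P"
    have "inj_on (\<lambda>\<gamma>. Q (comp \<gamma> s)) ?G"
    proof (rule inj_onI)
      fix \<gamma> \<gamma>' assume \<gamma>: "\<gamma> \<in> ?G" "\<gamma>' \<in> ?G" and eq: "Q (comp \<gamma> s) = Q (comp \<gamma>' s)"
      show "\<gamma> = \<gamma>'"
      proof (rule PiE_ext[OF \<gamma>])
        fix i assume i: "i \<in> S"
        have si: "s i permutes K" using s i by (auto dest: PiE_mem)
        have "{k\<in>K. \<delta> i k \<in> u i} = s i ` (Q (comp \<delta> s) `` {i})" for \<delta> :: "'i \<Rightarrow> 'k \<Rightarrow> 'k"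
        proof -
          have "Q (comp \<delta> s) `` {i} = {k\<in>K. \<delta> i (s i k) \<in> u i}" using i by (auto simp: Q_def comp_def)
          moreover have "s i ` {k\<in>K. \<delta> i (s i k) \<in> u i} = {k\<in>K. \<delta> i k \<in> u i}"
          proof (intro equalityI subsetI)
            fix k assume k: "k \<in> {k\<in>K. \<delta> i k \<in> u i}"
            then have "k \<in> s i ` K" using si by (simp add: permutes_image)
            then show "k \<in> s i ` {k\<in>K. \<delta> i (s i k) \<in> u i}" using k by auto
          qed (use si in \<open>auto simp: permutes_in_image\<close>)
          ultimately show ?thesis by simp
        qed
        then have "{k\<in>K. \<gamma> i k \<in> u i} = {k\<in>K. \<gamma>' i k \<in> u i}" using eq by metis
        then show "\<gamma> i = \<gamma>' i"
          using \<gamma> i by (intro inj_onD[OF \<Gamma>(5)[OF i]]) (auto dest: PiE_mem)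
      qed
    qed
    then have "(\<Sum>\<gamma>\<in>?G. F (Q (comp \<gamma> s))) = (\<Sum>U\<in>(\<lambda>\<gamma>. Q (comp \<gamma> s)) ` ?G. F U)"
      by (simp add: sum.reindex)
    also have "\<dots> \<le> (\<Sum>U\<in>Pow (S \<times> K). F U)"
      using F assms by (intro sum_mono2) (auto simp: Q_def)
    finally show "(\<Sum>\<gamma>\<in>?G. F (Q (comp \<gamma> s))) \<le> (\<Sum>U\<in>Pow (S \<times> K). F U)" .
  qed
  also have "\<dots> = fact (card K) ^ card S * (\<Sum>U\<in>Pow (S \<times> K). F U)"
    using assms by (simp add: card_PiE card_permutations)
  finally show ?thesis by (simp add: Q_def)
qed

section \<open>Averaged Fourier coefficients of global sets\<close>

definition block_act :: "('i \<Rightarrow> 'k \<Rightarrow> 'k) \<Rightarrow> 'i \<times> 'k \<Rightarrow> 'i \<times> 'k"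
  where "block_act \<tau> = (\<lambda>(i, k). (i, \<tau> i k))"

text \<open>Fourier coefficient at \<open>U\<close> of the uniform distribution on \<open>Y\<close>,
  seen on the blocks in \<open>R\<close>.\<close>

definition block_chars :: "('i \<Rightarrow> 'k set) set \<Rightarrow> 'i set \<Rightarrow> ('i \<times> 'k) set \<Rightarrow> real"
  where "block_chars Y R U = (\<Sum>y\<in>Y. chi U (Sigma R y)) / real (card Y)"

text \<open>The empty and the full subset of a block are the only ones fixed by all its
  permutations, so they are the characters without a large orbit.\<close>

definition nontriv :: "'i set \<Rightarrow> 'k set \<Rightarrow> ('i \<times> 'k) set \<Rightarrow> bool"
  where "nontriv R K U \<longleftrightarrow> (\<exists>i\<in>R. U `` {i} \<noteq> {} \<and> U `` {i} \<noteq> K)"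

text \<open>If \<open>U\<close> is nontrivial in \<open>d\<close> blocks, its orbit under permutations within these blocks has at least
  \<open>16 ^ (j * d)\<close> elements, while by Bessel's inequality the squared coefficients of a global set sum up to
  at most \<open>2 ^ (j * d)\<close> over the orbit. Passing from all permutations to a global set of permutations costs
  another factor \<open>2 ^ (j * d)\<close>.\<close>

lemma average_decay:
  fixes Y :: "('i \<Rightarrow> 'k set) set" and \<Theta> :: "('i \<Rightarrow> 'k \<Rightarrow> 'k) set"
  assumes fin: "finite I" "finite K" and K: "2 * 16 ^ j \<le> card K" and R: "R \<subseteq> I"
    and \<Theta>: "\<Theta> \<subseteq> PiE I (\<lambda>_. {p. p permutes K})"
    and Y: "Y \<subseteq> PiE I (\<lambda>_. Pow K)" "Y \<noteq> {}"
    and global_\<Theta>: "\<And>S' s. S' \<subseteq> R \<Longrightarrow> card (cell \<Theta> S' s) * fact (card K) ^ card S' \<le> 2 ^ (j * card S') * card \<Theta>"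
    and global_Y: "\<And>S' s. S' \<subseteq> R \<Longrightarrow> card (cell Y S' s) * (2 ^ card K) ^ card S' \<le> 2 ^ (j * card S') * card Y"
    and U: "U \<subseteq> R \<times> K" "nontriv R K U"
  shows "4 ^ j * (\<Sum>\<tau>\<in>\<Theta>. (block_chars Y R (block_act \<tau> -` U))\<^sup>2) \<le> real (card \<Theta>)"
proof -
  define S where "S = {i\<in>R. U `` {i} \<noteq> {} \<and> U `` {i} \<noteq> K}"
  \<comment> \<open>Blocks on which \<open>U\<close> is empty or full contribute the same for every
    \<open>\<tau>\<close>; they form the fixed part in \<open>bessel\<close>.\<close>
  define V where "V = U \<inter> (R - S) \<times> K"
  define Q where "Q s = {(i,k). i \<in> S \<and> k \<in> K \<and> s i k \<in> U `` {i}}" for s :: "'i \<Rightarrow> 'k \<Rightarrow> 'k"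
  define F where "F W = (\<Sum>y\<in>Y. chi (W \<union> V) (Sigma R y))\<^sup>2" for W
  define d where "d = card S"
  have finY: "finite Y" using Y fin by (meson finite_PiE finite_Pow_iff finite_subset)
  have fin\<Theta>: "finite \<Theta>" 
    by (rule finite_subset[OF \<Theta>]) (use fin in \<open>auto intro!: finite_PiE simp: finite_permutations\<close>)
  have SR: "S \<subseteq> R" "finite S" "finite R" using fin R by (auto simp: S_def intro: finite_subset)
  have d: "1 \<le> d" using U SR by (auto simp: d_def S_def nontriv_def Suc_le_eq card_gt_0_iff)
  have PK: "y i \<subseteq> K" if "y \<in> Y" "i \<in> R" for y i
    using that Y R by (auto dest!: subsetD[OF Y(1)] dest: PiE_mem)
  have "(\<Sum>y\<in>Y. chi (block_act \<tau> -` U) (Sigma R y))\<^sup>2 = F (Q (restrict \<tau> S))" if \<tau>: "\<tau> \<in> \<Theta>" for \<tau>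
  proof -
    have "chi (block_act \<tau> -` U) (Sigma R y) = chi (Q (restrict \<tau> S) \<union> V) (Sigma R y)" if y: "y \<in> Y" for y
    proof -
      have "(i,k) \<in> block_act \<tau> -` U \<longleftrightarrow> (i,k) \<in> Q (restrict \<tau> S) \<union> V" if ik: "i \<in> R" "k \<in> y i" for i k
      proof (cases "i \<in> S")
        case True
        then show ?thesis using ik PK[OF y] by (auto simp: block_act_def Q_def V_def)
      next
        case False
        have "\<tau> \<in> PiE I (\<lambda>_. {p. p permutes K})" "i \<in> I" using \<tau> \<Theta> R ik by auto
        then have k: "k \<in> K" "\<tau> i permutes K" using ik PK[OF y] by (auto dest: PiE_mem)
        then have "\<tau> i k \<in> K" by (simp add: permutes_in_image)
        moreover have "U `` {i} = {} \<or> U `` {i} = K" using False ik by (auto simp: S_def)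
        ultimately have "\<tau> i k \<in> U `` {i} \<longleftrightarrow> k \<in> U `` {i}" using k by auto
        then show ?thesis using False ik k by (auto simp: block_act_def Q_def V_def)
      qed
      then have "(block_act \<tau> -` U) \<inter> Sigma R y = (Q (restrict \<tau> S) \<union> V) \<inter> Sigma R y" by blast
      then show ?thesis by (simp add: chi_def)
    qed
    then show ?thesis by (simp add: F_def)
  qed
  then have sum_eq: "(\<Sum>\<tau>\<in>\<Theta>. (block_chars Y R (block_act \<tau> -` U))\<^sup>2) = (\<Sum>\<tau>\<in>\<Theta>. F (Q (restrict \<tau> S))) / (card Y)\<^sup>2"
    by (simp add: block_chars_def power_divide flip: sum_divide_distrib)
  let ?P = "PiE S (\<lambda>_. {p. p permutes K})"
  have finP: "finite ?P" using SR fin by (auto intro!: finite_PiE simp: finite_permutations)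
  have F0: "0 \<le> F W" for W by (simp add: F_def)
  let ?f = "fact (card K) ^ d :: real"
  have cellP: "real (card {\<tau>\<in>\<Theta>. restrict \<tau> S = s}) * ?f \<le> 2 ^ (j * d) * card \<Theta>" if s: "s \<in> ?P" for s
  proof -
    have "{\<tau>\<in>\<Theta>. restrict \<tau> S = s} \<subseteq> cell \<Theta> S s" by (auto simp: cell_def)
    then have "card {\<tau>\<in>\<Theta>. restrict \<tau> S = s} * fact (card K) ^ card S \<le> card (cell \<Theta> S s) * fact (card K) ^ card S"
      using fin\<Theta> by (intro mult_right_mono card_mono) (auto simp: cell_def)
    also have "\<dots> \<le> 2 ^ (j * card S) * card \<Theta>" by (rule global_\<Theta>[OF SR(1)])
    finally have "real (card {\<tau>\<in>\<Theta>. restrict \<tau> S = s} * fact (card K) ^ card S) \<le> real (2 ^ (j * card S) * card \<Theta>)"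
      by (simp only: of_nat_le_iff)
    then show ?thesis by (simp add: d_def)
  qed
  have "(\<Sum>\<tau>\<in>\<Theta>. F (Q (restrict \<tau> S))) * ?f = (\<Sum>s\<in>?P. \<Sum>\<tau>\<in>{\<tau>\<in>\<Theta>. restrict \<tau> S = s}. F (Q (restrict \<tau> S))) * ?f"
  proof -
    have "(\<lambda>\<tau>. restrict \<tau> S) ` \<Theta> \<subseteq> ?P" using \<Theta> SR R by fastforce
    from sum.group[OF fin\<Theta> finP this, of "\<lambda>\<tau>. F (Q (restrict \<tau> S))"] show ?thesis by simp
  qed
  also have "\<dots> = (\<Sum>s\<in>?P. F (Q s) * (real (card {\<tau>\<in>\<Theta>. restrict \<tau> S = s}) * ?f))"
    by (simp add: sum_distrib_left sum_distrib_right mult_ac)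
  also have "\<dots> \<le> (\<Sum>s\<in>?P. F (Q s) * (2 ^ (j * d) * card \<Theta>))"
    by (intro sum_mono mult_left_mono cellP F0)
  also have "\<dots> = 2 ^ (j * d) * card \<Theta> * (\<Sum>s\<in>?P. F (Q s))"
    by (simp add: sum_distrib_left mult_ac)
  finally have A: "(\<Sum>\<tau>\<in>\<Theta>. F (Q (restrict \<tau> S))) * ?f \<le> 2 ^ (j * d) * card \<Theta> * (\<Sum>s\<in>?P. F (Q s))" .
  have B: "(16 ^ j) ^ d * (\<Sum>s\<in>?P. F (Q s)) \<le> ?f * (\<Sum>W\<in>Pow (S \<times> K). F W)"
  proof -
    have "real (16 ^ j) ^ card S * (\<Sum>s\<in>?P. F {(i,k). i \<in> S \<and> k \<in> K \<and> s i k \<in> U `` {i}})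
           \<le> fact (card K) ^ card S * (\<Sum>W\<in>Pow (S \<times> K). F W)"
      using SR fin K F0 U by (intro sum_over_permuted_le) (auto simp: S_def)
    then show ?thesis by (simp add: Q_def d_def)
  qed
  have C: "(\<Sum>W\<in>Pow (S \<times> K). F W) \<le> 2 ^ (j * d) * (card Y)\<^sup>2"
  proof -
    have "(\<Sum>W\<in>Pow (S \<times> K). F W) \<le> 2 ^ card (S \<times> K) * real (card {(y, y'). y \<in> Y \<and> y' \<in> Y \<and> Sigma R y \<inter> S \<times> K = Sigma R y' \<inter> S \<times> K})"
      unfolding F_def
    proof (rule bessel)
      show "finite (Sigma R y)" if "y \<in> Y" for y
        using PK[OF that] SR(3) fin(2) by (meson finite_SigmaI finite_subset)
    qed (use SR fin finY in \<open>auto simp: V_def\<close>)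
    \<comment> \<open>Members of \<open>Y\<close> that agree on the blocks in \<open>S\<close> share
      a cell, and globalness bounds its size.\<close>
    also have "{(y, y'). y \<in> Y \<and> y' \<in> Y \<and> Sigma R y \<inter> S \<times> K = Sigma R y' \<inter> S \<times> K} \<subseteq> Sigma Y (cell Y S)"
    proof clarify
      fix y y' assume y: "y \<in> Y" "y' \<in> Y" and eq: "Sigma R y \<inter> S \<times> K = Sigma R y' \<inter> S \<times> K"
      have "y i = (Sigma R y \<inter> S \<times> K) `` {i}" "y' i = (Sigma R y' \<inter> S \<times> K) `` {i}" if "i \<in> S" for i
        using that SR PK y by auto
      then show "y' \<in> cell Y S y" using y eq by (auto simp: cell_def)
    qed
    then have "card {(y, y'). y \<in> Y \<and> y' \<in> Y \<and> Sigma R y \<inter> S \<times> K = Sigma R y' \<inter> S \<times> K} \<le> card (Sigma Y (cell Y S))"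
      using finY by (intro card_mono finite_SigmaI) (auto simp: cell_def)
    also have "\<dots> = (\<Sum>y\<in>Y. card (cell Y S y))"
      using finY by (simp add: cell_def)
    finally have "(\<Sum>W\<in>Pow (S \<times> K). F W) \<le> 2 ^ card (S \<times> K) * real (\<Sum>y\<in>Y. card (cell Y S y))"
      by (simp add: mult_left_mono)
    also have "\<dots> = (\<Sum>y\<in>Y. real (card (cell Y S y) * (2 ^ card K) ^ card S))"
    proof -
      have "(2::real) ^ card (S \<times> K) = (2 ^ card K) ^ card S"
        by (simp add: card_cartesian_product mult.commute flip: power_mult)
      then show ?thesis by (simp add: sum_distrib_right mult.commute)
    qed
    also have "\<dots> \<le> (\<Sum>y\<in>Y. real (2 ^ (j * card S) * card Y))"
      by (intro sum_mono of_nat_mono global_Y SR)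
    finally show ?thesis by (simp add: d_def power2_eq_square mult_ac)
  qed
  let ?X = "\<Sum>\<tau>\<in>\<Theta>. F (Q (restrict \<tau> S))"
  have X0: "0 \<le> ?X" using F0 by (intro sum_nonneg)
  have "?f * ((16 ^ j) ^ d * ?X) = (16 ^ j) ^ d * (?X * ?f)" by simp
  also have "\<dots> \<le> (16 ^ j) ^ d * (2 ^ (j * d) * card \<Theta> * (\<Sum>s\<in>?P. F (Q s)))"
    using A by (intro mult_left_mono) auto
  also have "\<dots> = 2 ^ (j * d) * card \<Theta> * ((16 ^ j) ^ d * (\<Sum>s\<in>?P. F (Q s)))" by simp
  also have "\<dots> \<le> 2 ^ (j * d) * card \<Theta> * (?f * (\<Sum>W\<in>Pow (S \<times> K). F W))"
    using B by (intro mult_left_mono) auto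
  also have "\<dots> \<le> 2 ^ (j * d) * card \<Theta> * (?f * (2 ^ (j * d) * (card Y)\<^sup>2))"
    using C by (intro mult_left_mono) auto
  also have "\<dots> = ?f * ((2 ^ (j * d) * 2 ^ (j * d)) * (card \<Theta> * (card Y)\<^sup>2))" by simp
  finally have raw: "(16 ^ j) ^ d * ?X \<le> (2 ^ (j * d) * 2 ^ (j * d)) * (real (card \<Theta>) * (real (card Y))\<^sup>2)"
    by simp
  \<comment> \<open>The two losses \<open>2 ^ (j * d)\<close> use up \<open>4 ^ (j * d)\<close> of
    the orbit factor \<open>16 ^ (j * d)\<close>. What remains is \<open>4 ^ (j * d)\<close>, at
    least \<open>4 ^ j\<close> because \<open>d\<close> is positive.\<close>
  have e: "((16::real) ^ j) ^ d = 4 ^ (j * d) * 4 ^ (j * d)" "(2::real) ^ (j * d) * 2 ^ (j * d) = 4 ^ (j * d)"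
    by (simp_all flip: power_mult_distrib power_mult)
  have "4 ^ (j * d) * (4 ^ (j * d) * ?X) \<le> 4 ^ (j * d) * (real (card \<Theta>) * (real (card Y))\<^sup>2)"
    using raw unfolding e by (simp only: mult.assoc)
  then have "4 ^ (j * d) * ?X \<le> card \<Theta> * (card Y)\<^sup>2" by simp
  moreover have "4 ^ j * ?X \<le> 4 ^ (j * d) * ?X"
    using d X0 by (intro mult_right_mono power_increasing) auto
  ultimately have "4 ^ j * ?X \<le> card \<Theta> * (card Y)\<^sup>2" by linarith
  moreover have "0 < (real (card Y))\<^sup>2" using Y finY by (simp add: card_gt_0_iff)
  ultimately show ?thesis unfolding sum_eq by (simp add: field_simps)
qed

section \<open>Fourier inversion and convolution on a product of blocks\<close>

definition fourier :: "'a set \<Rightarrow> ('a set \<Rightarrow> real) \<Rightarrow> 'a set \<Rightarrow> real"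
  where "fourier J H U = (\<Sum>z\<in>Pow J. H z * chi U z)"

definition block_diff :: "'i set \<Rightarrow> ('i \<Rightarrow> 'k \<Rightarrow> 'k) \<Rightarrow> ('i \<Rightarrow> 'k set) \<Rightarrow> ('i \<Rightarrow> 'k set) \<Rightarrow> ('i \<times> 'k) set"
  where "block_diff R \<tau> y y' = block_act \<tau> ` sym_diff (Sigma R y) (Sigma R y')"

text \<open>Convolution of \<open>H\<close> with the law of \<open>block_diff R \<tau> y y'\<close>
  for independent uniform \<open>y\<close>, \<open>y'\<close> in \<open>Y\<close>. Taking a
  difference makes the Fourier multiplier a square.\<close>

definition conv :: "('i \<Rightarrow> 'k set) set \<Rightarrow> 'i set \<Rightarrow> ('i \<Rightarrow> 'k \<Rightarrow> 'k) \<Rightarrow> (('i \<times> 'k) set \<Rightarrow> real) \<Rightarrow> ('i \<times> 'k) set \<Rightarrow> real"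
  where "conv Y R \<tau> H z = (\<Sum>(y,y')\<in>Y \<times> Y. H (sym_diff z (block_diff R \<tau> y y'))) / (real (card Y))\<^sup>2"

lemma fourier_inversion:
  assumes "finite J" "v \<subseteq> J"
  shows "(\<Sum>U\<in>Pow J. fourier J H U * chi U v) = 2 ^ card J * H v"
proof -
  have "(\<Sum>U\<in>Pow J. fourier J H U * chi U v) = (\<Sum>z\<in>Pow J. H z * (\<Sum>U\<in>Pow J. chi U (sym_diff z v)))"
  proof -
    have "fourier J H U * chi U v = (\<Sum>z\<in>Pow J. H z * chi U (sym_diff z v))" for U
    proof -
      have "chi U (sym_diff z v) = chi U z * chi U v" if "z \<in> Pow J" for z
        using that assms by (intro chi_sym_diff) (auto intro: finite_subset)
      then show ?thesis by (simp add: fourier_def sum_distrib_right mult.assoc)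
    qed
    then show ?thesis by (simp add: sum_distrib_left) (rule sum.swap)
  qed
  also have "\<dots> = (\<Sum>z\<in>Pow J. if z = v then 2 ^ card J * H z else 0)"
  proof (rule sum.cong[OF refl])
    fix z assume "z \<in> Pow J"
    then have "(\<Sum>U\<in>Pow J. chi U (sym_diff z v)) = (if sym_diff z v = {} then 2 ^ card J else 0)"
      using assms by (intro sum_chi) auto
    moreover have "sym_diff z v = {} \<longleftrightarrow> z = v" by auto
    ultimately show "H z * (\<Sum>U\<in>Pow J. chi U (sym_diff z v)) = (if z = v then 2 ^ card J * H z else 0)" by simp
  qed
  also have "\<dots> = 2 ^ card J * H v" using assms by simp
  finally show ?thesis .
qed

lemma block_act_bij:
  assumes "\<And>i. i \<in> R \<Longrightarrow> \<tau> i permutes K"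
  shows "bij_betw (block_act \<tau>) (R \<times> K) (R \<times> K)"
proof (rule bij_betw_imageI)
  show "inj_on (block_act \<tau>) (R \<times> K)"
    using assms by (auto simp: inj_on_def block_act_def dest: permutes_inj[THEN injD])
  show "block_act \<tau> ` (R \<times> K) = R \<times> K"
  proof (intro equalityI subsetI)
    fix x assume x: "x \<in> R \<times> K"
    then have "snd x \<in> \<tau> (fst x) ` K" using permutes_image[OF assms, of "fst x"] by auto
    then show "x \<in> block_act \<tau> ` (R \<times> K)" using x by (force simp: block_act_def)
  qed (use assms in \<open>auto simp: block_act_def permutes_in_image\<close>)
qed

lemma fourier_conv:
  fixes Y :: "('i \<Rightarrow> 'k set) set"
  assumes fin: "finite R" "finite K" "finite Y" and \<tau>: "\<And>i. i \<in> R \<Longrightarrow> \<tau> i permutes K"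
    and Y: "\<And>y i. y \<in> Y \<Longrightarrow> i \<in> R \<Longrightarrow> y i \<subseteq> K"
  shows "fourier (R \<times> K) (conv Y R \<tau> H) U = fourier (R \<times> K) H U * (block_chars Y R (block_act \<tau> -` U))\<^sup>2"
proof -
  let ?J = "R \<times> K"
  have bij: "bij_betw (block_act \<tau>) ?J ?J" using \<tau> by (rule block_act_bij)
  let ?w = "\<lambda>(y,y'). block_diff R \<tau> y y'"
  have *: "(\<Sum>z\<in>Pow ?J. H (sym_diff z (?w p)) * chi U z)
      = fourier ?J H U * (chi (block_act \<tau> -` U) (Sigma R (fst p)) * chi (block_act \<tau> -` U) (Sigma R (snd p)))"
    if p: "p \<in> Y \<times> Y" for p
  proof -
    let ?s = "sym_diff (Sigma R (fst p)) (Sigma R (snd p))"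
    have s: "?s \<subseteq> ?J" "Sigma R (fst p) \<subseteq> ?J" "Sigma R (snd p) \<subseteq> ?J" using p Y by fastforce+
    have w: "?w p = block_act \<tau> ` ?s" by (simp add: block_diff_def case_prod_unfold)
    have wJ: "?w p \<subseteq> ?J" using bij s unfolding w bij_betw_def by blast
    have "(\<Sum>z\<in>Pow ?J. H (sym_diff z (?w p)) * chi U z) = (\<Sum>z\<in>Pow ?J. H z * chi U (sym_diff z (?w p)))"
      by (rule sum.reindex_bij_witness[of _ "\<lambda>z. sym_diff z (?w p)" "\<lambda>z. sym_diff z (?w p)"])
        (use wJ in \<open>auto intro!: arg_cong[where f = "chi U"]\<close>)
    also have "\<dots> = (\<Sum>z\<in>Pow ?J. H z * (chi U z * chi U (?w p)))"
      using fin wJ by (intro sum.cong refl arg_cong2[where f = "(*)"] chi_sym_diff) (auto intro: finite_subset)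
    also have "\<dots> = fourier ?J H U * chi U (?w p)"
      by (simp add: fourier_def sum_distrib_right mult.assoc)
    also have "chi U (?w p) = chi (block_act \<tau> -` U) ?s"
      unfolding w using bij s by (intro chi_image) (auto simp: bij_betw_def intro: inj_on_subset)
    also have "\<dots> = chi (block_act \<tau> -` U) (Sigma R (fst p)) * chi (block_act \<tau> -` U) (Sigma R (snd p))"
      using s fin by (intro chi_sym_diff) (auto intro: finite_subset)
    finally show ?thesis .
  qed
  have "fourier ?J (conv Y R \<tau> H) U = (\<Sum>z\<in>Pow ?J. \<Sum>p\<in>Y \<times> Y. H (sym_diff z (?w p)) * chi U z) / (real (card Y))\<^sup>2"
    by (simp add: fourier_def conv_def case_prod_unfold sum_distrib_right sum_divide_distrib)
  also have "(\<Sum>z\<in>Pow ?J. \<Sum>p\<in>Y \<times> Y. H (sym_diff z (?w p)) * chi U z) = (\<Sum>p\<in>Y \<times> Y. \<Sum>z\<in>Pow ?J. H (sym_diff z (?w p)) * chi U z)"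
    by (rule sum.swap)
  also have "\<dots> = (\<Sum>p\<in>Y \<times> Y. fourier ?J H U * (chi (block_act \<tau> -` U) (Sigma R (fst p)) * chi (block_act \<tau> -` U) (Sigma R (snd p))))"
    using * by (rule sum.cong[OF refl])
  also have "\<dots> = fourier ?J H U * (\<Sum>y\<in>Y. chi (block_act \<tau> -` U) (Sigma R y))\<^sup>2"
  proof -
    have "(\<Sum>y\<in>Y. g y)\<^sup>2 = (\<Sum>p\<in>Y \<times> Y. g (fst p) * g (snd p))" for g :: "('i \<Rightarrow> 'k set) \<Rightarrow> real"
      by (simp add: power2_eq_square sum_product sum.cartesian_product case_prod_unfold)
    then show ?thesis by (simp add: sum_distrib_left)
  qed
  finally show ?thesis by (simp add: block_chars_def power_divide)
qed

text \<open>The case of \<open>bessel\<close> in which agreement on \<open>J\<close> forces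
  equality, since members of \<open>Y\<close> coincide off \<open>R\<close>; \<open>\<tau>\<close>
  only permutes the characters. It bounds the mass with which the iterated convolutions
  start.\<close>

lemma parseval_block_chars:
  fixes Y :: "('i \<Rightarrow> 'k set) set"
  assumes fin: "finite I" "finite K" and R: "R \<subseteq> I"
    and Y: "Y \<subseteq> PiE I (\<lambda>_. Pow K)" "Y \<noteq> {}"
    and const: "\<And>y y' i. y \<in> Y \<Longrightarrow> y' \<in> Y \<Longrightarrow> i \<in> I - R \<Longrightarrow> y i = y' i"
    and dense: "(2 ^ card K) ^ card R \<le> card Y * 2 ^ a"
    and \<tau>: "\<And>i. i \<in> R \<Longrightarrow> \<tau> i permutes K"
  shows "(\<Sum>U\<in>Pow (R \<times> K). (block_chars Y R (block_act \<tau> -` U))\<^sup>2) \<le> 2 ^ a"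
proof -
  let ?J = "R \<times> K"
  have finY: "finite Y" using Y fin by (meson finite_PiE finite_Pow_iff finite_subset)
  have finJ: "finite ?J" using fin R by (auto intro: finite_subset)
  have PK: "y i \<subseteq> K" if "y \<in> Y" "i \<in> R" for y i
    using that Y R by (auto dest!: subsetD[OF Y(1)] dest: PiE_mem)
  have bij: "bij_betw (block_act \<tau>) ?J ?J" using \<tau> by (rule block_act_bij)
  let ?f = "\<lambda>U. (block_chars Y R U)\<^sup>2"
  let ?p = "\<lambda>U. block_act \<tau> -` U \<inter> ?J"
  have "?f (block_act \<tau> -` U) = ?f (?p U)" for U
  proof -
    have "chi (block_act \<tau> -` U) (Sigma R y) = chi (?p U) (Sigma R y)" if y: "y \<in> Y" for y
    proof -
      have "block_act \<tau> -` U \<inter> Sigma R y = ?p U \<inter> Sigma R y" using PK[OF y] by auto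
      then show ?thesis by (simp add: chi_def)
    qed
    then show ?thesis by (simp add: block_chars_def)
  qed
  then have "(\<Sum>U\<in>Pow ?J. ?f (block_act \<tau> -` U)) = (\<Sum>U\<in>Pow ?J. ?f (?p U))" by simp
  also have "\<dots> = (\<Sum>U\<in>?p ` Pow ?J. ?f U)"
  proof -
    have "inj_on ?p (Pow ?J)"
    proof (rule inj_on_inverseI[where g = "\<lambda>W. block_act \<tau> ` W"])
      fix U assume "U \<in> Pow ?J"
      then have "U \<subseteq> block_act \<tau> ` ?J" using bij by (simp add: bij_betw_def)
      then show "block_act \<tau> ` ?p U = U" by auto
    qed
    then show ?thesis by (simp add: sum.reindex)
  qed
  also have "\<dots> \<le> (\<Sum>U\<in>Pow ?J. ?f U)" using finJ by (intro sum_mono2) auto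
  also have "\<dots> = (\<Sum>U\<in>Pow ?J. (\<Sum>y\<in>Y. chi (U \<union> {}) (Sigma R y))\<^sup>2) / (real (card Y))\<^sup>2"
    by (simp add: block_chars_def power_divide flip: sum_divide_distrib)
  also have "\<dots> \<le> (2 ^ card ?J * real (card {(y,y'). y \<in> Y \<and> y' \<in> Y \<and> Sigma R y \<inter> ?J = Sigma R y' \<inter> ?J})) / (real (card Y))\<^sup>2"
  proof (intro divide_right_mono bessel)
    show "finite (Sigma R y)" if "y \<in> Y" for y
      using PK[OF that] fin R by (meson finite_SigmaI finite_subset)
  qed (use finJ finY in auto)
  also have "{(y,y'). y \<in> Y \<and> y' \<in> Y \<and> Sigma R y \<inter> ?J = Sigma R y' \<inter> ?J} = (\<lambda>y. (y,y)) ` Y"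
  proof (intro equalityI subsetI)
    fix p assume "p \<in> {(y,y'). y \<in> Y \<and> y' \<in> Y \<and> Sigma R y \<inter> ?J = Sigma R y' \<inter> ?J}"
    then obtain y y' where p: "p = (y,y')" and y: "y \<in> Y" "y' \<in> Y" and eq: "Sigma R y \<inter> ?J = Sigma R y' \<inter> ?J" by blast
    have "y = y'"
    proof (rule PiE_ext[of y I "\<lambda>_. Pow K" y'])
      fix i assume i: "i \<in> I"
      show "y i = y' i"
      proof (cases "i \<in> R")
        case True
        then have "y i = (Sigma R y \<inter> ?J) `` {i}" "y' i = (Sigma R y' \<inter> ?J) `` {i}" using PK y by auto
        then show ?thesis using eq by simp
      qed (use const y i in auto)
    qed (use y Y in auto)
    then show "p \<in> (\<lambda>y. (y,y)) ` Y" using p y by auto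
  qed auto
  also have "card ((\<lambda>y. (y,y)) ` Y) = card Y" by (intro card_image inj_onI) auto
  also have "2 ^ card ?J * real (card Y) / (real (card Y))\<^sup>2 \<le> 2 ^ a"
  proof -
    have "real ((2 ^ card K) ^ card R) \<le> real (card Y * 2 ^ a)" using dense by (simp only: of_nat_le_iff)
    then have "(2::real) ^ card ?J \<le> card Y * 2 ^ a"
      by (simp add: card_cartesian_product mult.commute flip: power_mult)
    moreover have "0 < real (card Y)" using Y finY by (simp add: card_gt_0_iff)
    ultimately show ?thesis by (simp add: power2_eq_square field_simps)
  qed
  finally show ?thesis .
qed

lemma even_card_blocks:
  assumes "finite R" "finite K" "v \<subseteq> R \<times> K" "\<And>i. i \<in> R \<Longrightarrow> even (card (v `` {i}))"
    and U: "\<not> nontriv R K U"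
  shows "chi U v = 1"
proof -
  let ?w = "\<lambda>i. (U \<inter> v) `` {i}"
  have "U \<inter> v = Sigma R ?w" using assms by auto
  moreover have "card (Sigma R ?w) = (\<Sum>i\<in>R. card (?w i))"
  proof (rule card_SigmaI[OF assms(1)])
    show "\<forall>i\<in>R. finite (?w i)" using assms by (auto intro!: finite_subset[of _ K])
  qed
  moreover have "even (card (?w i))" if i: "i \<in> R" for i
  proof -
    have "U `` {i} = {} \<or> U `` {i} = K" using U i by (auto simp: nontriv_def)
    then have "?w i = {} \<or> ?w i = v `` {i}" using assms(3) by auto
    then show ?thesis using assms(4)[OF i] by (auto simp: card.empty)
  qed
  ultimately have "even (card (U \<inter> v))" by (simp add: dvd_sum)
  then show ?thesis by (simp add: chi_def)
qed

text \<open>\<open>P m z\<close> abstracts from reachability of \<open>z\<close> by \<open>m\<close> summands. The permutations \<open>\<tau>\<close> are chosen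
  greedily such that each convolution shrinks the total mass of the nontrivial Fourier coefficients
  by a factor \<open>4 ^ j\<close>. The trivial characters are \<open>1\<close> on every \<open>v\<close> that is even in all
  blocks, and their coefficients are nonnegative, so they do no harm.\<close>

lemma block_sumset:
  fixes Y :: "('i \<Rightarrow> 'k set) set" and \<Theta> :: "('i \<Rightarrow> 'k \<Rightarrow> 'k) set" and P :: "nat \<Rightarrow> ('i \<times> 'k) set \<Rightarrow> bool"
  assumes fin: "finite I" "finite K" and K: "2 * 16 ^ j \<le> card K" and j: "0 < j"
    and \<Theta>: "\<Theta> \<subseteq> PiE I (\<lambda>_. {p. p permutes K})" "\<Theta> \<noteq> {}"
    and Y: "Y \<subseteq> PiE I (\<lambda>_. Pow K)" "Y \<noteq> {}"
    and dense_\<Theta>: "fact (card K) ^ card I \<le> card \<Theta> * 2 ^ a"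
    and dense_Y: "(2 ^ card K) ^ card I \<le> card Y * 2 ^ a"
    and P0: "P 0 {}"
    and step: "\<And>m z \<tau> y y'. P m z \<Longrightarrow> \<tau> \<in> \<Theta> \<Longrightarrow> y \<in> Y \<Longrightarrow> y' \<in> Y \<Longrightarrow> P (Suc m) (sym_diff z (block_diff I \<tau> y y'))"
  shows "\<exists>S\<subseteq>I. j * card S \<le> 2 * a \<and>
    (\<forall>v. v \<subseteq> (I - S) \<times> K \<longrightarrow> (\<forall>i\<in>I. even (card (v `` {i}))) \<longrightarrow> P (a div j + 2) v)"
proof -
  have card_perm: "card {p. p permutes K} = fact (card K)" "finite {p. p permutes K}"
    using fin by (auto simp: card_permutations finite_permutations)
  obtain S2 t0 where S2: "S2 \<subseteq> I" "j * card S2 \<le> a"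
    and global_\<Theta>: "\<And>S' s. S' \<subseteq> I - S2 \<Longrightarrow>
       card (cell (cell \<Theta> S2 t0) S' s) * fact (card K) ^ card S' \<le> 2 ^ (j * card S') * card (cell \<Theta> S2 t0)"
    and t0: "t0 \<in> \<Theta>"
    using globalise[OF fin(1) card_perm(2) \<Theta>, of a "{}" j] dense_\<Theta> card_perm(1)
    by (metis (no_types, lifting) card.empty empty_subsetI minus_nat.diff_0)
  \<comment> \<open>\<open>Y\<close> is globalised on top of the coordinates already fixed for
    \<open>\<Theta>\<close>, so that both sets are global on the complement of one and the same
    \<open>S\<close>.\<close>
  obtain S y0 where S: "S2 \<subseteq> S" "S \<subseteq> I" "j * (card S - card S2) \<le> a"
    and y0: "y0 \<in> Y" and dense_cell: "(2 ^ card K) ^ (card I - card S) \<le> card (cell Y S y0) * 2 ^ a"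
    and global_Y: "\<And>S' s. S' \<subseteq> I - S \<Longrightarrow>
       card (cell (cell Y S y0) S' s) * (2 ^ card K) ^ card S' \<le> 2 ^ (j * card S') * card (cell Y S y0)"
    using globalise[OF fin(1) _ Y, of a S2 j] dense_Y S2(1) fin(2)
    by (metis (no_types, lifting) card_Pow finite_Pow_iff)
  define \<Theta>' where "\<Theta>' = cell \<Theta> S2 t0"
  define Y' where "Y' = cell Y S y0"
  define R where "R = I - S"
  let ?J = "R \<times> K"
  let ?c = "\<lambda>\<tau> U. (block_chars Y' R (block_act \<tau> -` U))\<^sup>2"
  let ?F = "fourier ?J"
  let ?N = "{U\<in>Pow ?J. nontriv R K U}"
  have finS: "finite S" "finite R" using S fin by (auto simp: R_def intro: finite_subset)
  have finJ: "finite ?J" "finite (Pow ?J)" using finS fin by auto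
  have \<Theta>': "\<Theta>' \<subseteq> \<Theta>" "\<Theta>' \<noteq> {}" "\<Theta>' \<subseteq> PiE I (\<lambda>_. {p. p permutes K})" using t0 \<Theta> by (auto simp: \<Theta>'_def cell_def)
  have fin\<Theta>': "finite \<Theta>'" by (rule finite_subset[OF \<Theta>'(3)]) (use fin card_perm in \<open>auto intro!: finite_PiE\<close>)
  have Y': "Y' \<subseteq> Y" "Y' \<noteq> {}" "Y' \<subseteq> PiE I (\<lambda>_. Pow K)" using y0 Y by (auto simp: Y'_def cell_def)
  have finY': "finite Y'" by (rule finite_subset[OF Y'(3)]) (use fin in \<open>auto intro!: finite_PiE\<close>)
  have PK: "y i \<subseteq> K" if "y \<in> Y'" "i \<in> R" for y i
    using that Y' by (auto simp: R_def dest!: subsetD[OF Y'(3)] dest: PiE_mem)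
  have perm: "\<tau> i permutes K" if "\<tau> \<in> \<Theta>'" "i \<in> R" for \<tau> i
    using that by (auto simp: R_def dest!: subsetD[OF \<Theta>'(3)] dest: PiE_mem)
  have decay: "4 ^ j * (\<Sum>\<tau>\<in>\<Theta>'. ?c \<tau> U) \<le> card \<Theta>'" if "U \<in> ?N" for U
  proof (rule average_decay[OF fin K _ \<Theta>'(3) Y'(3,2)])
    fix S' :: "'i set" and s :: "'i \<Rightarrow> 'k \<Rightarrow> 'k"
    assume "S' \<subseteq> R"
    then have "S' \<subseteq> I - S2" using S by (auto simp: R_def)
    then show "card (cell \<Theta>' S' s) * fact (card K) ^ card S' \<le> 2 ^ (j * card S') * card \<Theta>'"
      unfolding \<Theta>'_def by (rule global_\<Theta>)
  next
    fix S' :: "'i set" and s :: "'i \<Rightarrow> 'k set"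
    assume "S' \<subseteq> R"
    then show "card (cell Y' S' s) * (2 ^ card K) ^ card S' \<le> 2 ^ (j * card S') * card Y'"
      unfolding Y'_def R_def by (rule global_Y)
  qed (use that in \<open>auto simp: R_def\<close>)
  have parseval: "(\<Sum>U\<in>Pow ?J. ?c \<tau> U) \<le> 2 ^ a" if "\<tau> \<in> \<Theta>'" for \<tau>
  proof (rule parseval_block_chars[OF fin _ Y'(3,2)])
    show "(2 ^ card K) ^ card R \<le> card Y' * 2 ^ a"
      using dense_cell S finS by (simp add: R_def Y'_def card_Diff_subset)
  qed (use perm[OF that] in \<open>auto simp: R_def Y'_def cell_def\<close>)
  have diff: "block_diff R \<tau> y y' = block_diff I \<tau> y y'" if "y \<in> Y'" "y' \<in> Y'" for \<tau> y y'
  proof -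
    have "sym_diff (Sigma R y) (Sigma R y') = sym_diff (Sigma I y) (Sigma I y')"
      using that by (auto simp: R_def Y'_def cell_def)
    then show ?thesis by (simp add: block_diff_def)
  qed
  have conv: "(\<forall>z. 0 \<le> conv Y' R \<tau> H z) \<and> (\<forall>z. conv Y' R \<tau> H z \<noteq> 0 \<longrightarrow> P (Suc m) z) \<and>
      (\<forall>U. ?F (conv Y' R \<tau> H) U = ?F H U * ?c \<tau> U)"
    if \<tau>: "\<tau> \<in> \<Theta>'" and H: "\<forall>z. 0 \<le> H z" "\<forall>z. H z \<noteq> 0 \<longrightarrow> P m z" for \<tau> H m
  proof (intro conjI allI impI)
    fix z
    show "0 \<le> conv Y' R \<tau> H z" using H unfolding conv_def by (auto intro!: divide_nonneg_nonneg sum_nonneg)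
    assume "conv Y' R \<tau> H z \<noteq> 0"
    then have "(\<Sum>(y,y')\<in>Y' \<times> Y'. H (sym_diff z (block_diff R \<tau> y y'))) \<noteq> 0" by (auto simp: conv_def)
    then obtain p where p: "p \<in> Y' \<times> Y'" "H (sym_diff z (block_diff R \<tau> (fst p) (snd p))) \<noteq> 0"
      by (metis (no_types, lifting) case_prod_unfold sum.neutral)
    then have "P (Suc m) (sym_diff (sym_diff z (block_diff R \<tau> (fst p) (snd p))) (block_diff I \<tau> (fst p) (snd p)))"
      using \<tau> \<Theta>' Y' H by (intro step) auto
    also have "sym_diff (sym_diff z (block_diff R \<tau> (fst p) (snd p))) (block_diff I \<tau> (fst p) (snd p)) = z"
      using diff[of "fst p" "snd p" \<tau>] p by auto
    finally show "P (Suc m) z" .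
  next
    fix U
    show "?F (conv Y' R \<tau> H) U = ?F H U * ?c \<tau> U"
      by (rule fourier_conv) (use finS fin finY' perm[OF \<tau>] PK in auto)
  qed
  have c_empty: "?c \<tau> {} = 1" for \<tau>
    using Y' finY' by (simp add: block_chars_def)
  have "\<exists>H. (\<forall>z. 0 \<le> H z) \<and> (\<forall>z. H z \<noteq> 0 \<longrightarrow> P (Suc m) z) \<and> (\<forall>U. 0 \<le> ?F H U) \<and> ?F H {} = 1
       \<and> 4 ^ (j * m) * (\<Sum>U\<in>?N. ?F H U) \<le> 2 ^ a" for m
  proof (induction m)
    case 0
    define H :: "('i \<times> 'k) set \<Rightarrow> real" where "H z = (if z = {} then 1 else 0)" for z
    have FH: "?F H U = 1" for U
    proof -
      have "?F H U = (\<Sum>z\<in>Pow ?J. if z = {} then 1 else 0)" unfolding fourier_def H_def by (intro sum.cong) auto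
      then show ?thesis using finJ by simp
    qed
    \<comment> \<open>The point mass has all coefficients one, so its nontrivial mass may be far
      above \<open>2 ^ a\<close>. One convolution with any member of \<open>\<Theta>'\<close> brings
      it down by Parseval; this factor is the shift from \<open>m\<close> to
      \<open>Suc m\<close>.\<close>
    have "t0 \<in> \<Theta>'" using t0 by (auto simp: \<Theta>'_def cell_def)
    note c = conv[OF this, of H 0]
    have "(\<Sum>U\<in>?N. ?F (conv Y' R t0 H) U) = (\<Sum>U\<in>?N. ?c t0 U)" using c FH P0 by (auto simp: H_def)
    also have "\<dots> \<le> (\<Sum>U\<in>Pow ?J. ?c t0 U)" using finJ by (intro sum_mono2) auto
    also have "\<dots> \<le> 2 ^ a" using \<open>t0 \<in> \<Theta>'\<close> by (rule parseval)
    finally show ?case using c FH P0 c_empty by (intro exI[of _ "conv Y' R t0 H"]) (auto simp: H_def)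
  next
    case (Suc m)
    then obtain H where H: "\<forall>z. 0 \<le> H z" "\<forall>z. H z \<noteq> 0 \<longrightarrow> P (Suc m) z" "\<forall>U. 0 \<le> ?F H U" "?F H {} = 1"
      "4 ^ (j * m) * (\<Sum>U\<in>?N. ?F H U) \<le> 2 ^ a" by blast
    let ?s = "\<lambda>\<tau>. 4 ^ j * (\<Sum>U\<in>?N. ?F H U * ?c \<tau> U)"
    have "(\<Sum>\<tau>\<in>\<Theta>'. ?s \<tau>) = (\<Sum>U\<in>?N. ?F H U * (4 ^ j * (\<Sum>\<tau>\<in>\<Theta>'. ?c \<tau> U)))"
      unfolding sum_distrib_left by (subst sum.swap) (simp add: mult_ac)
    also have "\<dots> \<le> (\<Sum>U\<in>?N. ?F H U * card \<Theta>')"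
      using decay H by (intro sum_mono mult_left_mono) auto
    also have "\<dots> = (\<Sum>\<tau>\<in>\<Theta>'. \<Sum>U\<in>?N. ?F H U)" by (simp add: sum_distrib_left mult.commute)
    finally obtain \<tau> where \<tau>: "\<tau> \<in> \<Theta>'" "?s \<tau> \<le> (\<Sum>U\<in>?N. ?F H U)"
      using fin\<Theta>' \<Theta>'(2) by (meson linorder_not_le sum_strict_mono)
    note c = conv[OF \<tau>(1) H(1,2)]
    have "4 ^ (j * Suc m) * (\<Sum>U\<in>?N. ?F (conv Y' R \<tau> H) U) = 4 ^ (j * m) * ?s \<tau>"
      using c by (simp add: power_add mult_ac)
    also have "\<dots> \<le> 4 ^ (j * m) * (\<Sum>U\<in>?N. ?F H U)" using \<tau> by (intro mult_left_mono) auto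
    also have "\<dots> \<le> 2 ^ a" by (rule H(5))
    finally show ?case using c H c_empty by (intro exI[of _ "conv Y' R \<tau> H"]) auto
  qed
  \<comment> \<open>After the initial convolution, \<open>a div j + 1\<close> more suffice:
    \<open>4 ^ (j * (a div j + 1))\<close> exceeds \<open>2 ^ a\<close>, so the nontrivial mass
    drops below one, the coefficient of the empty character.\<close>
  from this[of "a div j + 1"] obtain H where H: "\<forall>z. 0 \<le> H z" "\<forall>z. H z \<noteq> 0 \<longrightarrow> P (a div j + 2) z" "\<forall>U. 0 \<le> ?F H U" "?F H {} = 1"
      "4 ^ (j * (a div j + 1)) * (\<Sum>U\<in>?N. ?F H U) \<le> 2 ^ a" by auto
  have small: "(\<Sum>U\<in>?N. ?F H U) < 1"
  proof (rule ccontr)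
    assume "\<not> ?thesis"
    then have "(4::real) ^ (j * (a div j + 1)) * 1 \<le> 4 ^ (j * (a div j + 1)) * (\<Sum>U\<in>?N. ?F H U)"
      by (intro mult_left_mono) auto
    then have "(4::real) ^ (j * (a div j + 1)) \<le> 2 ^ a" using H(5) by linarith
    moreover have "a < j * (a div j + 1)" using j by (simp add: dividend_less_times_div)
    then have "(2::real) ^ a < 2 ^ (j * (a div j + 1))" by simp
    moreover have "(2::real) ^ (j * (a div j + 1)) \<le> 4 ^ (j * (a div j + 1))" by (intro power_mono) auto
    ultimately show False by linarith
  qed
  have "P (a div j + 2) v" if v: "v \<subseteq> (I - S) \<times> K" "\<forall>i\<in>I. even (card (v `` {i}))" for v
  proof -
    have vJ: "v \<subseteq> ?J" using v by (simp add: R_def)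
    let ?T = "{U\<in>Pow ?J. \<not> nontriv R K U}"
    have PJ: "Pow ?J = ?T \<union> ?N" by auto
    have "(\<Sum>U\<in>Pow ?J. ?F H U * chi U v) = (\<Sum>U\<in>?T. ?F H U * chi U v) + (\<Sum>U\<in>?N. ?F H U * chi U v)"
      by (subst PJ, rule sum.union_disjoint) (use finJ in auto)
    moreover have "(\<Sum>U\<in>?T. ?F H U * chi U v) = (\<Sum>U\<in>?T. ?F H U)"
      using even_card_blocks[OF finS(2) fin(2) vJ] v by (intro sum.cong) (auto simp: R_def)
    moreover have "(\<Sum>U\<in>{{}}. ?F H U) \<le> (\<Sum>U\<in>?T. ?F H U)"
      using finJ H by (intro sum_mono2) (auto simp: nontriv_def)
    moreover have "(\<Sum>U\<in>?N. - ?F H U) \<le> (\<Sum>U\<in>?N. ?F H U * chi U v)"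
    proof (rule sum_mono)
      fix U
      have "\<bar>?F H U * chi U v\<bar> = ?F H U" using H by (simp add: abs_mult)
      then show "- ?F H U \<le> ?F H U * chi U v" by linarith
    qed
    ultimately have "0 < (\<Sum>U\<in>Pow ?J. ?F H U * chi U v)"
      using small H(4) by (simp add: sum_negf)
    then have "H v \<noteq> 0" using fourier_inversion[OF finJ(1) vJ, of H] by auto
    then show ?thesis using H by blast
  qed
  moreover have "j * card S \<le> 2 * a"
  proof -
    have "card S2 \<le> card S" using S finS by (intro card_mono)
    then have "j * card S = j * (card S - card S2) + j * card S2" by (simp flip: distrib_left)
    then show ?thesis using S S2 by linarith
  qed
  ultimately show ?thesis using S by blast
qed

section \<open>Flips of pairs of points\<close>

lemma map_permutation_comp:
  assumes "inj_on f A" "q ` A \<subseteq> A"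
  shows "map_permutation A f p \<circ> map_permutation A f q = map_permutation A f (p \<circ> q)"
proof
  fix y show "(map_permutation A f p \<circ> map_permutation A f q) y = map_permutation A f (p \<circ> q) y"
  proof (cases "y \<in> f ` A")
    case True
    then obtain x where "x \<in> A" "y = f x" by blast
    moreover from this have "q x \<in> A" using assms by auto
    ultimately show ?thesis using assms by (simp add: map_permutation_apply)
  qed (simp add: map_permutation_def)
qed

lemma map_permutation_permutes_superset:
  assumes "inj_on f A" "bij_betw q A A" "f ` A \<subseteq> B"
  shows "map_permutation A f q permutes B"
proof (rule permutes_subset[OF _ assms(3)])
  have "map_permutation A f (restrict_id q A) permutes f ` A"
    using assms by (intro map_permutation_permutes permutes_restrict_id) (auto simp: bij_betw_def)
  also have "map_permutation A f (restrict_id q A) = map_permutation A f q"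
    using assms by (intro map_permutation_cong_strong) (auto simp: bij_betw_def)
  finally show "map_permutation A f q permutes f ` A" .
qed

text \<open>\<open>c\<close> sends \<open>(x, False)\<close> and \<open>(x, True)\<close> to the two
  points of the pair labelled \<open>x\<close>. The flips form an elementary abelian 2-group,
  identified with the subsets of \<open>J\<close> under symmetric difference.\<close>

definition flips :: "'a set \<Rightarrow> ('a \<times> bool \<Rightarrow> nat) \<Rightarrow> 'a set \<Rightarrow> nat \<Rightarrow> nat"
  where "flips J c v = map_permutation (J \<times> UNIV) c (\<lambda>(x, s). (x, if x \<in> v then \<not> s else s))"

text \<open>Pairs go to pairs without mixing the two sides, so conjugation by a move just relabels
  flips.\<close>

definition moves :: "'a set \<Rightarrow> ('a \<times> bool \<Rightarrow> nat) \<Rightarrow> ('a \<Rightarrow> 'a) \<Rightarrow> nat \<Rightarrow> nat"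
  where "moves J c \<pi> = map_permutation (J \<times> UNIV) c (\<lambda>(x, s). (\<pi> x, s))"

lemma flips_apply:
  assumes "inj_on c (J \<times> UNIV)" "x \<in> J"
  shows "flips J c v (c (x, s)) = c (x, if x \<in> v then \<not> s else s)"
  unfolding flips_def using assms by (subst map_permutation_apply) auto

lemma flips_apply_other: "p \<notin> c ` (J \<times> UNIV) \<Longrightarrow> flips J c v p = p"
  by (simp add: flips_def map_permutation_def)

lemma flips_permutes:
  assumes "inj_on c (J \<times> UNIV)" "c ` (J \<times> UNIV) \<subseteq> B"
  shows "flips J c v permutes B"
  unfolding flips_def
proof (rule map_permutation_permutes_superset[OF assms(1) _ assms(2)])
  let ?f = "\<lambda>(x, s). (x, if x \<in> v then \<not> s else s)"
  show "bij_betw ?f (J \<times> UNIV) (J \<times> UNIV)"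
    by (rule bij_betw_byWitness[of _ ?f]) (auto split: if_splits)
qed

lemma flips_comp:
  assumes "inj_on c (J \<times> UNIV)"
  shows "flips J c v \<circ> flips J c w = flips J c (sym_diff v w)"
proof -
  have "(\<lambda>(x, s). (x, if x \<in> w then \<not> s else s)) ` (J \<times> UNIV) \<subseteq> J \<times> UNIV" by auto
  moreover have "(\<lambda>(x, s). (x, if x \<in> v then \<not> s else s)) \<circ> (\<lambda>(x, s). (x, if x \<in> w then \<not> s else s))
      = (\<lambda>(x, s). (x, if x \<in> sym_diff v w then \<not> s else s))" by (auto simp: fun_eq_iff)
  ultimately show ?thesis unfolding flips_def by (simp add: map_permutation_comp[OF assms])
qed

lemma flips_empty: "inj_on c (J \<times> UNIV) \<Longrightarrow> flips J c {} = id"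
  by (simp add: flips_def map_permutation_ident' case_prod_unfold id_def)

lemma moves_permutes:
  assumes "inj_on c (J \<times> UNIV)" "c ` (J \<times> UNIV) \<subseteq> B" "bij_betw \<pi> J J"
  shows "moves J c \<pi> permutes B"
  unfolding moves_def
proof (rule map_permutation_permutes_superset[OF assms(1) _ assms(2)])
  show "bij_betw (\<lambda>(x, s). (\<pi> x, s)) (J \<times> UNIV) (J \<times> UNIV)"
  proof (rule bij_betw_imageI)
    show "inj_on (\<lambda>(x, s). (\<pi> x, s)) (J \<times> UNIV)" using assms(3) by (auto simp: bij_betw_def inj_on_def)
    show "(\<lambda>(x, s). (\<pi> x, s)) ` (J \<times> UNIV) = J \<times> UNIV" using assms(3) by (force simp: bij_betw_def)
  qed
qed

lemma moves_flips:
  assumes "inj_on c (J \<times> UNIV)" "bij_betw \<pi> J J" "v \<subseteq> J"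
  shows "moves J c \<pi> \<circ> flips J c v = flips J c (\<pi> ` v) \<circ> moves J c \<pi>"
proof
  fix p show "(moves J c \<pi> \<circ> flips J c v) p = (flips J c (\<pi> ` v) \<circ> moves J c \<pi>) p"
  proof (cases "p \<in> c ` (J \<times> UNIV)")
    case True
    then obtain x s where x: "x \<in> J" "p = c (x, s)" by auto
    have "\<pi> x \<in> J" using assms(2) x by (auto simp: bij_betw_def)
    moreover have "\<pi> x \<in> \<pi> ` v \<longleftrightarrow> x \<in> v"
      using assms(2,3) x(1) by (intro inj_on_image_mem_iff) (auto simp: bij_betw_def)
    ultimately show ?thesis
      using x assms(1) by (simp add: flips_apply moves_def map_permutation_apply)
  qed (simp add: flips_apply_other moves_def map_permutation_def)
qed

section \<open>Powers of a symmetric set of permutations\<close>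

lemma set_power_alt_0: "id \<in> set_power (alt_group n) A 0"
  by (simp add: set_power_0 alt_group_one)

lemma set_power_alt_Suc:
  "x \<in> set_power (alt_group n) A (Suc m) \<longleftrightarrow> (\<exists>a\<in>A. \<exists>y\<in>set_power (alt_group n) A m. x = a \<circ> y)"
  by (auto simp: set_power_Suc set_mult_def alt_group_mult)

lemma set_power_comp:
  "x \<in> set_power (alt_group n) A k \<Longrightarrow> y \<in> set_power (alt_group n) A m \<Longrightarrow> x \<circ> y \<in> set_power (alt_group n) A (k + m)"
proof (induction k arbitrary: x)
  case 0
  then show ?case by (simp add: set_power_0 alt_group_one)
next
  case (Suc k)
  then obtain a z where "a \<in> A" "z \<in> set_power (alt_group n) A k" "x = a \<circ> z"
    by (auto simp: set_power_alt_Suc)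
  moreover from this Suc have "z \<circ> y \<in> set_power (alt_group n) A (k + m)" by blast
  ultimately have "\<exists>b\<in>A. \<exists>u\<in>set_power (alt_group n) A (k + m). x \<circ> y = b \<circ> u"
    by (metis comp_assoc)
  then show ?case by (metis add_Suc set_power_alt_Suc)
qed

lemma set_power_1: "a \<in> A \<Longrightarrow> a \<in> set_power (alt_group n) A 1"
  using set_power_alt_0[of n A] set_power_alt_Suc[of a n A 0] by fastforce

locale symmetric_subset =
  fixes n :: nat and A :: "(nat \<Rightarrow> nat) set"
  assumes permutes: "a \<in> A \<Longrightarrow> a permutes {1..n}"
    and inv_mem: "a \<in> A \<Longrightarrow> inv' a \<in> A"
    and nonempty: "A \<noteq> {}"
begin

abbreviation pw :: "nat \<Rightarrow> (nat \<Rightarrow> nat) set"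
  where "pw m \<equiv> set_power (alt_group n) A m"

lemma finite_A: "finite A"
  using permutes by (auto intro: finite_subset[OF _ finite_permutations[of "{1..n}"]])

lemma pw_permutes: "x \<in> pw m \<Longrightarrow> x permutes {1..n}"
proof (induction m arbitrary: x)
  case 0
  then have "x = id" by (simp add: set_power_0 alt_group_one)
  then show ?case using permutes_id by metis
next
  case (Suc m)
  then show ?case using permutes by (auto simp: set_power_alt_Suc intro: permutes_compose)
qed

lemma pw_inv: "x \<in> pw m \<Longrightarrow> inv' x \<in> pw m"
proof (induction m arbitrary: x)
  case 0
  then have "x = id" by (simp add: set_power_0 alt_group_one)
  then show ?case using set_power_alt_0 by (metis inv_id)
next
  case (Suc m)
  then obtain a y where a: "a \<in> A" "y \<in> pw m" "x = a \<circ> y" by (auto simp: set_power_alt_Suc)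
  have "inv' x = inv' y \<circ> inv' a"
    unfolding a(3) using a permutes pw_permutes by (intro o_inv_distrib) (auto intro: permutes_bij)
  moreover have "inv' y \<circ> inv' a \<in> pw (m + 1)"
    using Suc.IH[OF a(2)] set_power_1[OF inv_mem[OF a(1)]] by (intro set_power_comp) auto
  ultimately show ?case by (metis Suc_eq_plus1)
qed

text \<open>The identity need not lie in \<open>A\<close>, so words are padded with
  \<open>a \<circ> inv' a\<close>; powers are compared only along a fixed parity.\<close>

lemma id_mem_even: "id \<in> pw (2 * k)"
proof (induction k)
  case 0
  show ?case unfolding mult_0_right by (rule set_power_alt_0)
next
  case (Suc k)
  obtain a where a: "a \<in> A" using nonempty by blast
  have "a \<circ> (inv' a \<circ> id) \<in> pw (1 + (1 + 2 * k))"
    by (intro set_power_comp set_power_1 a inv_mem Suc)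
  moreover have "a \<circ> (inv' a \<circ> id) = id" using permutes_inv_o(1)[OF permutes[OF a]] by (metis comp_id)
  moreover have "1 + (1 + 2 * k) = 2 * Suc k" by simp
  ultimately show ?case by metis
qed

lemma pw_mono: "x \<in> pw m \<Longrightarrow> m \<le> k \<Longrightarrow> even (k - m) \<Longrightarrow> x \<in> pw k"
  by (elim evenE) (metis set_power_comp[OF _ id_mem_even] comp_id le_add_diff_inverse)

lemma pw_conj: "x \<in> pw m \<Longrightarrow> w \<in> pw l \<Longrightarrow> w \<circ> x \<circ> inv' w \<in> pw (2 * l + m)"
  using set_power_comp[OF set_power_comp[of w n A l x m] pw_inv[of w l]] by (simp add: mult_2 add_ac)

end

text \<open>In \<open>inv' u \<circ> u'\<close> the outer \<open>M0\<close> cancels, leaving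
  \<open>w\<close> conjugated by \<open>g\<close>. Conjugation with \<open>b\<close> removes
  \<open>g\<close>, and \<open>x\<close> drops out since it commutes with \<open>w\<close>. So the
  result shows neither the translate \<open>g\<close> nor the flip \<open>x\<close> that happens to
  accompany the move \<open>M\<close>.\<close>

lemma conj_identity:
  fixes b g s v w :: "'a \<Rightarrow> 'a"
  assumes bij: "bij b" "bij u" "bij g"
    and u: "u = M0 \<circ> y \<circ> g" "u' = M0 \<circ> y' \<circ> g" and b: "b = M \<circ> x \<circ> g"
    and rel: "y \<circ> w = y'" "x \<circ> w = w \<circ> x" "M \<circ> w = z \<circ> M"
  shows "b \<circ> (inv' u \<circ> u') \<circ> inv' b = z"
proof -
  have g: "g (inv' g p) = p" for p using bij by (simp add: bij_is_surj surj_f_inv_f)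
  have rel': "y (w p) = y' p" "x (w p) = w (x p)" "M (w p) = z (M p)" for p
    using rel[THEN fun_cong, of p] by simp_all
  have "u (inv' g (w (g p))) = u' p" for p by (simp add: u g rel')
  then have "inv' u (u' p) = inv' g (w (g p))" for p using bij by (metis bij_inv_eq_iff)
  then have "b (inv' u (u' p)) = z (b p)" for p by (simp add: b g rel')
  then show ?thesis using bij by (simp add: fun_eq_iff bij_is_surj surj_f_inv_f)
qed

context symmetric_subset
begin

text \<open>Quotients of two elements of \<open>A\<close> with the same \<open>\<tau>0\<close> are conjugates of flips, and conjugating them
  back by an element of \<open>A\<close> over \<open>\<tau>\<close> permutes the flipped pairs by \<open>\<tau>\<close>.\<close>

lemma flips_in_power:
  fixes c :: "('i \<times> 'k) \<times> bool \<Rightarrow> nat"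
  assumes fin: "finite I" "finite K" and K: "2 * 16 ^ j \<le> card K" and j: "0 < j"
    and c: "inj_on c ((I \<times> K) \<times> UNIV)" "c ` ((I \<times> K) \<times> UNIV) \<subseteq> {1..n}"
    and dense: "fact n \<le> card A * 2 ^ a"
  shows "\<exists>S\<subseteq>I. j * card S \<le> 2 * a \<and>
    (\<forall>v. v \<subseteq> (I - S) \<times> K \<longrightarrow> (\<forall>i\<in>I. even (card (v `` {i}))) \<longrightarrow> flips (I \<times> K) c v \<in> pw (4 * (a div j + 2)))"
proof -
  let ?J = "I \<times> K"
  let ?t = "flips ?J c" and ?m = "\<lambda>\<tau>. moves ?J c (block_act \<tau>)"
  define T where "T = PiE I (\<lambda>_. {p. p permutes K})"
  define E where "E = PiE I (\<lambda>_. Pow K)"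
  define \<Phi> where "\<Phi> = (\<lambda>(\<tau>, y). ?m \<tau> \<circ> ?t (Sigma I y))"
  let ?G = "{p. p permutes {1..n}}"
  have finT: "finite T" "finite E" using fin by (auto simp: T_def E_def finite_permutations intro!: finite_PiE)
  have cardT: "card T = fact (card K) ^ card I" "card E = (2 ^ card K) ^ card I"
    using fin by (simp_all add: T_def E_def card_PiE card_permutations card_Pow)
  have bij: "bij_betw (block_act \<tau>) ?J ?J" if "\<tau> \<in> T" for \<tau>
    using that by (intro block_act_bij) (auto simp: T_def dest: PiE_mem)
  have m: "?m \<tau> permutes {1..n}" if "\<tau> \<in> T" for \<tau> using c bij[OF that] by (rule moves_permutes)
  have t: "?t v permutes {1..n}" for v using c by (rule flips_permutes)
  have \<Phi>: "\<Phi> p permutes {1..n}" if "p \<in> T \<times> E" for p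
    using that m t by (auto simp: \<Phi>_def intro: permutes_compose)
  \<comment> \<open>Double counting of pairs \<open>(p, g)\<close>: on average over
    \<open>g\<close>, the translated family \<open>\<Phi> p \<circ> g\<close> meets \<open>A\<close>
    with the density of \<open>A\<close>, and the pigeonhole principle picks one
    \<open>g\<close>.\<close>
  define W where "W = (SIGMA p:T \<times> E. {g \<in> ?G. \<Phi> p \<circ> g \<in> A})"
  have card_fibre: "card {g \<in> ?G. \<Phi> p \<circ> g \<in> A} = card A" if p: "p \<in> T \<times> E" for p
  proof -
    have "bij_betw (\<lambda>g. \<Phi> p \<circ> g) {g \<in> ?G. \<Phi> p \<circ> g \<in> A} A"
    proof (rule bij_betw_byWitness[of _ "\<lambda>a. inv' (\<Phi> p) \<circ> a"])
      show "\<forall>g\<in>{g \<in> ?G. \<Phi> p \<circ> g \<in> A}. inv' (\<Phi> p) \<circ> (\<Phi> p \<circ> g) = g"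
        using permutes_inv_o[OF \<Phi>[OF p]] by (metis comp_assoc id_comp)
      show "\<forall>a\<in>A. \<Phi> p \<circ> (inv' (\<Phi> p) \<circ> a) = a"
        using permutes_inv_o[OF \<Phi>[OF p]] by (metis comp_assoc id_comp)
      then show "(\<lambda>a. inv' (\<Phi> p) \<circ> a) ` A \<subseteq> {g \<in> ?G. \<Phi> p \<circ> g \<in> A}"
        using permutes permutes_inv[OF \<Phi>[OF p]] by (auto intro: permutes_compose)
    qed auto
    then show ?thesis by (rule bij_betw_same_card)
  qed
  have finG: "finite ?G" "card ?G = fact n" by (auto simp: finite_permutations card_permutations)
  have finW: "finite W" using finT finG by (auto simp: W_def)
  have "card W = (\<Sum>p\<in>T \<times> E. card {g \<in> ?G. \<Phi> p \<circ> g \<in> A})"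
    unfolding W_def using finT finG by (intro card_SigmaI) auto
  also have "\<dots> = (\<Sum>p\<in>T \<times> E. card A)" using card_fibre by (intro sum.cong) auto
  finally have cardW: "card W = card T * card E * card A" by (simp add: card_cartesian_product)
  have TE: "0 < card T" "0 < card E" by (simp_all add: cardT)
  have A: "0 < card A" using finite_A nonempty by (simp add: card_gt_0_iff)
  have "W \<noteq> {}" using cardW TE A by fastforce
  moreover have "snd ` W \<subseteq> ?G" by (auto simp: W_def)
  ultimately obtain w0 where w0: "w0 \<in> W" "card W \<le> card ?G * card {w\<in>W. snd w = snd w0}"
    using pigeonhole_fibre[OF finW _ _ finG(1)] by blast
  define g where "g = snd w0"
  have g: "g \<in> ?G" "card W \<le> fact n * card {w\<in>W. snd w = g}"
    using w0 \<open>snd ` W \<subseteq> ?G\<close> finG(2) unfolding g_def by auto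
  define D where "D = {p \<in> T \<times> E. \<Phi> p \<circ> g \<in> A}"
  have finD: "finite D" using finT by (auto simp: D_def)
  have "{w\<in>W. snd w = g} = (\<lambda>p. (p, g)) ` D" using g by (auto simp: W_def D_def)
  then have "card {w\<in>W. snd w = g} = card D" by (simp add: card_image inj_on_def)
  then have "card T * card E * card A \<le> fact n * card D" using g cardW by simp
  also have "\<dots> \<le> card A * 2 ^ a * card D" using dense by simp
  finally have "card A * (card T * card E) \<le> card A * (2 ^ a * card D)" by (simp only: mult_ac)
  then have D: "card T * card E \<le> 2 ^ a * card D" using A by simp
  then have "D \<noteq> {}" using TE by auto
  \<comment> \<open>A projection of \<open>D\<close> is at least as dense as \<open>D\<close>, and
    so is its largest fibre. Hence \<open>\<Theta>\<close> and \<open>Y\<close> both have density at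
    least \<open>1 / 2 ^ a\<close>.\<close>
  define \<Theta> where "\<Theta> = fst ` D"
  have \<Theta>: "\<Theta> \<subseteq> T" "\<Theta> \<noteq> {}" using \<open>D \<noteq> {}\<close> by (auto simp: \<Theta>_def D_def)
  have "D \<subseteq> \<Theta> \<times> E" by (force simp: \<Theta>_def D_def)
  then have "card D \<le> card \<Theta> * card E"
    using finT \<Theta> by (metis card_cartesian_product card_mono finite_SigmaI finite_subset)
  then have "card T * card E \<le> 2 ^ a * (card \<Theta> * card E)" using D by (meson mult_le_mono2 order_trans)
  then have "card E * card T \<le> card E * (card \<Theta> * 2 ^ a)" by (simp only: mult_ac)
  then have dense_\<Theta>: "card T \<le> card \<Theta> * 2 ^ a" using TE by simp
  obtain p0 where p0: "p0 \<in> D" "card D \<le> card T * card {p\<in>D. fst p = fst p0}"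
  proof -
    have "fst ` D \<subseteq> T" by (auto simp: D_def)
    then show ?thesis using pigeonhole_fibre[OF finD \<open>D \<noteq> {}\<close> _ finT(1)] that by blast
  qed
  define \<tau>0 where "\<tau>0 = fst p0"
  define Y where "Y = {y. (\<tau>0, y) \<in> D}"
  have "{p\<in>D. fst p = fst p0} = Pair \<tau>0 ` Y" by (auto simp: Y_def \<tau>0_def)
  then have "card {p\<in>D. fst p = fst p0} = card Y" by (simp add: card_image inj_on_def)
  then have "card D \<le> card T * card Y" using p0 by simp
  then have "card T * card E \<le> 2 ^ a * (card T * card Y)" using D by (meson mult_le_mono2 order_trans)
  then have "card T * card E \<le> card T * (card Y * 2 ^ a)" by (simp only: mult_ac)
  then have dense_Y: "card E \<le> card Y * 2 ^ a" using TE by simp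
  have Y: "Y \<subseteq> E" "Y \<noteq> {}" using p0 by (auto simp: Y_def D_def \<tau>0_def intro!: exI[of _ "snd p0"])
  define P where "P m z \<longleftrightarrow> ?t z \<in> pw (4 * m)" for m z
  have "\<exists>S\<subseteq>I. j * card S \<le> 2 * a \<and>
    (\<forall>v. v \<subseteq> (I - S) \<times> K \<longrightarrow> (\<forall>i\<in>I. even (card (v `` {i}))) \<longrightarrow> P (a div j + 2) v)"
  proof (rule block_sumset[OF fin K j _ \<Theta>(2) _ Y(2)])
    show "P 0 {}" using set_power_alt_0 c by (metis P_def flips_empty mult_0_right)
    fix m z \<tau> y y' assume Pm: "P m z" and \<tau>: "\<tau> \<in> \<Theta>" and y: "y \<in> Y" "y' \<in> Y"
    obtain x where x: "(\<tau>, x) \<in> D" using \<tau> by (auto simp: \<Theta>_def)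
    let ?w = "sym_diff (Sigma I y) (Sigma I y')"
    define b where "b = ?m \<tau> \<circ> ?t (Sigma I x) \<circ> g"
    define u where "u = ?m \<tau>0 \<circ> ?t (Sigma I y) \<circ> g"
    define u' where "u' = ?m \<tau>0 \<circ> ?t (Sigma I y') \<circ> g"
    have mem: "b \<in> A" "u \<in> A" "u' \<in> A" using x y by (auto simp: b_def u_def u'_def D_def Y_def \<Phi>_def)
    have sd: "sym_diff (Sigma I y) ?w = Sigma I y'" "sym_diff (Sigma I x) ?w = sym_diff ?w (Sigma I x)" by auto
    have wJ: "?w \<subseteq> ?J" using y Y by (fastforce simp: E_def)
    have "b \<circ> (inv' u \<circ> u') \<circ> inv' b = ?t (block_diff I \<tau> y y')"
    proof (rule conj_identity)
      show "bij b" "bij u" "bij g" using mem permutes g permutes_bij by auto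
      show "?t (Sigma I y) \<circ> ?t ?w = ?t (Sigma I y')" by (simp only: flips_comp[OF c(1)] sd)
      show "?t (Sigma I x) \<circ> ?t ?w = ?t ?w \<circ> ?t (Sigma I x)" by (simp only: flips_comp[OF c(1)] sd)
      show "?m \<tau> \<circ> ?t ?w = ?t (block_diff I \<tau> y y') \<circ> ?m \<tau>"
        unfolding block_diff_def using c(1) bij \<tau> \<Theta> wJ by (intro moves_flips) auto
    qed (simp_all add: u_def u'_def b_def)
    \<comment> \<open>Four factors from \<open>A\<close>: \<open>b\<close>, \<open>inv' u\<close>,
      \<open>u'\<close> and \<open>inv' b\<close>. This is the \<open>4\<close> in the
      exponent.\<close>
    moreover have "b \<circ> (inv' u \<circ> u') \<circ> inv' b \<in> pw (2 * 1 + (1 + 1))"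
      by (intro pw_conj set_power_comp pw_inv set_power_1 mem)
    ultimately have "?t (block_diff I \<tau> y y') \<in> pw 4" by simp
    then have "?t z \<circ> ?t (block_diff I \<tau> y y') \<in> pw (4 * m + 4)"
      using Pm unfolding P_def by (intro set_power_comp)
    then show "P (Suc m) (sym_diff z (block_diff I \<tau> y y'))"
      unfolding P_def flips_comp[OF c(1)] by (simp add: add.commute)
  qed (use \<Theta> Y dense_\<Theta> dense_Y cardT in \<open>auto simp: T_def E_def\<close>)
  then show ?thesis by (simp add: P_def)
qed

end

section \<open>Double transpositions in a bounded power\<close>

lemma extend_injection:
  assumes "finite Y" "X \<subseteq> Y" "inj_on f X" "f ` X \<subseteq> Z" "finite Z" "card Y \<le> card Z"
  shows "\<exists>g. inj_on g Y \<and> g ` Y \<subseteq> Z \<and> (\<forall>x\<in>X. g x = f x)"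
proof -
  have "card (Y - X) \<le> card (Z - f ` X)"
    using assms by (simp add: card_Diff_subset card_image finite_subset)
  then obtain h where h: "h ` (Y - X) \<subseteq> Z - f ` X" "inj_on h (Y - X)"
    using card_le_inj[of "Y - X" "Z - f ` X"] assms by auto
  let ?g = "\<lambda>x. if x \<in> X then f x else h x"
  have "inj_on ?g Y"
  proof (rule inj_onI)
    fix x y assume xy: "x \<in> Y" "y \<in> Y" "?g x = ?g y"
    have "h z \<notin> f ` X" if "z \<in> Y" "z \<notin> X" for z using h that by auto
    then have iff: "x \<in> X \<longleftrightarrow> y \<in> X" using xy by (metis imageI)
    show "x = y"
    proof (cases "x \<in> X")
      case True
      then show ?thesis using xy iff inj_onD[OF assms(3)] by simp
    next
      case False
      then show ?thesis using xy iff inj_onD[OF h(2)] by simp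
    qed
  qed
  moreover have "?g ` Y \<subseteq> Z" using h assms by auto
  ultimately show ?thesis by (intro exI[of _ ?g]) auto
qed

text \<open>The points may coincide: \<open>double_transposition a b b c\<close> is a three-cycle
  for distinct points, and \<open>double_transposition_chain\<close> holds without any
  distinctness.\<close>

definition double_transposition :: "nat \<Rightarrow> nat \<Rightarrow> nat \<Rightarrow> nat \<Rightarrow> nat \<Rightarrow> nat"
  where "double_transposition a b c d = transpose a b \<circ> transpose c d"

text \<open>Lets a coordinate system \<open>f\<close> be extended by further pairs to
  \<open>c\<close> without changing the flips of the old labels.\<close>

lemma flips_reparam:
  assumes "inj_on c (J \<times> UNIV)" "inj_on f (J' \<times> UNIV)" "inj_on h J'" "h ` J' \<subseteq> J"
    and "\<And>x s. x \<in> J' \<Longrightarrow> c (h x, s) = f (x, s)" "v \<subseteq> J'"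
  shows "flips J c (h ` v) = flips J' f v"
proof
  fix p
  show "flips J c (h ` v) p = flips J' f v p"
  proof (cases "p \<in> f ` (J' \<times> UNIV)")
    case True
    then obtain x s where x: "x \<in> J'" "p = f (x, s)" by auto
    have "h x \<in> h ` v \<longleftrightarrow> x \<in> v" using assms(3,6) x(1) by (intro inj_on_image_mem_iff) auto
    moreover have "p = c (h x, s)" using x assms by simp
    ultimately have "flips J c (h ` v) p = c (h x, if x \<in> v then \<not> s else s)"
      using assms(1,4) x(1) by (simp add: flips_apply image_subset_iff)
    then show ?thesis using x assms by (simp add: flips_apply)
  next
    case False
    have "flips J c (h ` v) p = p"
    proof (cases "p \<in> c ` (J \<times> UNIV)")
      case True
      then obtain x s where x: "x \<in> J" "p = c (x, s)" by auto
      have "x \<notin> h ` v"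
      proof
        assume "x \<in> h ` v"
        then obtain x' where "x' \<in> v" "x = h x'" by auto
        then have "p = f (x', s)" "x' \<in> J'" using x assms by auto
        then show False using False by auto
      qed
      then show ?thesis using x assms(1) by (simp add: flips_apply)
    qed (simp add: flips_apply_other)
    then show ?thesis using False by (simp add: flips_apply_other)
  qed
qed

text \<open>\<open>N\<close> is the number of pairs in a block, \<open>M\<close> the power
  containing the flips, and \<open>\<beta>\<close> bounds the number of bad blocks. The square in
  \<open>room\<close> arises since up to \<open>(\<beta> + 1) * N\<close> leftover pairs are grouped
  in twos and each two get a block of \<open>2 * N\<close> points.\<close>

locale large_symmetric_subset = symmetric_subset +
  fixes j a N M \<beta> :: nat
  assumes j: "0 < j" and N: "N = 2 * 16 ^ j"
    and M: "M = 4 * (a div j + 2)" and \<beta>: "\<beta> = 2 * (a div j) + 1"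
    and dense: "fact n \<le> card A * 2 ^ a"
    and room: "(\<beta> + 1) * N\<^sup>2 \<le> n"
begin

lemma N_ge: "32 \<le> N"
proof -
  have "(16::nat) ^ 1 \<le> 16 ^ j" using j by (intro power_increasing) auto
  then show ?thesis by (simp add: N)
qed

lemma room_linear: "(\<beta> + 1) * (2 * N) \<le> n"
proof -
  have "2 * N \<le> N\<^sup>2" using N_ge by (simp add: power2_eq_square)
  then show ?thesis using room by (meson le_trans mult_le_mono2)
qed

lemma n_ge: "64 * \<beta> + 64 \<le> n"
proof -
  have "(\<beta> + 1) * (2 * 32) \<le> (\<beta> + 1) * (2 * N)" using N_ge by (intro mult_le_mono) auto
  then show ?thesis using room_linear by simp
qed

lemma card_bad: "j * card S \<le> 2 * a \<Longrightarrow> card S \<le> \<beta>"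
proof -
  assume "j * card S \<le> 2 * a"
  also have "2 * a < j * (2 * (a div j) + 2)"
    using dividend_less_times_div[OF j, of a] by (simp add: algebra_simps)
  finally have "j * card S < j * (2 * (a div j) + 2)" .
  then have "card S < 2 * (a div j) + 2" unfolding mult_less_cancel1 by blast
  then show ?thesis by (simp add: \<beta>)
qed

text \<open>Each double transposition flips two pairs. Placed in a block of its own, filled up with
  arbitrary disjoint pairs to size \<open>N\<close>, it is an even set, so
  \<open>flips_in_power\<close> handles all subfamilies off the bad blocks at once.\<close>

lemma few_bad_double_transpositions:
  fixes f :: "('i \<times> bool) \<times> bool \<Rightarrow> nat"
  assumes I: "finite I" "card I * (2 * N) \<le> n"
    and f: "inj_on f ((I \<times> UNIV) \<times> UNIV)" "f ` ((I \<times> UNIV) \<times> UNIV) \<subseteq> {1..n}"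
  shows "\<exists>S\<subseteq>I. card S \<le> \<beta> \<and> (\<forall>I'\<subseteq>I - S. flips (I \<times> UNIV) f (I' \<times> UNIV) \<in> pw M)"
proof -
  let ?K = "{..<N}"
  let ?J = "I \<times> ?K"
  define h :: "'i \<times> bool \<Rightarrow> 'i \<times> nat" where "h = (\<lambda>(i, k). (i, of_bool k))"
  have h: "inj_on h (I \<times> UNIV)" "h ` (I \<times> UNIV) \<subseteq> ?J" using N_ge by (auto simp: h_def inj_on_def)
  let ?X = "h ` (I \<times> UNIV) \<times> (UNIV :: bool set)"
  define f' where "f' = (\<lambda>((i, k), s). f ((i, k = (1::nat)), s))"
  have f': "f' (h x, s) = f (x, s)" for x s
    by (cases x; cases "snd x") (simp_all add: f'_def h_def)
  have "inj_on f' ?X"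
  proof (rule inj_onI)
    fix p q assume "p \<in> ?X" "q \<in> ?X" and eq: "f' p = f' q"
    then obtain x s y t where x: "x \<in> I \<times> UNIV" "p = (h x, s)" and y: "y \<in> I \<times> UNIV" "q = (h y, t)" by auto
    then have "(x, s) = (y, t)" using eq by (intro inj_onD[OF f(1)]) (auto simp: f')
    then show "p = q" using x y by simp
  qed
  moreover have "f' ` ?X \<subseteq> {1..n}" using f' f(2) by auto
  moreover have "finite (?J \<times> (UNIV :: bool set))" using I by simp
  moreover have "?X \<subseteq> ?J \<times> UNIV" using h(2) by auto
  moreover have "card (?J \<times> (UNIV :: bool set)) \<le> card {1..n}" using I by (simp add: card_cartesian_product mult_ac)
  ultimately obtain c where c: "inj_on c (?J \<times> UNIV)" "c ` (?J \<times> UNIV) \<subseteq> {1..n}" "\<forall>x\<in>?X. c x = f' x"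
    using extend_injection[of "?J \<times> UNIV" ?X f' "{1..n}"] by (meson finite_atLeastAtMost)
  obtain S where S: "S \<subseteq> I" "j * card S \<le> 2 * a"
    "\<And>v. v \<subseteq> (I - S) \<times> ?K \<Longrightarrow> (\<forall>i\<in>I. even (card (v `` {i}))) \<Longrightarrow> flips ?J c v \<in> pw (4 * (a div j + 2))"
    using flips_in_power[OF I(1) _ _ j c(1,2) dense] by (auto simp: N)
  have "flips (I \<times> UNIV) f (I' \<times> UNIV) \<in> pw M" if I': "I' \<subseteq> I - S" for I'
  proof -
    have "flips ?J c (h ` (I' \<times> UNIV)) = flips (I \<times> UNIV) f (I' \<times> UNIV)"
      by (rule flips_reparam[OF c(1) f(1) h]) (use c(3) f' I' in auto)
    moreover have "flips ?J c (h ` (I' \<times> UNIV)) \<in> pw (4 * (a div j + 2))"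
    proof (rule S(3))
      show "h ` (I' \<times> UNIV) \<subseteq> (I - S) \<times> ?K" using I' h(2) by (auto simp: h_def)
      show "\<forall>i\<in>I. even (card ((h ` (I' \<times> UNIV)) `` {i}))"
      proof
        fix i
        have "(h ` (I' \<times> UNIV)) `` {i} = (if i \<in> I' then {0, 1} else {})"
          by (auto simp: h_def of_bool_def image_iff split: if_splits)
        then show "even (card ((h ` (I' \<times> UNIV)) `` {i}))" by simp
      qed
    qed
    ultimately show ?thesis by (simp add: M)
  qed
  then show ?thesis using S card_bad by blast
qed

end

lemma flips_single:
  fixes f :: "('i \<times> bool) \<times> bool \<Rightarrow> nat"
  assumes f: "inj_on f ((F \<times> UNIV) \<times> UNIV)" and t: "t \<in> F"
  shows "flips (F \<times> UNIV) f ({t} \<times> UNIV)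
    = double_transposition (f ((t, False), False)) (f ((t, False), True)) (f ((t, True), False)) (f ((t, True), True))"
    (is "?L = double_transposition ?a ?b ?c ?d")
proof
  fix p
  have *: "?L (f (x, s)) = f (x, if fst x = t then \<not> s else s)" if "x \<in> F \<times> UNIV" for x s
    using that by (subst flips_apply[OF f]) (auto simp: mem_Times_iff)
  have neq: "f ((t, k), s) = f ((t, k'), s') \<longleftrightarrow> k = k' \<and> s = s'" for k s k' s'
    using t inj_on_eq_iff[OF f, of "((t, k), s)" "((t, k'), s')"] by simp
  have dist: "distinct [?a, ?b, ?c, ?d]" by (simp add: neq)
  show "?L p = double_transposition ?a ?b ?c ?d p"
  proof (cases "p \<in> {?a, ?b, ?c, ?d}")
    case True
    have "?L ?a = ?b" "?L ?b = ?a" "?L ?c = ?d" "?L ?d = ?c" using * t by simp_all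
    then show ?thesis using True dist
      by (elim insertE) (simp_all add: double_transposition_def transpose_def)
  next
    case False
    have "?L p = p"
    proof (cases "p \<in> f ` ((F \<times> UNIV) \<times> UNIV)")
      case True
      then obtain x s where x: "x \<in> F \<times> UNIV" "p = f (x, s)" by auto
      have "fst x \<noteq> t"
      proof
        assume "fst x = t"
        then have "p = f ((t, snd x), s)" using x(2) by (metis prod.collapse)
        then show False using False by (cases "snd x"; cases s) auto
      qed
      then show ?thesis using *[OF x(1)] x(2) by simp
    qed (simp add: flips_apply_other)
    then show ?thesis using False by (simp add: double_transposition_def transpose_def)
  qed
qed

lemma transpose_conj:
  assumes "bij w"
  shows "w \<circ> transpose a b \<circ> inv' w = transpose (w a) (w b)"
proof
  fix p
  obtain q where q: "p = w q" using assms by (meson bij_pointE)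
  have eq: "w x = w y \<longleftrightarrow> x = y" for x y using assms by (meson bij_is_inj inj_eq)
  show "(w \<circ> transpose a b \<circ> inv' w) p = transpose (w a) (w b) p"
    using assms by (simp add: q bij_is_inj transpose_def eq)
qed

lemma double_transposition_conj:
  assumes "bij w"
  shows "w \<circ> double_transposition a b c d \<circ> inv' w = double_transposition (w a) (w b) (w c) (w d)"
proof -
  have "w \<circ> double_transposition a b c d \<circ> inv' w
      = (w \<circ> transpose a b \<circ> inv' w) \<circ> (w \<circ> transpose c d \<circ> inv' w)"
    using assms by (auto simp: double_transposition_def fun_eq_iff bij_is_inj)
  then show ?thesis by (simp only: transpose_conj[OF assms] double_transposition_def)
qed

lemma double_transposition_chain:
  "double_transposition a b c d \<circ> double_transposition c d e f = double_transposition a b e f"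
  by (rule ext) (simp add: double_transposition_def)

text \<open>Conjugation by \<open>(b z) (x y)\<close> turns \<open>(i b) (x y)\<close> into
  \<open>(i z) (y x)\<close>: an accidental partner of \<open>i\<close> is exchanged for a
  prescribed one.\<close>

lemma double_transposition_swap:
  assumes "distinct [i, b, z]" "{i, b, z} \<inter> {x, y} = {}"
  shows "double_transposition b z x y \<circ> double_transposition i b x y \<circ> double_transposition b z x y
       = double_transposition i z x y"
proof -
  let ?w = "double_transposition b z x y"
  have d: "{b, z} \<inter> {x, y} = {}" "i \<notin> {b, z, x, y}" using assms by auto
  have inv: "?w (?w p) = p" for p
    using d(1) by (simp add: double_transposition_def transpose_def)
  have bij: "bij ?w" by (rule o_bij[of ?w]) (simp_all add: fun_eq_iff inv)
  have w: "inv' ?w = ?w" by (rule inv_unique_comp) (simp_all add: fun_eq_iff inv)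
  have "?w i = i" "?w b = z" "?w x = y" "?w y = x" using d by (auto simp: double_transposition_def)
  then have "?w \<circ> double_transposition i b x y \<circ> ?w = double_transposition i z y x"
    using double_transposition_conj[OF bij, of i b x y] unfolding w by simp
  then show ?thesis by (simp add: double_transposition_def transpose_commute)
qed

context large_symmetric_subset
begin

text \<open>A double transposition is encoded by the function \<open>t :: bool \<times> bool \<Rightarrow> nat\<close> listing its four points.\<close>

lemma clean_set:
  "\<exists>T\<subseteq>{1..n}. card T \<le> 4 * \<beta> \<and>
    (\<forall>p q r s. distinct [p, q, r, s] \<longrightarrow> {p, q, r, s} \<subseteq> {1..n} - T \<longrightarrow> double_transposition p q r s \<in> pw M)"
proof -
  let ?dt = "\<lambda>t. double_transposition (t (False, False)) (t (False, True)) (t (True, False)) (t (True, True))"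
  define bad where "bad = {t. inj t \<and> range t \<subseteq> {1..n} \<and> ?dt t \<notin> pw M}"
  \<comment> \<open>Families of pairwise disjoint bad double transpositions. More than
    \<open>\<beta>\<close> members would contradict \<open>few_bad_double_transpositions\<close>,
    and the points of a largest family meet every bad double transposition.\<close>
  define \<F> where "\<F> = {F. F \<subseteq> bad \<and> finite F \<and> disjoint_family_on range F}"
  define f :: "((bool \<times> bool \<Rightarrow> nat) \<times> bool) \<times> bool \<Rightarrow> nat" where "f = (\<lambda>((t, k), s). t (k, s))"
  have le: "card F \<le> \<beta>" if F: "F \<in> \<F>" for F
  proof (rule ccontr)
    assume "\<not> ?thesis"
    then obtain I where I: "I \<subseteq> F" "card I = \<beta> + 1" "finite I"
      by (metis Suc_eq_plus1 not_less_eq_eq obtain_subset_with_card_n)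
    have Ibad: "I \<subseteq> bad" using F I by (auto simp: \<F>_def)
    have dis: "disjoint_family_on range I"
      using F I(1) disjoint_family_on_mono unfolding \<F>_def by blast
    have inj: "inj_on f ((I \<times> UNIV) \<times> UNIV)"
    proof (rule inj_onI)
      fix x y assume "x \<in> (I \<times> UNIV) \<times> UNIV" "y \<in> (I \<times> UNIV) \<times> UNIV" and eq: "f x = f y"
      then obtain t k s t' k' s' where x: "x = ((t, k), s)" "t \<in> I" and y: "y = ((t', k'), s')" "t' \<in> I" by auto
      have eq': "t (k, s) = t' (k', s')" using eq by (simp add: f_def x y)
      then have "range t \<inter> range t' \<noteq> {}" by (metis disjoint_iff rangeI)
      then have "t = t'" using dis x(2) y(2) by (auto simp: disjoint_family_on_def)
      moreover have "inj t" using x(2) Ibad by (auto simp: bad_def)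
      ultimately show "x = y" using eq' by (simp add: x(1) y(1) inj_eq)
    qed
    have "f ` ((I \<times> UNIV) \<times> UNIV) \<subseteq> {1..n}" using Ibad by (fastforce simp: bad_def f_def)
    then obtain S where S: "S \<subseteq> I" "card S \<le> \<beta>" "\<forall>I'\<subseteq>I - S. flips (I \<times> UNIV) f (I' \<times> UNIV) \<in> pw M"
      using few_bad_double_transpositions[OF I(3) _ inj] I(2) room_linear by auto
    have "I \<noteq> S" using I S by auto
    then obtain t where t: "t \<in> I" "t \<in> I - S" using S by blast
    have "flips (I \<times> UNIV) f ({t} \<times> UNIV) \<in> pw M" using S(3) t by auto
    then have "?dt t \<in> pw M" using flips_single[OF inj t(1)] by (simp add: f_def)
    then show False using t Ibad by (auto simp: bad_def)
  qed
  have "{} \<in> \<F>" by (auto simp: \<F>_def disjoint_family_on_def)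
  then obtain F where F: "F \<in> \<F>" "\<And>F'. F' \<in> \<F> \<Longrightarrow> card F' \<le> card F"
    using ex_has_greatest_nat[of "\<lambda>F. F \<in> \<F>" "{}" card "\<beta> + 1"] le by (metis less_Suc_eq_le Suc_eq_plus1)
  define T where "T = \<Union> (range ` F)"
  have finF: "finite F" "F \<subseteq> bad" "disjoint_family_on range F" using F by (auto simp: \<F>_def)
  show ?thesis
  proof (intro exI[of _ T] conjI allI impI)
    show "T \<subseteq> {1..n}" using finF by (auto simp: T_def bad_def)
    have "card T \<le> (\<Sum>t\<in>F. card (range t))" unfolding T_def by (rule card_UN_le[OF finF(1)])
    also have "\<dots> \<le> (\<Sum>t\<in>F. 4)"
    proof (rule sum_mono)
      fix t :: "bool \<times> bool \<Rightarrow> nat"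
      have "card (UNIV :: (bool \<times> bool) set) = 4" by (simp add: card_cartesian_product flip: UNIV_Times_UNIV)
      then show "card (range t) \<le> 4" using card_image_le[of UNIV t] by simp
    qed
    also have "\<dots> \<le> 4 * \<beta>" using le[OF F(1)] by simp
    finally show "card T \<le> 4 * \<beta>" .
    fix p q r s assume d: "distinct [p, q, r, s]" and sub: "{p, q, r, s} \<subseteq> {1..n} - T"
    show "double_transposition p q r s \<in> pw M"
    proof (rule ccontr)
      assume not: "double_transposition p q r s \<notin> pw M"
      define t where "t = (\<lambda>(k, s'). if k then if s' then s else r else if s' then q else p)"
      have "inj t" using d by (auto simp: inj_def t_def split: if_splits)
      moreover have rt: "range t \<subseteq> {p, q, r, s}" by (auto simp: t_def)
      ultimately have new: "t \<in> bad" using sub not by (auto simp: bad_def t_def)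
      have "range t \<inter> T = {}" using rt sub by auto
      then have dis: "range t \<inter> range t' = {}" if "t' \<in> F" for t' using that by (auto simp: T_def)
      then have "disjoint_family_on range (insert t F)"
        using finF(3) unfolding disjoint_family_on_def by (metis Int_commute insert_iff)
      then have "insert t F \<in> \<F>" using finF new by (simp add: \<F>_def)
      then have "card (insert t F) \<le> card F" by (rule F(2))
      moreover have "t \<notin> F" using dis[of t] by auto
      ultimately show False using finF by simp
    qed
  qed
qed

end

section \<open>From clean points to all double transpositions by short words\<close>

locale generating_symmetric_subset = large_symmetric_subset +
  assumes gen: "generate (alt_group n) A = carrier (alt_group n)"
begin

lemma n_large: "128 \<le> n"
  using n_ge by (simp add: \<beta>)

text \<open>Invariance under \<open>A\<close> passes to the generated group, but a three-cycle can
  carry a point of \<open>R\<close> out of \<open>R\<close>.\<close>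

lemma not_invariant:
  assumes "R \<subseteq> {1..n}" "R \<noteq> {}" "R \<noteq> {1..n}"
  shows "\<exists>a\<in>A. \<not> a ` R \<subseteq> R"
proof (rule ccontr)
  assume "\<not> ?thesis"
  then have inv: "a ` R \<subseteq> R" if "a \<in> A" for a using that by blast
  have "p ` R \<subseteq> R" if "p \<in> generate (alt_group n) A" for p
    using that
  proof (induction rule: generate.induct)
    case one
    then show ?case by (simp add: alt_group_one)
  next
    case (incl h)
    then show ?case by (rule inv)
  next
    case (inv h)
    have "h \<in> carrier (alt_group n)" using inv gen generate.incl by metis
    then show ?case using inv inv_mem by (metis alt_group_inv_equality \<open>\<And>a. a \<in> A \<Longrightarrow> a ` R \<subseteq> R\<close>)
  next
    case (eng h1 h2)
    then show ?case by (auto simp: alt_group_mult)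
  qed
  then have all: "p ` R \<subseteq> R" if "p permutes {1..n}" "evenperm p" for p
    using that gen by (simp add: alt_group_carrier)
  obtain x where x: "x \<in> R" using assms by blast
  obtain y where y: "y \<in> {1..n}" "y \<notin> R" using assms by blast
  have "card {x, y} < card {1..n}" using n_large by (simp add: card_insert_if)
  then have "{1..n} - {x, y} \<noteq> {}" using card_mono[of "{x, y}" "{1..n}"] by auto
  then obtain z where z: "z \<in> {1..n}" "z \<noteq> x" "z \<noteq> y" by blast
  let ?p = "transpose x z \<circ> transpose x y"
  have xyz: "x \<in> {1..n}" "x \<noteq> y" using x y assms by auto
  have "?p permutes {1..n}" using xyz y z by (intro permutes_compose permutes_swap_id)
  moreover have "evenperm ?p" using xyz z by (simp add: evenperm_comp permutation_swap_id evenperm_swap)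
  ultimately have "?p x \<in> R" using all x by blast
  then show False using xyz y z by (simp add: transpose_def)
qed

text \<open>The set of points reached by words of length at most \<open>l\<close> gains a point in
  each step until it is everything. Starting from a set with small complement, the number of steps
  is at most the number of missing points.\<close>

lemma reach:
  assumes "S \<subseteq> {1..n}" "S \<noteq> {}" "i \<in> {1..n}"
  shows "\<exists>l w s. l \<le> n - card S \<and> w \<in> pw l \<and> s \<in> S \<and> w s = i"
proof -
  define R where "R l = {w s | w s l'. l' \<le> l \<and> w \<in> pw l' \<and> s \<in> S}" for l
  have sub: "R l \<subseteq> {1..n}" for l
  proof
    fix x assume "x \<in> R l"
    then obtain w s l' where "x = w s" "w \<in> pw l'" "s \<in> S" by (auto simp: R_def)
    then show "x \<in> {1..n}" using assms(1) permutes_in_image[OF pw_permutes[of w l'], of s] by auto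
  qed
  have mono: "R l \<subseteq> R (Suc l)" for l by (auto simp: R_def intro: le_SucI)
  have step: "a ` R l \<subseteq> R (Suc l)" if a: "a \<in> A" for l a
    proof clarify
      fix x assume "x \<in> R l"
      then obtain w s l' where w: "x = w s" "l' \<le> l" "w \<in> pw l'" "s \<in> S" by (auto simp: R_def)
      then have "a \<circ> w \<in> pw (Suc l')" using a by (auto simp: set_power_alt_Suc)
      then show "a x \<in> R (Suc l)" using w unfolding R_def by (intro CollectI exI[of _ "a \<circ> w"] exI[of _ s] exI[of _ "Suc l'"]) auto
    qed
  have "R l = {1..n} \<or> card S + l \<le> card (R l)" for l
  proof (induction l)
    case 0
    have "S \<subseteq> R 0"
    proof
      fix s assume "s \<in> S"
      then show "s \<in> R 0" unfolding R_def using set_power_alt_0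
        by (intro CollectI exI[of _ id] exI[of _ s] exI[of _ 0]) auto
    qed
    then show ?case using sub[of 0] by (auto intro!: card_mono intro: finite_subset)
  next
    case (Suc l)
    show ?case
    proof (cases "R l = {1..n}")
      case True
      then show ?thesis using mono[of l] sub[of "Suc l"] by auto
    next
      case False
      have "card S \<le> card (R l)" "card S + l \<le> card (R l)" using Suc False by auto
      moreover have "0 < card S" using assms by (metis card_gt_0_iff finite_atLeastAtMost finite_subset)
      ultimately have "R l \<noteq> {}" by auto
      then obtain a where "a \<in> A" "\<not> a ` R l \<subseteq> R l" using not_invariant[OF sub _ False] by blast
      then have "R l \<subset> R (Suc l)" using mono[of l] step[of _ l] by blast
      then have "card (R l) < card (R (Suc l))" using sub by (meson finite_atLeastAtMost finite_subset psubset_card_mono)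
      then show ?thesis using \<open>card S + l \<le> card (R l)\<close> by simp
    qed
  qed
  from this[of "n - card S"] have "R (n - card S) = {1..n}"
  proof
    assume le: "card S + (n - card S) \<le> card (R (n - card S))"
    show ?thesis using sub le by (intro card_seteq) auto
  qed
  then have "i \<in> R (n - card S)" using assms by simp
  then show ?thesis unfolding R_def by blast
qed

text \<open>Twice the cost \<open>12 * M + 24 * \<beta>\<close> of a double transposition with two
  clean points, which is three times the cost \<open>4 * M + 8 * \<beta>\<close> of one with three
  clean points.\<close>

definition M3 :: nat where "M3 = 24 * M + 48 * \<beta>"

lemma M3_even: "even M3" by (simp add: M3_def)

text \<open>Points off \<open>T\<close> are clean. Conjugation by a short word carrying a clean
  point to \<open>i\<close> gives a double transposition with \<open>i\<close> and three clean
  points; chaining and swapping then make its partner and the other pair prescribed ones. Applied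
  twice, this handles two unclean points in one pair, and a chain joins two such pairs.\<close>

lemma all_double_transpositions:
  assumes d: "distinct [p, q, r, s]" and sub: "{p, q, r, s} \<subseteq> {1..n}"
  shows "double_transposition p q r s \<in> pw M3"
proof -
  obtain T where T: "T \<subseteq> {1..n}" "card T \<le> 4 * \<beta>"
    and clean: "\<And>p q r s. distinct [p, q, r, s] \<Longrightarrow> {p, q, r, s} \<subseteq> {1..n} - T \<Longrightarrow> double_transposition p q r s \<in> pw M"
    using clean_set by metis
  define S where "S = {1..n} - T"
  have finT: "finite T" using T by (auto intro: finite_subset)
  have cardS: "card S = n - card T" "finite S" "card S + card T = n"
    using T finT card_mono[OF _ T(1)] by (auto simp: S_def card_Diff_subset)
  have choose3: "\<exists>b c d. {b, c, d} \<subseteq> U - Z \<and> distinct [b, c, d]" if "card Z + 3 \<le> card U" "finite Z" "finite U" for U Z :: "nat set"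
  proof -
    have "3 \<le> card (U - Z)" using that diff_card_le_card_Diff[OF that(2), of U] by linarith
    then obtain V where "V \<subseteq> U - Z" "card V = 3" using obtain_subset_with_card_n by metis
    then show ?thesis by (auto simp: card_3_iff)
  qed
  have clean': "double_transposition p q r s \<in> pw M" if "distinct [p, q, r, s]" "{p, q, r, s} \<subseteq> S" for p q r s
    using clean that by (simp add: S_def)
  have near: "\<exists>b\<in>S - {z, x, y, i}. double_transposition i b x y \<in> pw (2 * M + 8 * \<beta>)"
    if i: "i \<in> {1..n}" and xyz: "x \<in> S" "y \<in> S" "z \<in> S" "distinct [x, y, z]" "i \<notin> {x, y, z}" for i x y z
  proof -
    have "S \<noteq> {}" using xyz by auto
    then obtain l w t where w: "l \<le> n - card S" "w \<in> pw l" "t \<in> S" "w t = i"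
      using reach[of S i] i by (auto simp: S_def)
    have l: "l \<le> 4 * \<beta>" using w(1) cardS T by linarith
    have wp: "w permutes {1..n}" using w by (intro pw_permutes)
    let ?U = "S \<inter> w ` S" and ?Z = "{z, x, y, i}"
    have "card (w ` S) = card S" using wp by (intro card_image permutes_inj_on)
    moreover have "card (S \<union> w ` S) \<le> n"
    proof -
      have "S \<union> w ` S \<subseteq> {1..n}" using permutes_image[OF wp] by (auto simp: S_def)
      then have "card (S \<union> w ` S) \<le> card {1..n}" by (intro card_mono) auto
      then show ?thesis by simp
    qed
    moreover have "card (S \<union> w ` S) + card ?U = card S + card (w ` S)"
      using cardS by (intro card_Un_Int[symmetric]) auto
    moreover have "card ?Z \<le> 4" by (simp add: card_insert_le_m1)
    \<comment> \<open>\<open>S\<close> and its image under \<open>w\<close> each miss at most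
      \<open>4 * \<beta>\<close> points, so they share at least
      \<open>n - 8 * \<beta>\<close>.\<close>
    ultimately have "card ?Z + 3 \<le> card ?U" using cardS T n_ge by linarith
    then obtain b c d where bcd: "{b, c, d} \<subseteq> ?U - ?Z" "distinct [b, c, d]"
      using choose3[of ?Z ?U] cardS by auto
    then obtain b' c' d' where pre: "b = w b'" "c = w c'" "d = w d'" "b' \<in> S" "c' \<in> S" "d' \<in> S" by auto
    have "distinct [t, b', c', d']" using bcd pre w(4) by auto
    then have "double_transposition t b' c' d' \<in> pw M" using pre w by (intro clean') auto
    then have "w \<circ> double_transposition t b' c' d' \<circ> inv' w \<in> pw (2 * l + M)" using w by (intro pw_conj)
    then have 1: "double_transposition i b c d \<in> pw (2 * l + M)"
      by (simp only: double_transposition_conj[OF permutes_bij[OF wp]] pre w(4))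
    have "double_transposition c d x y \<in> pw M" using bcd xyz by (intro clean') auto
    with 1 have "double_transposition i b c d \<circ> double_transposition c d x y \<in> pw ((2 * l + M) + M)"
      by (rule set_power_comp)
    then have "double_transposition i b x y \<in> pw (2 * l + M + M)" by (simp only: double_transposition_chain)
    then have "double_transposition i b x y \<in> pw (2 * M + 8 * \<beta>)"
      using l by (rule_tac pw_mono) auto
    then show ?thesis using bcd by auto
  qed
  have far: "double_transposition i z x y \<in> pw (4 * M + 8 * \<beta>)"
    if i: "i \<in> {1..n}" and xyz: "x \<in> S" "y \<in> S" "z \<in> S" "distinct [x, y, z]" "i \<notin> {x, y, z}" for i x y z
  proof -
    obtain b where b: "b \<in> S - {z, x, y, i}" "double_transposition i b x y \<in> pw (2 * M + 8 * \<beta>)"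
      using near[OF i xyz] by blast
    have bz: "double_transposition b z x y \<in> pw M" using b xyz by (intro clean') auto
    have "double_transposition b z x y \<circ> double_transposition i b x y \<circ> double_transposition b z x y \<in> pw (M + (2 * M + 8 * \<beta>) + M)"
      by (intro set_power_comp bz b)
    also have "double_transposition b z x y \<circ> double_transposition i b x y \<circ> double_transposition b z x y = double_transposition i z x y"
      using b xyz by (intro double_transposition_swap) auto
    finally show ?thesis by (simp add: algebra_simps)
  qed
  have any: "double_transposition i k x y \<in> pw (12 * M + 24 * \<beta>)"
    if i: "i \<in> {1..n}" "k \<in> {1..n}" "i \<noteq> k" and xyz: "x \<in> S" "y \<in> S" "z \<in> S" "distinct [x, y, z]" "i \<notin> {x, y, z}" "k \<notin> {x, y, z}" for i k x y z
  proof -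
    have "double_transposition k z x y \<circ> double_transposition i z x y \<circ> double_transposition k z x y
       \<in> pw ((4 * M + 8 * \<beta>) + (4 * M + 8 * \<beta>) + (4 * M + 8 * \<beta>))"
      using that by (intro set_power_comp far) auto
    also have "double_transposition k z x y \<circ> double_transposition i z x y \<circ> double_transposition k z x y = double_transposition i k x y"
    proof -
      have "double_transposition z k x y \<circ> double_transposition i z x y \<circ> double_transposition z k x y = double_transposition i k x y"
        using that by (intro double_transposition_swap) auto
      then show ?thesis by (simp add: double_transposition_def transpose_commute)
    qed
    finally show ?thesis by (simp add: algebra_simps)
  qed
  have "card {p, q, r, s} \<le> 4" by (simp add: card_insert_le_m1)
  then have "card {p, q, r, s} + 3 \<le> card S" using cardS T n_ge by linarith
  then obtain x y z where xyz: "{x, y, z} \<subseteq> S - {p, q, r, s}" "distinct [x, y, z]"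
    using choose3[of "{p, q, r, s}" S] cardS by auto
  have "double_transposition p q x y \<circ> double_transposition x y r s \<in> pw ((12 * M + 24 * \<beta>) + (12 * M + 24 * \<beta>))"
  proof (rule set_power_comp)
    show "double_transposition p q x y \<in> pw (12 * M + 24 * \<beta>)"
      by (rule any[of _ _ _ _ z]) (use xyz d sub in auto)
    have "double_transposition r s x y \<in> pw (12 * M + 24 * \<beta>)"
      by (rule any[of _ _ _ _ z]) (use xyz d sub in auto)
    moreover have "double_transposition x y r s = double_transposition r s x y"
      using xyz d by (auto simp: double_transposition_def fun_eq_iff transpose_def)
    ultimately show "double_transposition x y r s \<in> pw (12 * M + 24 * \<beta>)" by simp
  qed
  then show ?thesis by (simp add: double_transposition_chain M3_def)
qed

end

section \<open>Products of involutions\<close>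

lemma permutes_finite_order:
  assumes "finite X" "p permutes X"
  shows "\<exists>k>0. p ^^ k = id"
proof -
  have "range (\<lambda>k. p ^^ k) \<subseteq> {q. q permutes X}" using assms permutes_funpow by blast
  then have "finite (range (\<lambda>k. p ^^ k))" using assms finite_permutations finite_subset by metis
  then have "\<not> inj (\<lambda>k. p ^^ k)" using finite_imageD infinite_UNIV_nat by blast
  then obtain i k where ik: "i < k" "p ^^ i = p ^^ k"
    unfolding inj_on_def by (metis nat_neq_iff)
  have "(p ^^ i) ((p ^^ (k - i)) x) = (p ^^ i) x" for x
    using ik by (metis comp_apply funpow_add le_add_diff_inverse less_imp_le)
  moreover have "inj (p ^^ i)" using assms permutes_funpow permutes_inj by metis
  ultimately have "p ^^ (k - i) = id" by (auto simp: fun_eq_iff dest: injD)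
  then show ?thesis using ik by (intro exI[of _ "k - i"]) auto
qed

text \<open>On every cycle \<open>p\<close> is the product of two reflections of that cycle.\<close>

lemma permutes_product_two_involutions:
  assumes "finite X" "p permutes X"
  shows "\<exists>u v. u permutes X \<and> v permutes X \<and> u \<circ> u = id \<and> v \<circ> v = id \<and> p = u \<circ> v"
proof -
  obtain k where k: "k > 0" "p ^^ k = id" using permutes_finite_order[OF assms] by blast
  define q where "q = p ^^ (k - 1)"
  have pq: "p (q x) = x" "q (p x) = x" for x
  proof -
    have "p (q x) = (p ^^ Suc (k - 1)) x" by (simp add: q_def)
    then show "p (q x) = x" using k by simp
    have "q (p x) = (p ^^ Suc (k - 1)) x" by (simp add: q_def funpow_swap1)
    then show "q (p x) = x" using k by simp
  qed
  have pqi: "(p ^^ i) ((q ^^ i) x) = x" "(q ^^ i) ((p ^^ i) x) = x" for i x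
  proof -
    show "(p ^^ i) ((q ^^ i) x) = x" for x by (induction i arbitrary: x) (simp_all add: pq funpow_swap1)
    show "(q ^^ i) ((p ^^ i) x) = x" for x by (induction i arbitrary: x) (simp_all add: pq funpow_swap1)
  qed
  have q_pow: "(q ^^ i) x = (p ^^ ((k - 1) * i)) x" for i x by (simp add: q_def funpow_mult)
  define orb where "orb x = {(p ^^ i) x | i. True}" for x
  have orb_p: "orb (p x) = orb x" for x
  proof (intro equalityI subsetI)
    fix y assume "y \<in> orb (p x)"
    then obtain i where "y = (p ^^ i) (p x)" by (auto simp: orb_def)
    then have "y = (p ^^ Suc i) x" by (simp add: funpow_swap1)
    then show "y \<in> orb x" unfolding orb_def by blast
  next
    fix y assume "y \<in> orb x"
    then obtain i where "y = (p ^^ i) x" by (auto simp: orb_def)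
    then have "y = (p ^^ i) (q (p x))" by (simp add: pq)
    then have "y = (p ^^ (i + (k - 1))) (p x)" by (simp add: q_def funpow_add)
    then show "y \<in> orb (p x)" unfolding orb_def by blast
  qed
  have orb_pow: "orb ((p ^^ i) x) = orb x" for i x by (induction i) (simp_all add: orb_p)
  define r where "r x = (SOME y. y \<in> orb x)" for x
  have r_pow: "r ((p ^^ i) x) = r x" for i x by (simp add: r_def orb_pow)
  have r_mem: "\<exists>i. x = (p ^^ i) (r x)" for x
  proof -
    have "x \<in> orb x" unfolding orb_def by (intro CollectI exI[of _ 0]) simp
    then have "r x \<in> orb x" unfolding r_def by (rule someI)
    then obtain i where i: "r x = (p ^^ i) x" by (auto simp: orb_def)
    then have "x = (q ^^ i) (r x)" using pqi by simp
    then show ?thesis unfolding q_pow by blast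
  qed
  \<comment> \<open>Reflection of the cycle about its representative, taking the \<open>i\<close>-th
    point after \<open>r x\<close> to the \<open>i\<close>-th point before it. The exponent is
    determined only up to the period; the next fact shows that the choice does not matter.\<close>
  define u where "u x = (q ^^ (SOME i. x = (p ^^ i) (r x))) (r x)" for x
  have u: "u x = (q ^^ i) (r x)" if i: "x = (p ^^ i) (r x)" for x i
  proof -
    let ?i = "SOME i. x = (p ^^ i) (r x)"
    have "(p ^^ ?i) (r x) = (p ^^ i) (r x)" using someI[of "\<lambda>i. x = (p ^^ i) (r x)", OF i] i by simp
    then have "(q ^^ (i + ?i)) ((p ^^ ?i) (r x)) = (q ^^ (?i + i)) ((p ^^ i) (r x))" by (simp add: add.commute)
    then have "(q ^^ i) (r x) = (q ^^ ?i) (r x)" by (simp add: funpow_add pqi)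
    then show ?thesis by (simp add: u_def)
  qed
  have uu: "u (u x) = x" for x
  proof -
    obtain i where i: "x = (p ^^ i) (r x)" using r_mem by blast
    have ux: "u x = (p ^^ ((k - 1) * i)) (r x)" using u[OF i] by (simp add: q_pow)
    have rr: "r (r x) = r x" using r_pow[of i "r x"] i by simp
    have "r (u x) = r x" unfolding ux r_pow by (rule rr)
    then have "u (u x) = (q ^^ ((k - 1) * i)) (r x)" using u[of "u x" "(k - 1) * i"] ux by simp
    also have "\<dots> = (p ^^ i) (r x)"
    proof -
      have "(p ^^ ((k - 1) * i)) ((p ^^ i) (r x)) = r x" using pqi(2)[of i "r x"] by (simp add: q_pow)
      then show ?thesis using pqi(2)[of "(k - 1) * i" "(p ^^ i) (r x)"] by simp
    qed
    finally show ?thesis using i by simp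
  qed
  have up: "u (p x) = q (u x)" for x
  proof -
    obtain i where i: "x = (p ^^ i) (r x)" using r_mem by blast
    have rp: "r (p x) = r x" using r_pow[of 1 x] by simp
    have "p x = (p ^^ Suc i) (r (p x))" unfolding rp using i by simp
    then have "u (p x) = (q ^^ Suc i) (r x)" using u[of "p x" "Suc i"] rp by simp
    then show ?thesis using u[OF i] by simp
  qed
  have fix_u: "u x = x" if "x \<notin> X" for x
  proof -
    have px: "(p ^^ i) x = x" for i 
      by (induction i) (simp_all add: permutes_not_in[OF assms(2) that])
    then have "orb x = {x}" by (auto simp: orb_def)
    then have "r x = x" by (simp add: r_def)
    then show ?thesis using u[of x 0] by simp
  qed
  have perm: "w permutes X" if "\<And>x. w (w x) = x" "\<And>x. x \<notin> X \<Longrightarrow> w x = x" for w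
    unfolding permutes_def using that by metis
  \<comment> \<open>An involution, because \<open>u\<close> conjugates \<open>p\<close> to its
    inverse.\<close>
  define v where "v = u \<circ> p"
  have vv: "v (v x) = x" for x by (simp add: v_def up uu pq)
  have "u permutes X" using uu fix_u by (rule perm)
  moreover have "v permutes X"
    using vv by (rule perm) (simp add: v_def fix_u permutes_not_in[OF assms(2)])
  ultimately show ?thesis
    using uu vv by (intro exI[of _ u] exI[of _ v]) (simp add: fun_eq_iff v_def)
qed

text \<open>For an involution \<open>u\<close> this is the product of its 2-cycles that meet
  \<open>Q\<close>. If \<open>Q\<close> contains at most one point of each and no fixed point,
  disjoint subsets of \<open>Q\<close> give commuting factors.\<close>

definition part :: "('a \<Rightarrow> 'a) \<Rightarrow> 'a set \<Rightarrow> 'a \<Rightarrow> 'a"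
  where "part u Q x = (if x \<in> Q \<or> u x \<in> Q then u x else x)"

lemma part_union:
  assumes "\<And>x. u (u x) = x" "Q \<inter> u ` Q = {}" "Q1 \<subseteq> Q" "Q2 \<subseteq> Q" "Q1 \<inter> Q2 = {}"
  shows "part u (Q1 \<union> Q2) = part u Q1 \<circ> part u Q2"
proof
  fix x
  have no: "\<not> (x \<in> Q \<and> u x \<in> Q)" using assms(1,2) by (metis IntI empty_iff image_eqI)
  show "part u (Q1 \<union> Q2) x = (part u Q1 \<circ> part u Q2) x"
    using no assms(3-5) by (auto simp: part_def assms(1))
qed

text \<open>Coordinates in which 2-cycles of an involution become flips: the point in
  \<open>Q\<close> is the \<open>False\<close> side, its partner the \<open>True\<close>
  side.\<close>

lemma part_flips:
  assumes u: "\<And>x. u (u x) = x" and Q: "Q \<inter> u ` Q = {}" and e: "inj_on e J" "e ` J \<subseteq> Q"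
  defines "c \<equiv> \<lambda>(x, s). if s then u (e x) else e x"
  shows "inj_on c (J \<times> UNIV)" "v \<subseteq> J \<Longrightarrow> flips J c v = part u (e ` v)"
proof -
  have no: "u (e x) \<noteq> e y" if "x \<in> J" "y \<in> J" for x y using that Q e by auto
  have inj_u: "u x = u y \<longleftrightarrow> x = y" for x y using u by metis
  show inj: "inj_on c (J \<times> UNIV)"
  proof (rule inj_onI)
    fix p q assume "p \<in> J \<times> UNIV" "q \<in> J \<times> UNIV" "c p = c q"
    then show "p = q" using no inj_u inj_on_eq_iff[OF e(1)] no[symmetric]
      by (cases p; cases q) (auto simp: c_def split: if_splits)
  qed
  assume v: "v \<subseteq> J"
  show "flips J c v = part u (e ` v)"
  proof
    fix p
    show "flips J c v p = part u (e ` v) p"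
    proof (cases "p \<in> c ` (J \<times> UNIV)")
      case True
      then obtain x s where x: "x \<in> J" "p = c (x, s)" by auto
      have mem: "e x \<in> e ` v \<longleftrightarrow> x \<in> v" using e(1) x(1) v by (rule inj_on_image_mem_iff)
      have not_mem: "u (e x) \<notin> e ` v" using no[OF x(1)] v by auto
      have "flips J c v p = c (x, if x \<in> v then \<not> s else s)" using x by (simp add: flips_apply[OF inj])
      moreover have "c (x, s') = (if s' then u (e x) else e x)" for s' by (simp add: c_def)
      ultimately show ?thesis
        using x(2) mem not_mem by (cases s) (simp_all add: part_def u)
    next
      case False
      have "p \<notin> e ` v" "u p \<notin> e ` v"
      proof -
        have "c (y, s) \<in> c ` (J \<times> UNIV)" if "y \<in> v" for y s using that v by auto
        then have ne: "p \<noteq> c (y, s)" if "y \<in> v" for y s using False that by metis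
        show "p \<notin> e ` v" using ne[of _ False] by (auto simp: c_def)
        show "u p \<notin> e ` v"
        proof
          assume "u p \<in> e ` v"
          then obtain y where y: "y \<in> v" "u p = e y" by auto
          then have "p = c (y, True)" using u[of p] by (simp add: c_def)
          then show False using ne y by blast
        qed
      qed
      then show ?thesis using False by (simp add: part_def flips_apply_other)
    qed
  qed
qed

lemma enumerate_blocks:
  fixes K :: "'k set"
  assumes "finite Q" "finite K"
  shows "\<exists>e. inj_on e ({..<card Q div card K} \<times> K) \<and> e ` ({..<card Q div card K} \<times> K) \<subseteq> Q"
  using card_le_inj[of "{..<card Q div card K} \<times> K" Q] assms
  by (simp add: card_cartesian_product) blast

context generating_symmetric_subset
begin

text \<open>Exceptional double transpositions are paid for one by one. The resulting
  \<open>\<beta> * M3\<close> is what makes the final bound quadratic.\<close>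

lemma flips_of_few:
  fixes f :: "('i \<times> bool) \<times> bool \<Rightarrow> nat"
  assumes f: "inj_on f ((I \<times> UNIV) \<times> UNIV)" "f ` ((I \<times> UNIV) \<times> UNIV) \<subseteq> {1..n}"
    and S: "finite S" "S \<subseteq> I"
  shows "flips (I \<times> UNIV) f (S \<times> UNIV) \<in> pw (card S * M3)"
  using S
proof (induction S)
  case empty
  show ?case using set_power_alt_0 f(1) by (metis Sigma_empty1 card.empty flips_empty mult_0)
next
  case (insert t S)
  have "sym_diff ({t} \<times> (UNIV :: bool set)) (S \<times> UNIV) = insert t S \<times> UNIV" using insert by auto
  then have "flips (I \<times> UNIV) f ({t} \<times> UNIV) \<circ> flips (I \<times> UNIV) f (S \<times> UNIV) = flips (I \<times> UNIV) f (insert t S \<times> UNIV)"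
    by (simp only: flips_comp[OF f(1)])
  moreover have "flips (I \<times> UNIV) f ({t} \<times> UNIV) \<in> pw M3"
  proof -
    have t: "t \<in> I" using insert by simp
    have neq: "f ((t, k), s) = f ((t, k'), s') \<longleftrightarrow> k = k' \<and> s = s'" for k s k' s'
      using t inj_on_eq_iff[OF f(1), of "((t, k), s)" "((t, k'), s')"] by simp
    have "f ((t, k), s) \<in> {1..n}" for k s using t by (intro subsetD[OF f(2)]) auto
    then show ?thesis unfolding flips_single[OF f(1) t]
      by (intro all_double_transpositions) (simp_all add: neq)
  qed
  ultimately have "flips (I \<times> UNIV) f (insert t S \<times> UNIV) \<in> pw (M3 + card S * M3)"
    using insert set_power_comp by (metis insert_subset)
  then show ?case using insert by simp
qed

text \<open>The 2-cycles are arranged in full blocks of \<open>N\<close>, and all but at most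
  \<open>\<beta>\<close> blocks are flipped within \<open>pw M\<close>. The fewer than
  \<open>(\<beta> + 1) * N\<close> remaining cycles are grouped in twos; again all but
  \<open>\<beta>\<close> groups together cost \<open>M\<close>, the others \<open>M3\<close> each. A
  last unpaired cycle is the transposition \<open>r\<close>.\<close>

lemma involution_in_power:
  assumes perm: "u permutes {1..n}" and "u \<circ> u = id"
  shows "\<exists>g\<in>pw (2 * M + \<beta> * M3). \<exists>r. u = g \<circ> r \<and>
    (r = id \<or> (\<exists>s t. s \<noteq> t \<and> {s, t} \<subseteq> {1..n} \<and> r = transpose s t))"
proof -
  have u: "u (u x) = x" for x using assms(2) by (metis comp_apply id_apply)
  define Q where "Q = {x\<in>{1..n}. x < u x}"
  have Q: "finite Q" "Q \<inter> u ` Q = {}" by (auto simp: Q_def u)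
  have range: "c ` (J \<times> UNIV) \<subseteq> {1..n}"
    if "c = (\<lambda>(x, s). if s then u (e x) else e x)" "e ` J \<subseteq> Q" for c J and e :: "'b \<Rightarrow> nat"
  proof
    fix y assume "y \<in> c ` (J \<times> UNIV)"
    then obtain x s where "x \<in> J" "y = c (x, s)" by auto
    then have x: "x \<in> J" "y = (if s then u (e x) else e x)" by (simp_all add: that(1))
    then have "e x \<in> {1..n}" using that by (auto simp: Q_def)
    then show "y \<in> {1..n}" using x permutes_in_image[OF perm] by auto
  qed
  have uQ: "u = part u Q"
  proof
    fix x show "u x = part u Q x"
    proof (cases "x \<in> {1..n}")
      case True
      then have "u x \<in> {1..n}" using permutes_in_image[OF perm] by simp
      then show ?thesis using True by (auto simp: part_def Q_def u)
    qed (use permutes_not_in[OF perm] in \<open>auto simp: part_def\<close>)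
  qed
  have N0: "0 < N" using N_ge by simp
  define B where "B = card Q div N"
  let ?I = "{..<B}" and ?K = "{..<N}"
  obtain e' where e': "inj_on e' (?I \<times> ?K)" "e' ` (?I \<times> ?K) \<subseteq> Q"
    using enumerate_blocks[OF Q(1), of ?K] by (auto simp: B_def)
  define c where "c = (\<lambda>(x, s). if s then u (e' x) else e' x)"
  note c = part_flips[OF u Q(2) e', folded c_def]
  obtain S where S: "S \<subseteq> ?I" "j * card S \<le> 2 * a"
    "\<And>v. v \<subseteq> (?I - S) \<times> ?K \<Longrightarrow> (\<forall>i\<in>?I. even (card (v `` {i}))) \<Longrightarrow> flips (?I \<times> ?K) c v \<in> pw (4 * (a div j + 2))"
    using flips_in_power[OF _ _ _ j c(1) range[OF c_def e'(2)] dense] by (auto simp: N)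
  let ?v = "(?I - S) \<times> ?K"
  \<comment> \<open>Full blocks are even because \<open>N\<close> is.\<close>
  have "even (card (?v `` {i}))" for i
  proof -
    have "?v `` {i} = (if i \<in> ?I - S then ?K else {})" by auto
    then show ?thesis by (simp add: N)
  qed
  then have "flips (?I \<times> ?K) c ?v \<in> pw M" unfolding M by (intro S(3)) auto
  then have g0: "part u (e' ` ?v) \<in> pw M" using c(2)[of ?v] by (metis Diff_subset Sigma_mono subset_refl)
  define Q1 where "Q1 = Q - e' ` ?v"
  have "e' ` ?v \<subseteq> Q" using e'(2) by auto
  then have split1: "u = part u (e' ` ?v) \<circ> part u Q1"
    using part_union[OF u Q(2), of "e' ` ?v" Q1] uQ by (auto simp: Q1_def Un_absorb1)
  have card_S: "card S \<le> \<beta>" "finite S" using S card_bad by (auto intro: finite_subset)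
  have cardQ1: "card Q1 < (\<beta> + 1) * N"
  proof -
    have "card (e' ` ?v) = card ?v" using e'(1) by (intro card_image) (auto intro: inj_on_subset)
    also have "\<dots> = (B - card S) * N" using S card_S by (simp add: card_cartesian_product card_Diff_subset)
    finally have "card Q1 = card Q - (B - card S) * N"
      using Q(1) \<open>e' ` ?v \<subseteq> Q\<close> by (simp add: Q1_def card_Diff_subset finite_subset)
    moreover have "card Q = B * N + card Q mod N" by (simp add: B_def)
    moreover have "card Q mod N < N" using N0 by simp
    moreover have "B * N \<le> (B - card S + card S) * N" by (intro mult_right_mono) auto
    then have "B * N \<le> (B - card S) * N + card S * N" by (simp only: distrib_right)
    moreover have "card S * N \<le> \<beta> * N" using card_S by simp
    ultimately have "card Q1 < N + \<beta> * N" by linarith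
    then show ?thesis by (simp add: distrib_right)
  qed
  have Q1: "finite Q1" "Q1 \<subseteq> Q" using Q by (auto simp: Q1_def)
  define B2 where "B2 = card Q1 div 2"
  let ?I2 = "{..<B2}"
  obtain d' where d': "inj_on d' (?I2 \<times> (UNIV :: bool set))" "d' ` (?I2 \<times> UNIV) \<subseteq> Q1"
    using enumerate_blocks[OF Q1(1), of "UNIV :: bool set"] by (auto simp: B2_def)
  have d'Q: "d' ` (?I2 \<times> UNIV) \<subseteq> Q" using Q1 d' by auto
  define f where "f = (\<lambda>(x, s). if s then u (d' x) else d' x)"
  note f = part_flips[OF u Q(2) d'(1) d'Q, folded f_def]
  note f_range = range[OF f_def d'Q]
  have "card ?I2 * (2 * N) \<le> n"
  proof -
    have "card ?I2 * 2 \<le> (\<beta> + 1) * N" using cardQ1 by (simp add: B2_def)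
    then have "card ?I2 * 2 * N \<le> (\<beta> + 1) * N * N" by (intro mult_right_mono) auto
    also have "\<dots> \<le> n" using room by (simp only: power2_eq_square mult.assoc)
    finally show ?thesis by (simp add: mult_ac)
  qed
  then obtain S2 where S2: "S2 \<subseteq> ?I2" "card S2 \<le> \<beta>"
    "\<forall>I'\<subseteq>?I2 - S2. flips (?I2 \<times> UNIV) f (I' \<times> UNIV) \<in> pw M"
    using few_bad_double_transpositions[OF _ _ f(1) f_range] by auto
  have finS2: "finite S2" using S2 by (auto intro: finite_subset)
  define g1 where "g1 = flips (?I2 \<times> UNIV) f ((?I2 - S2) \<times> UNIV)"
  define g2 where "g2 = flips (?I2 \<times> UNIV) f (S2 \<times> UNIV)"
  have g1: "g1 \<in> pw M" using S2(3) by (simp add: g1_def)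
  have "g2 \<in> pw (card S2 * M3)" unfolding g2_def by (rule flips_of_few[OF f(1) f_range finS2 S2(1)])
  then have g2: "g2 \<in> pw (\<beta> * M3)"
    by (rule pw_mono) (use S2 M3_even in \<open>auto simp flip: diff_mult_distrib\<close>)
  have "sym_diff ((?I2 - S2) \<times> (UNIV :: bool set)) (S2 \<times> UNIV) = ?I2 \<times> UNIV" using S2(1) by auto
  then have g12: "g1 \<circ> g2 = part u (d' ` (?I2 \<times> UNIV))"
    unfolding g1_def g2_def flips_comp[OF f(1)] by (simp only: f(2)[OF subset_refl])
  define Q2 where "Q2 = Q1 - d' ` (?I2 \<times> UNIV)"
  have split2: "part u Q1 = g1 \<circ> g2 \<circ> part u Q2"
    using part_union[OF u Q(2), of "d' ` (?I2 \<times> UNIV)" Q2] d'(2) Q1(2)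
    by (auto simp: Q2_def Un_absorb1 g12)
  have "card Q2 \<le> 1"
  proof -
    have "card (d' ` (?I2 \<times> UNIV)) = B2 * 2" using d'(1) by (simp add: card_image card_cartesian_product)
    then have "card Q2 = card Q1 - B2 * 2" using d'(2) by (simp add: Q2_def card_Diff_subset)
    then show ?thesis by (simp add: B2_def)
  qed
  moreover have finQ2: "finite Q2" using Q1 by (simp add: Q2_def)
  ultimately consider "Q2 = {}" | x where "Q2 = {x}"
    by (metis card_0_eq card_1_singletonE le_antisym less_one linorder_not_le)
  then have r: "part u Q2 = id \<or> (\<exists>s t. s \<noteq> t \<and> {s, t} \<subseteq> {1..n} \<and> part u Q2 = transpose s t)"
  proof cases
    case 1
    then show ?thesis by (simp add: part_def fun_eq_iff)
  next
    case 2
    then have "x \<in> Q" using Q1 by (auto simp: Q2_def)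
    then have "x \<noteq> u x" "{x, u x} \<subseteq> {1..n}" using permutes_in_image[OF perm, of x] by (auto simp: Q_def)
    moreover have "part u Q2 = transpose x (u x)"
    proof
      fix y
      have "u y = x \<longleftrightarrow> y = u x" using u by metis
      then show "part u Q2 y = transpose x (u x) y" by (auto simp: part_def 2 transpose_def)
    qed
    ultimately show ?thesis by blast
  qed
  have "u = (part u (e' ` ?v) \<circ> (g1 \<circ> g2)) \<circ> part u Q2"
    using split1 split2 by (metis comp_assoc)
  moreover have "part u (e' ` ?v) \<circ> (g1 \<circ> g2) \<in> pw (M + (M + \<beta> * M3))"
    by (intro set_power_comp g0 g1 g2)
  moreover have "M + (M + \<beta> * M3) = 2 * M + \<beta> * M3" by simp
  ultimately show ?thesis using r by metis
qed

lemma pw_even: "x \<in> pw m \<Longrightarrow> evenperm x"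
proof (induction m arbitrary: x)
  case 0
  then show ?case by (simp add: set_power_0 alt_group_one)
next
  case (Suc m)
  then obtain b y where b: "b \<in> A" "y \<in> pw m" "x = b \<circ> y" by (auto simp: set_power_alt_Suc)
  have "b \<in> carrier (alt_group n)" using b(1) gen generate.incl by metis
  then have "evenperm b" by (simp add: alt_group_carrier)
  moreover have "permutation b" "permutation y"
    using b permutes pw_permutes permutation_permutes by (metis finite_atLeastAtMost)+
  ultimately show ?case using Suc.IH b evenperm_comp by metis
qed

text \<open>Writing the second involution as \<open>q \<circ> inv' h\<close> instead of
  \<open>h \<circ> q\<close> brings the two leftover transpositions together. By parity both are
  present or both absent, and through two fresh points their product becomes a product of two double
  transpositions.\<close>

theorem power_covers: "pw (4 * M + 2 * (\<beta> * M3) + 2 * M3) = carrier (alt_group n)"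
proof (intro equalityI subsetI)
  fix p assume "p \<in> pw (4 * M + 2 * (\<beta> * M3) + 2 * M3)"
  then show "p \<in> carrier (alt_group n)" using pw_even pw_permutes by (simp add: alt_group_carrier)
next
  fix p assume "p \<in> carrier (alt_group n)"
  then have p: "p permutes {1..n}" "evenperm p" by (simp_all add: alt_group_carrier)
  let ?k = "2 * M + \<beta> * M3"
  obtain u v where uv: "u permutes {1..n}" "v permutes {1..n}" "u \<circ> u = id" "v \<circ> v = id" "p = u \<circ> v"
    using permutes_product_two_involutions[OF _ p(1)] by auto
  let ?T = "\<lambda>r. \<exists>s t. s \<noteq> t \<and> {s, t} \<subseteq> {1..n} \<and> r = transpose s t"
  obtain g r where g: "g \<in> pw ?k" "u = g \<circ> r" "r = id \<or> ?T r"
    using involution_in_power[OF uv(1,3)] by blast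
  obtain h q where h: "h \<in> pw ?k" "v = h \<circ> q" "q = id \<or> ?T q"
    using involution_in_power[OF uv(2,4)] by blast
  have q: "q \<circ> q = id" "r \<circ> r = id" using h(3) g(3) by auto
  have bij: "bij h" using h pw_permutes permutes_bij by blast
  have "v = q \<circ> inv' h"
  proof -
    have "v (h (q x)) = x" for x using uv(4) h(2) by (metis comp_apply id_apply)
    then have "v (h x) = q x" for x using q(1) by (metis comp_apply id_apply)
    then show ?thesis using bij by (simp add: fun_eq_iff) (metis bij_inv_eq_iff)
  qed
  then have pg: "p = g \<circ> (r \<circ> q) \<circ> inv' h" using uv(5) g(2) by (simp add: comp_assoc)
  have odd: False if "s \<noteq> t" "p = g \<circ> transpose s t \<circ> inv' h" for s t
  proof -
    have "evenperm g" "evenperm (inv' h)" "permutation g" "permutation (inv' h)"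
      using g h pw_even pw_inv pw_permutes permutation_permutes by (metis finite_atLeastAtMost)+
    then have "\<not> evenperm p"
      using that by (simp add: evenperm_comp evenperm_swap permutation_compose permutation_swap_id)
    then show False using p by simp
  qed
  have "r \<circ> q \<in> pw (2 * M3)"
  proof (cases "r = id"; cases "q = id")
    assume "r = id" "q = id"
    then show ?thesis using id_mem_even[of M3] by simp
  next
    assume "r = id" "q \<noteq> id"
    then obtain s t where st: "s \<noteq> t" "p = g \<circ> transpose s t \<circ> inv' h" using h(3) pg by auto
    then show ?thesis using odd by blast
  next
    assume "r \<noteq> id" "q = id"
    then obtain s t where st: "s \<noteq> t" "p = g \<circ> transpose s t \<circ> inv' h" using g(3) pg by auto
    then show ?thesis using odd by blast
  next
    assume "r \<noteq> id" "q \<noteq> id"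
    then obtain s t s' t' where st: "s \<noteq> t" "{s, t} \<subseteq> {1..n}" "r = transpose s t"
      and st': "s' \<noteq> t'" "{s', t'} \<subseteq> {1..n}" "q = transpose s' t'" using g(3) h(3) by blast
    have "card {s, t, s', t'} \<le> 4" by (simp add: card_insert_le_m1)
    then have "2 \<le> card ({1..n} - {s, t, s', t'})"
      using n_large diff_card_le_card_Diff[of "{s, t, s', t'}" "{1..n}"] by simp
    then obtain V where "V \<subseteq> {1..n} - {s, t, s', t'}" "card V = 2" using obtain_subset_with_card_n by metis
    then obtain x y where xy: "{x, y} \<subseteq> {1..n} - {s, t, s', t'}" "x \<noteq> y" by (auto simp: card_2_iff)
    have "double_transposition s t x y \<circ> double_transposition x y s' t' \<in> pw (M3 + M3)"
      using st st' xy by (intro set_power_comp all_double_transpositions) auto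
    then show ?thesis
      unfolding double_transposition_chain unfolding st(3) st'(3) double_transposition_def by (simp add: mult_2)
  qed
  then have "g \<circ> (r \<circ> q) \<circ> inv' h \<in> pw ((?k + 2 * M3) + ?k)"
    by (intro set_power_comp g h pw_inv)
  moreover have "(?k + 2 * M3) + ?k = 4 * M + 2 * (\<beta> * M3) + 2 * M3" by simp
  ultimately show "p \<in> pw (4 * M + 2 * (\<beta> * M3) + 2 * M3)" using pg by metis
qed

end

section \<open>A spectral bound for dense sets\<close>

text \<open>Obtained by expanding the squared norm of \<open>m\<close> scaled by
  \<open>\<omega>\<close> minus its projection. The common norm may vanish, as a component of a
  function can be zero.\<close>

lemma bessel_orthogonal:
  fixes w :: "'g \<Rightarrow> 'x \<Rightarrow> real"
  assumes fin: "finite X" "finite \<Gamma>" and \<omega>: "0 \<le> \<omega>"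
    and orth: "\<And>i k. i \<in> \<Gamma> \<Longrightarrow> k \<in> \<Gamma> \<Longrightarrow> i \<noteq> k \<Longrightarrow> (\<Sum>x\<in>X. w i x * w k x) = 0"
    and norm: "\<And>i. i \<in> \<Gamma> \<Longrightarrow> (\<Sum>x\<in>X. (w i x)\<^sup>2) = \<omega>"
  shows "(\<Sum>i\<in>\<Gamma>. (\<Sum>x\<in>X. m x * w i x)\<^sup>2) \<le> \<omega> * (\<Sum>x\<in>X. (m x)\<^sup>2)"
proof (cases "\<omega> = 0")
  case True
  have "(\<Sum>x\<in>X. m x * w i x) = 0" if i: "i \<in> \<Gamma>" for i
  proof -
    have "(\<Sum>x\<in>X. (w i x)\<^sup>2) = 0" using norm[OF i] True by simp
    then have "\<forall>x\<in>X. (w i x)\<^sup>2 = 0" using fin by (simp add: sum_nonneg_eq_0_iff)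
    then show ?thesis by simp
  qed
  then show ?thesis using True by simp
next
  case False
  then have pos: "0 < \<omega>" using \<omega> by simp
    define c where "c i = (\<Sum>x\<in>X. m x * w i x)" for i
    have cross: "(\<Sum>x\<in>X. m x * (\<Sum>i\<in>\<Gamma>. c i * w i x)) = (\<Sum>i\<in>\<Gamma>. (c i)\<^sup>2)"
    proof -
      have "(\<Sum>x\<in>X. m x * (\<Sum>i\<in>\<Gamma>. c i * w i x)) = (\<Sum>i\<in>\<Gamma>. \<Sum>x\<in>X. c i * (m x * w i x))"
        by (subst sum.swap) (simp add: sum_distrib_left mult_ac)
      also have "\<dots> = (\<Sum>i\<in>\<Gamma>. (c i)\<^sup>2)" by (simp add: c_def power2_eq_square flip: sum_distrib_left)
      finally show ?thesis .
    qed
    have sq: "(\<Sum>x\<in>X. (\<Sum>i\<in>\<Gamma>. c i * w i x)\<^sup>2) = \<omega> * (\<Sum>i\<in>\<Gamma>. (c i)\<^sup>2)"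
    proof -
      have "(\<Sum>x\<in>X. (\<Sum>i\<in>\<Gamma>. c i * w i x)\<^sup>2) = (\<Sum>x\<in>X. \<Sum>i\<in>\<Gamma>. \<Sum>k\<in>\<Gamma>. c i * c k * (w i x * w k x))"
        by (simp add: power2_eq_square sum_product mult_ac)
      also have "\<dots> = (\<Sum>i\<in>\<Gamma>. \<Sum>k\<in>\<Gamma>. \<Sum>x\<in>X. c i * c k * (w i x * w k x))"
        by (subst sum.swap, rule sum.cong[OF refl], rule sum.swap)
      also have "\<dots> = (\<Sum>i\<in>\<Gamma>. \<Sum>k\<in>\<Gamma>. if k = i then (c i)\<^sup>2 * \<omega> else 0)"
      proof (intro sum.cong refl)
        fix i k assume "i \<in> \<Gamma>" "k \<in> \<Gamma>"
        then show "(\<Sum>x\<in>X. c i * c k * (w i x * w k x)) = (if k = i then (c i)\<^sup>2 * \<omega> else 0)"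
          using orth[of i k] norm[of i] by (simp add: power2_eq_square flip: sum_distrib_left)
      qed
      also have "\<dots> = \<omega> * (\<Sum>i\<in>\<Gamma>. (c i)\<^sup>2)" using fin by (simp add: sum_distrib_left mult.commute)
      finally show ?thesis .
    qed
    have "0 \<le> (\<Sum>x\<in>X. (\<omega> * m x - (\<Sum>i\<in>\<Gamma>. c i * w i x))\<^sup>2)" by (intro sum_nonneg) auto
    also have "\<dots> = \<omega>\<^sup>2 * (\<Sum>x\<in>X. (m x)\<^sup>2) - 2 * \<omega> * (\<Sum>x\<in>X. m x * (\<Sum>i\<in>\<Gamma>. c i * w i x)) + (\<Sum>x\<in>X. (\<Sum>i\<in>\<Gamma>. c i * w i x)\<^sup>2)"
      by (simp add: power2_diff power_mult_distrib sum.distrib sum_subtractf sum_distrib_left mult_ac)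
    also have "\<dots> = \<omega> * (\<omega> * (\<Sum>x\<in>X. (m x)\<^sup>2) - (\<Sum>i\<in>\<Gamma>. (c i)\<^sup>2))"
      unfolding cross sq by (simp add: power2_eq_square algebra_simps)
    finally show ?thesis using pos by (simp add: zero_le_mult_iff c_def)
qed

section \<open>Functions on the symmetric group and their components under flips\<close>

abbreviation Sym :: "nat \<Rightarrow> (nat \<Rightarrow> nat) set"
  where "Sym n \<equiv> {p. p permutes {1..n}}"

definition nsq :: "nat \<Rightarrow> ((nat \<Rightarrow> nat) \<Rightarrow> real) \<Rightarrow> real"
  where "nsq n v = (\<Sum>x\<in>Sym n. (v x)\<^sup>2)"

text \<open>Projection to the \<open>chi U\<close>-isotypic part for the flips acting by right
  translation. Functions live on the whole symmetric group because single flips are odd.\<close>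

definition component :: "'k set \<Rightarrow> ('k \<times> bool \<Rightarrow> nat) \<Rightarrow> 'k set \<Rightarrow> ((nat \<Rightarrow> nat) \<Rightarrow> real) \<Rightarrow> (nat \<Rightarrow> nat) \<Rightarrow> real"
  where "component K c U v x = (\<Sum>y\<in>Pow K. chi U y * v (x \<circ> flips K c y)) / 2 ^ card K"

declare finite_permutations [simp]

lemma sum_Sym_shift:
  assumes "f permutes {1..n}"
  shows "(\<Sum>x\<in>Sym n. g (x \<circ> f)) = (\<Sum>x\<in>Sym n. g x)"
proof (rule sum.reindex_bij_witness[of _ "\<lambda>x. x \<circ> inv' f" "\<lambda>x. x \<circ> f"])
  fix x assume x: "x \<in> Sym n"
  show "(x \<circ> f) \<circ> inv' f = x" "(x \<circ> inv' f) \<circ> f = x"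
    using permutes_inv_o[OF assms] by (metis comp_assoc comp_id)+
  show "x \<circ> f \<in> Sym n" "x \<circ> inv' f \<in> Sym n"
    using x assms permutes_inv[OF assms] by (auto intro: permutes_compose)
qed simp

lemma nsq_shift: "f permutes {1..n} \<Longrightarrow> nsq n (\<lambda>x. v (x \<circ> f)) = nsq n v"
  unfolding nsq_def by (rule sum_Sym_shift)

lemma nsq_nonneg [simp]: "0 \<le> nsq n v"
  by (simp add: nsq_def sum_nonneg)

locale flip_structure =
  fixes n :: nat and K :: "'k set" and c :: "'k \<times> bool \<Rightarrow> nat"
  assumes finK: "finite K" and K: "K \<noteq> {}"
    and c: "inj_on c (K \<times> UNIV)" "c ` (K \<times> UNIV) \<subseteq> {1..n}"
begin

abbreviation t :: "'k set \<Rightarrow> nat \<Rightarrow> nat" where "t \<equiv> flips K c"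
abbreviation comp :: "'k set \<Rightarrow> ((nat \<Rightarrow> nat) \<Rightarrow> real) \<Rightarrow> (nat \<Rightarrow> nat) \<Rightarrow> real" where "comp \<equiv> component K c"

lemma t: "t y permutes {1..n}" using c by (rule flips_permutes)

lemma sum_components: "(\<Sum>U\<in>Pow K. comp U v x) = v x"
proof -
  have "(\<Sum>U\<in>Pow K. comp U v x) = (\<Sum>U\<in>Pow K. \<Sum>y\<in>Pow K. chi U y * v (x \<circ> t y)) / 2 ^ card K"
    by (simp add: component_def sum_divide_distrib)
  also have "(\<Sum>U\<in>Pow K. \<Sum>y\<in>Pow K. chi U y * v (x \<circ> t y)) = (\<Sum>y\<in>Pow K. (\<Sum>U\<in>Pow K. chi U y) * v (x \<circ> t y))"
    by (subst sum.swap) (simp add: sum_distrib_right)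
  also have "\<dots> = (\<Sum>y\<in>Pow K. if y = {} then 2 ^ card K * v (x \<circ> t y) else 0)"
    using finK by (intro sum.cong refl) (simp add: sum_chi)
  also have "\<dots> = 2 ^ card K * v (x \<circ> t {})" using finK by simp
  also have "x \<circ> t {} = x" using flips_empty[OF c(1)] by (metis comp_id)
  finally show ?thesis by simp
qed

lemma component_shift:
  assumes "z \<subseteq> K"
  shows "comp U v (x \<circ> t z) = chi U z * comp U v x"
proof -
  have "(\<Sum>y\<in>Pow K. chi U y * v (x \<circ> t z \<circ> t y)) = (\<Sum>y\<in>Pow K. chi U (sym_diff z y) * v (x \<circ> t y))"
  proof (rule sum.reindex_bij_witness[of _ "sym_diff z" "sym_diff z"])
    fix y assume y: "y \<in> Pow K"
    show "sym_diff z (sym_diff z y) = y" "sym_diff z (sym_diff z y) = y" by auto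
    show "sym_diff z y \<in> Pow K" "sym_diff z y \<in> Pow K" using y assms by auto
    have "x \<circ> t (sym_diff z y) = x \<circ> t z \<circ> t y" by (simp only: comp_assoc flips_comp[OF c(1)])
    moreover have "sym_diff z (sym_diff z y) = y" by auto
    ultimately show "chi U (sym_diff z (sym_diff z y)) * v (x \<circ> t (sym_diff z y)) = chi U y * v (x \<circ> t z \<circ> t y)" by simp
  qed
  also have "\<dots> = (\<Sum>y\<in>Pow K. chi U z * (chi U y * v (x \<circ> t y)))"
  proof (intro sum.cong refl)
    fix y assume "y \<in> Pow K"
    then have "chi U (sym_diff z y) = chi U z * chi U y"
      using assms finK by (intro chi_sym_diff) (auto intro: finite_subset)
    then show "chi U (sym_diff z y) * v (x \<circ> t y) = chi U z * (chi U y * v (x \<circ> t y))" by simp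
  qed
  finally show ?thesis by (simp add: component_def sum_distrib_left)
qed

text \<open>Flipping a label in exactly one of \<open>U\<close> and \<open>U'\<close> preserves the
  sum and negates every summand.\<close>

lemma orthogonal:
  assumes "U \<subseteq> K" "U' \<subseteq> K" "U \<noteq> U'"
    and g: "\<And>x z. z \<subseteq> K \<Longrightarrow> g (x \<circ> t z) = chi U z * g x"
    and h: "\<And>x z. z \<subseteq> K \<Longrightarrow> h (x \<circ> t z) = chi U' z * h x"
  shows "(\<Sum>x\<in>Sym n. g x * h x :: real) = 0"
proof -
  obtain k where k: "k \<in> sym_diff U U'" using assms by blast
  then have kK: "{k} \<subseteq> K" using assms by auto
  have "chi U {k} * chi U' {k} = -1" using k by (auto simp: chi_def)
  then have "g (x \<circ> t {k}) * h (x \<circ> t {k}) = - (g x * h x)" for x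
    using g[OF kK, of x] h[OF kK, of x] by (metis mult.assoc mult.left_commute mult_minus1)
  then have "(\<Sum>x\<in>Sym n. g x * h x) = (\<Sum>x\<in>Sym n. - (g x * h x))"
    using sum_Sym_shift[OF t[of "{k}"], of "\<lambda>x. g x * h x"] by simp
  then show ?thesis by (simp add: sum_negf)
qed

lemma nsq_components: "nsq n v = (\<Sum>U\<in>Pow K. nsq n (comp U v))"
proof -
  have "(v x)\<^sup>2 = (\<Sum>U\<in>Pow K. comp U v x)\<^sup>2" for x by (simp only: sum_components)
  then have "nsq n v = (\<Sum>x\<in>Sym n. \<Sum>U\<in>Pow K. \<Sum>U'\<in>Pow K. comp U v x * comp U' v x)"
    unfolding nsq_def by (simp add: power2_eq_square sum_product)
  also have "\<dots> = (\<Sum>U\<in>Pow K. \<Sum>U'\<in>Pow K. \<Sum>x\<in>Sym n. comp U v x * comp U' v x)"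
    by (subst sum.swap, rule sum.cong[OF refl], rule sum.swap)
  also have "\<dots> = (\<Sum>U\<in>Pow K. \<Sum>U'\<in>Pow K. if U' = U then nsq n (comp U v) else 0)"
  proof (intro sum.cong refl)
    fix U U' assume U: "U \<in> Pow K" "U' \<in> Pow K"
    show "(\<Sum>x\<in>Sym n. comp U v x * comp U' v x) = (if U' = U then nsq n (comp U v) else 0)"
    proof (cases "U = U'")
      case True
      then show ?thesis by (simp add: nsq_def power2_eq_square)
    next
      case False
      then have "(\<Sum>x\<in>Sym n. comp U v x * comp U' v x) = 0"
        using U component_shift by (intro orthogonal[of U U']) auto
      then show ?thesis using False by simp
    qed
  qed
  also have "\<dots> = (\<Sum>U\<in>Pow K. nsq n (comp U v))" using finK by simp
  finally show ?thesis .
qed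

end

section \<open>The averaging operator\<close>

context symmetric_subset
begin

text \<open>Not normalised. It multiplies on the left and so commutes with the right translations by
  flips and moves.\<close>

definition avg :: "((nat \<Rightarrow> nat) \<Rightarrow> real) \<Rightarrow> (nat \<Rightarrow> nat) \<Rightarrow> real"
  where "avg v x = (\<Sum>a\<in>A. v (a \<circ> x))"

lemma avg_eq:
  assumes "x \<in> Sym n"
  shows "avg v x = (\<Sum>y\<in>Sym n. of_bool (y \<circ> inv' x \<in> A) * v y)"
proof -
  have "(\<Sum>y\<in>Sym n. of_bool (y \<circ> inv' x \<in> A) * v y) = (\<Sum>y\<in>Sym n. of_bool (y \<in> A) * v (y \<circ> x))"
  proof (rule sum_Sym_shift[symmetric, where g = "\<lambda>y. of_bool (y \<circ> inv' x \<in> A) * v y" and f = x, THEN trans])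
    show "x permutes {1..n}" using assms by simp
    have "y \<circ> x \<circ> inv' x = y" for y :: "nat \<Rightarrow> nat" using assms permutes_inv_o by (metis comp_assoc comp_id mem_Collect_eq)
    then show "(\<Sum>y\<in>Sym n. of_bool (y \<circ> x \<circ> inv' x \<in> A) * v (y \<circ> x)) = (\<Sum>y\<in>Sym n. of_bool (y \<in> A) * v (y \<circ> x))" by (simp only:)
  qed
  also have "\<dots> = (\<Sum>y\<in>Sym n. if y \<in> A then v (y \<circ> x) else 0)" by (intro sum.cong) auto
  also have "\<dots> = (\<Sum>y\<in>Sym n \<inter> A. v (y \<circ> x))" by (rule sum.inter_restrict[OF finite_permutations[OF finite_atLeastAtMost], symmetric])
  also have "Sym n \<inter> A = A" using permutes by auto
  finally show ?thesis unfolding avg_def by (rule sym)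
qed

lemma row_sum:
  assumes "x \<in> Sym n"
  shows "(\<Sum>y\<in>Sym n. (of_bool (y \<circ> inv' x \<in> A))\<^sup>2) = real (card A)"
proof -
  have "(of_bool b)\<^sup>2 = (of_bool b * 1 :: real)" for b by (cases b) auto
  then have "(\<Sum>y\<in>Sym n. (of_bool (y \<circ> inv' x \<in> A))\<^sup>2) = avg (\<lambda>_. 1) x"
    unfolding avg_eq[OF assms] by (simp only:)
  then show ?thesis by (simp add: avg_def)
qed

text \<open>A Hilbert-Schmidt bound: each of the \<open>fact n\<close> rows of the kernel has
  squared norm \<open>card A\<close>, and Bessel's inequality applies row by row.\<close>

lemma nsq_avg_le_family:
  fixes w :: "'g \<Rightarrow> (nat \<Rightarrow> nat) \<Rightarrow> real" and \<omega> :: real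
  assumes "finite \<Gamma>" "0 \<le> \<omega>"
    and "\<And>i k. i \<in> \<Gamma> \<Longrightarrow> k \<in> \<Gamma> \<Longrightarrow> i \<noteq> k \<Longrightarrow> (\<Sum>x\<in>Sym n. w i x * w k x) = 0"
    and "\<And>i. i \<in> \<Gamma> \<Longrightarrow> nsq n (w i) = \<omega>"
  shows "(\<Sum>i\<in>\<Gamma>. nsq n (avg (w i))) \<le> fact n * card A * \<omega>"
proof -
  have "(\<Sum>i\<in>\<Gamma>. nsq n (avg (w i))) = (\<Sum>x\<in>Sym n. \<Sum>i\<in>\<Gamma>. (avg (w i) x)\<^sup>2)"
    unfolding nsq_def by (rule sum.swap)
  also have "\<dots> \<le> (\<Sum>x\<in>Sym n. \<omega> * real (card A))"
  proof (rule sum_mono)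
    fix x assume x: "x \<in> Sym n"
    have "(\<Sum>i\<in>\<Gamma>. (avg (w i) x)\<^sup>2) \<le> \<omega> * (\<Sum>y\<in>Sym n. (of_bool (y \<circ> inv' x \<in> A))\<^sup>2)"
      unfolding avg_eq[OF x] by (rule bessel_orthogonal) (use assms in \<open>auto simp: nsq_def\<close>)
    then show "(\<Sum>i\<in>\<Gamma>. (avg (w i) x)\<^sup>2) \<le> \<omega> * card A" unfolding row_sum[OF x] .
  qed
  finally show ?thesis by (simp add: card_permutations mult_ac)
qed

lemma avg_shift: "avg (\<lambda>x. v (x \<circ> f)) x = avg v (x \<circ> f)"
  by (simp add: avg_def comp_assoc)

end

text \<open>The sum vanishes over every coset of the alternating group, not only in total: for even
  \<open>A\<close> the operator is as large on the sign as on the constants, so both must be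
  excluded.\<close>

definition mean_zero :: "nat \<Rightarrow> ((nat \<Rightarrow> nat) \<Rightarrow> real) \<Rightarrow> bool"
  where "mean_zero n v \<longleftrightarrow> (\<forall>x\<in>Sym n. (\<Sum>p\<in>carrier (alt_group n). v (x \<circ> p)) = 0)"

lemma finite_alt [simp]: "finite (carrier (alt_group n))"
  by (rule finite_subset[of _ "Sym n"]) (auto simp: alt_group_carrier)

lemma evenperm_conj:
  assumes "f permutes {1..n}" "p \<in> carrier (alt_group n)"
  shows "inv' f \<circ> p \<circ> f \<in> carrier (alt_group n)"
proof -
  have perm: "permutation f" "permutation p" "permutation (inv' f)"
    using assms permutes_inv[OF assms(1)] permutation_permutes by (auto simp: alt_group_carrier)
  then have "evenperm (inv' f \<circ> p \<circ> f)"
    using assms(2) by (simp add: evenperm_comp permutation_compose evenperm_inv alt_group_carrier)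
  moreover have "inv' f \<circ> p \<circ> f permutes {1..n}"
    using assms permutes_inv[OF assms(1)] by (intro permutes_compose) (auto simp: alt_group_carrier)
  ultimately show ?thesis by (simp add: alt_group_carrier)
qed

lemma mean_zero_shift:
  assumes f: "f permutes {1..n}" and v: "mean_zero n v"
  shows "mean_zero n (\<lambda>x. v (x \<circ> f))"
  unfolding mean_zero_def
proof
  fix x assume x: "x \<in> Sym n"
  have ff: "f \<circ> inv' f = id" "inv' f \<circ> f = id" using permutes_inv_o[OF f] by auto
  have "(\<Sum>p\<in>carrier (alt_group n). v (x \<circ> p \<circ> f)) = (\<Sum>p\<in>carrier (alt_group n). v (x \<circ> f \<circ> p))"
  proof (rule sum.reindex_bij_witness[of _ "\<lambda>p. f \<circ> p \<circ> inv' f" "\<lambda>p. inv' f \<circ> p \<circ> f"])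
    fix p assume p: "p \<in> carrier (alt_group n)"
    show "f \<circ> (inv' f \<circ> p \<circ> f) \<circ> inv' f = p" "inv' f \<circ> (f \<circ> p \<circ> inv' f) \<circ> f = p"
      using ff by (metis comp_assoc comp_id id_comp)+
    show "inv' f \<circ> p \<circ> f \<in> carrier (alt_group n)" using f p by (rule evenperm_conj)
    show "f \<circ> p \<circ> inv' f \<in> carrier (alt_group n)"
      using evenperm_conj[OF permutes_inv[OF f] p] by (simp only: permutes_inv_inv[OF f])
    show "v (x \<circ> f \<circ> (inv' f \<circ> p \<circ> f)) = v (x \<circ> p \<circ> f)"
      using ff by (metis comp_assoc comp_id)
  qed
  also have "x \<circ> f \<in> Sym n" using x f by (auto intro: permutes_compose)
  then have "(\<Sum>p\<in>carrier (alt_group n). v (x \<circ> f \<circ> p)) = 0" using v by (auto simp: mean_zero_def)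
  finally show "(\<Sum>p\<in>carrier (alt_group n). v (x \<circ> p \<circ> f)) = 0" .
qed

context flip_structure
begin

lemma mean_zero_component:
  assumes "mean_zero n v"
  shows "mean_zero n (comp U v)"
  unfolding mean_zero_def
proof
  fix x assume x: "x \<in> Sym n"
  have "(\<Sum>p\<in>carrier (alt_group n). comp U v (x \<circ> p))
      = (\<Sum>y\<in>Pow K. chi U y * (\<Sum>p\<in>carrier (alt_group n). v (x \<circ> p \<circ> t y))) / 2 ^ card K"
    unfolding component_def sum_divide_distrib[symmetric] sum_distrib_left
    by (rule arg_cong[where f = "\<lambda>r. r / _"], rule sum.swap)
  also have "\<dots> = 0" using mean_zero_shift[OF t assms] x by (simp add: mean_zero_def)
  finally show "(\<Sum>p\<in>carrier (alt_group n). comp U v (x \<circ> p)) = 0" .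
qed

definition nontrivial_part :: "((nat \<Rightarrow> nat) \<Rightarrow> real) \<Rightarrow> real"
  where "nontrivial_part v = (\<Sum>U\<in>Pow K - {{}, K}. nsq n (comp U v))"

lemma nsq_split: "nsq n v = nontrivial_part v + (\<Sum>U\<in>{{}, K}. nsq n (comp U v))"
  unfolding nontrivial_part_def nsq_components[of v]
  using finK by (intro sum.subset_diff) auto

text \<open>On an even \<open>y\<close> the characters \<open>{}\<close> and \<open>K\<close> are
  both one, so only nontrivial components enter the difference, each with a factor \<open>0\<close>
  or \<open>- 2\<close> that gets squared.\<close>

lemma almost_invariant:
  assumes y: "y \<subseteq> K" "even (card y)"
  shows "nsq n (\<lambda>x. v (x \<circ> t y) - v x) \<le> 4 * nontrivial_part v"
proof -
  let ?d = "\<lambda>x. v (x \<circ> t y) - v x"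
  have d: "comp U ?d x = (chi U y - 1) * comp U v x" for U x
  proof -
    have comm: "x \<circ> t z \<circ> t y = x \<circ> t y \<circ> t z" for z
    proof -
      have "sym_diff z y = sym_diff y z" by auto
      then show ?thesis by (simp only: comp_assoc flips_comp[OF c(1)])
    qed
    have "comp U ?d x = comp U v (x \<circ> t y) - comp U v x"
      by (simp only: component_def comm right_diff_distrib sum_subtractf diff_divide_distrib)
    then show ?thesis using component_shift[OF y(1)] by (simp add: algebra_simps)
  qed
  have triv: "chi U y = 1" if "U = {} \<or> U = K" for U
  proof -
    have "K \<inter> y = y" using y by auto
    then show ?thesis using that y by (auto simp: chi_def)
  qed
  have "nsq n (comp U ?d) = (chi U y - 1)\<^sup>2 * nsq n (comp U v)" for U
    by (simp add: nsq_def d power_mult_distrib sum_distrib_left)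
  moreover have "(chi U y - 1)\<^sup>2 \<le> 4" for U
  proof -
    have "chi U y = 1 \<or> chi U y = -1" unfolding chi_def by (metis neg_one_even_power neg_one_odd_power)
    then show ?thesis by auto
  qed
  ultimately have "nsq n (comp U ?d) \<le> 4 * nsq n (comp U v)" "U = {} \<or> U = K \<Longrightarrow> nsq n (comp U ?d) = 0" for U
    using triv[of U] by (auto intro!: mult_right_mono)
  then show ?thesis
    unfolding nsq_split[of ?d] nontrivial_part_def by (auto simp: sum_distrib_left intro!: sum_mono)
qed

end

locale flip_average = symmetric_subset n A + flip_structure n K c
  for n A and K :: "'k set" and c +
  fixes m :: nat
  assumes m: "0 < m" "2 * m \<le> card K"
begin

lemma avg_component: "avg (comp U v) x = comp U (avg v) x"
proof -
  have "avg (comp U v) x = (\<Sum>a\<in>A. \<Sum>y\<in>Pow K. chi U y * v (a \<circ> (x \<circ> t y))) / 2 ^ card K"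
    by (simp only: avg_def component_def comp_assoc sum_divide_distrib)
  also have "(\<Sum>a\<in>A. \<Sum>y\<in>Pow K. chi U y * v (a \<circ> (x \<circ> t y))) = (\<Sum>y\<in>Pow K. chi U y * (\<Sum>a\<in>A. v (a \<circ> (x \<circ> t y))))"
    unfolding sum_distrib_left by (rule sum.swap)
  finally show ?thesis by (simp only: avg_def component_def)
qed

text \<open>The nontrivial characters come in large orbits under the permutations of \<open>K\<close>, and a
  translate of a component is a component for another character of the orbit. As the averaging
  operator commutes with right translations, its norm on such a component is bounded by its
  Hilbert-Schmidt norm divided by the orbit length.\<close>

lemma nsq_avg_component:
  assumes U: "U \<subseteq> K" "U \<noteq> {}" "U \<noteq> K"
  shows "m * nsq n (avg (comp U v)) \<le> fact n * card A * nsq n (comp U v)"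
proof -
  obtain \<Gamma> where \<Gamma>: "\<Gamma> \<subseteq> {p. p permutes K}" "finite \<Gamma>" "m \<le> card \<Gamma>" "\<forall>\<gamma>\<in>\<Gamma>. \<gamma> \<circ> \<gamma> = id"
    "inj_on (\<lambda>\<gamma>. {k\<in>K. \<gamma> k \<in> U}) \<Gamma>"
    using many_swaps[OF finK U m(2)] by blast
  define w where "w \<gamma> x = comp U v (x \<circ> moves K c \<gamma>)" for \<gamma> x
  have bij: "bij_betw \<gamma> K K" if "\<gamma> \<in> \<Gamma>" for \<gamma> using \<Gamma> that permutes_imp_bij by blast
  have mv: "moves K c \<gamma> permutes {1..n}" if "\<gamma> \<in> \<Gamma>" for \<gamma>
    using c bij[OF that] by (rule moves_permutes)
  have w_shift: "w \<gamma> (x \<circ> t z) = chi {k\<in>K. \<gamma> k \<in> U} z * w \<gamma> x" if \<gamma>: "\<gamma> \<in> \<Gamma>" and z: "z \<subseteq> K" for \<gamma> x z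
  proof -
    have \<gamma>z: "\<gamma> ` z \<subseteq> K" using bij[OF \<gamma>] z by (auto simp: bij_betw_def)
    have "\<gamma> \<circ> \<gamma> = id" using \<Gamma>(4) \<gamma> by blast
    then have "\<gamma> (\<gamma> k) = k" for k by (metis comp_apply id_apply)
    then have "\<gamma> ` \<gamma> ` z = z" by (simp add: image_image)
    then have "t z \<circ> moves K c \<gamma> = moves K c \<gamma> \<circ> t (\<gamma> ` z)"
      using moves_flips[OF c(1) bij[OF \<gamma>] \<gamma>z] by simp
    then have "w \<gamma> (x \<circ> t z) = comp U v (x \<circ> moves K c \<gamma> \<circ> t (\<gamma> ` z))"
      by (simp only: w_def comp_assoc)
    also have "\<dots> = chi U (\<gamma> ` z) * w \<gamma> x" unfolding w_def by (rule component_shift[OF \<gamma>z])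
    also have "chi U (\<gamma> ` z) = chi (\<gamma> -` U) z"
      using bij[OF \<gamma>] z by (intro chi_image) (auto simp: bij_betw_def intro: inj_on_subset)
    also have "\<dots> = chi {k\<in>K. \<gamma> k \<in> U} z"
    proof -
      have "\<gamma> -` U \<inter> z = {k\<in>K. \<gamma> k \<in> U} \<inter> z" using z by auto
      then show ?thesis by (simp add: chi_def)
    qed
    finally show ?thesis .
  qed
  have nw: "nsq n (w \<gamma>) = nsq n (comp U v)" if "\<gamma> \<in> \<Gamma>" for \<gamma>
    unfolding w_def by (rule nsq_shift[OF mv[OF that]])
  have "(\<Sum>\<gamma>\<in>\<Gamma>. nsq n (avg (w \<gamma>))) \<le> fact n * card A * nsq n (comp U v)"
  proof (rule nsq_avg_le_family[OF \<Gamma>(2)])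
    fix \<gamma> \<delta> assume gd: "\<gamma> \<in> \<Gamma>" "\<delta> \<in> \<Gamma>" "\<gamma> \<noteq> \<delta>"
    then have "{k\<in>K. \<gamma> k \<in> U} \<noteq> {k\<in>K. \<delta> k \<in> U}" using \<Gamma>(5) by (meson inj_onD)
    then show "(\<Sum>x\<in>Sym n. w \<gamma> x * w \<delta> x) = 0"
      using w_shift gd by (intro orthogonal[of "{k\<in>K. \<gamma> k \<in> U}" "{k\<in>K. \<delta> k \<in> U}"]) auto
  qed (use nw in auto)
  moreover have "nsq n (avg (w \<gamma>)) = nsq n (avg (comp U v))" if "\<gamma> \<in> \<Gamma>" for \<gamma>
  proof -
    have "avg (w \<gamma>) = (\<lambda>x. avg (comp U v) (x \<circ> moves K c \<gamma>))"
      unfolding w_def by (rule ext) (rule avg_shift)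
    then show ?thesis using nsq_shift[OF mv[OF that]] by simp
  qed
  ultimately have "card \<Gamma> * nsq n (avg (comp U v)) \<le> fact n * card A * nsq n (comp U v)" by simp
  moreover have "m * nsq n (avg (comp U v)) \<le> card \<Gamma> * nsq n (avg (comp U v))"
    using \<Gamma>(3) by (intro mult_right_mono) auto
  ultimately show ?thesis by linarith
qed

text \<open>Nontrivial components obey the Hilbert-Schmidt bound, the two trivial ones only
  \<open>\<mu>\<close>. If \<open>\<mu>\<close> is the larger, a function nearly attaining it has
  little nontrivial part.\<close>

lemma nsq_avg_le:
  assumes "\<And>U. nsq n (avg (comp U v)) \<le> \<mu> * nsq n (comp U v)"
  shows "nsq n (avg v) \<le> \<mu> * nsq n v - (\<mu> - fact n * card A / m) * nontrivial_part v"
proof -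
  let ?\<Lambda> = "fact n * card A / m :: real"
  have eq: "nsq n (comp U (avg v)) = nsq n (avg (comp U v))" for U
    unfolding nsq_def by (simp add: avg_component)
  have "nsq n (avg v) = (\<Sum>U\<in>Pow K - {{}, K}. nsq n (avg (comp U v))) + (\<Sum>U\<in>{{}, K}. nsq n (avg (comp U v)))"
    unfolding nsq_split[of "avg v"] nontrivial_part_def eq ..
  also have "\<dots> \<le> (\<Sum>U\<in>Pow K - {{}, K}. ?\<Lambda> * nsq n (comp U v)) + (\<Sum>U\<in>{{}, K}. \<mu> * nsq n (comp U v))"
  proof (intro add_mono sum_mono)
    fix U assume "U \<in> Pow K - {{}, K}"
    then have "m * nsq n (avg (comp U v)) \<le> fact n * card A * nsq n (comp U v)"
      by (intro nsq_avg_component) auto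
    then show "nsq n (avg (comp U v)) \<le> ?\<Lambda> * nsq n (comp U v)" using m by (simp add: field_simps)
  qed (rule assms)
  also have "\<dots> = ?\<Lambda> * nontrivial_part v + \<mu> * (\<Sum>U\<in>{{}, K}. nsq n (comp U v))"
    unfolding nontrivial_part_def sum_distrib_left ..
  also have "\<dots> = \<mu> * nsq n v - (\<mu> - ?\<Lambda>) * nontrivial_part v"
    unfolding nsq_split[of v] by (simp only: algebra_simps)
  finally show ?thesis .
qed

end

section \<open>Displacement of functions by right translations\<close>

lemma L2_nsq: "L2_set v (Sym n) = sqrt (nsq n v)"
  by (simp add: L2_set_def nsq_def)

lemma L2_set_sum_le:
  assumes "finite P"
  shows "L2_set (\<lambda>x. \<Sum>p\<in>P. g p x) X \<le> (\<Sum>p\<in>P. L2_set (g p) X)"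
  using assms
proof (induction P)
  case empty
  show ?case by (simp add: L2_set_def)
next
  case (insert q P)
  have "L2_set (\<lambda>x. \<Sum>p\<in>insert q P. g p x) X = L2_set (\<lambda>x. g q x + (\<Sum>p\<in>P. g p x)) X"
    using insert by simp
  also have "\<dots> \<le> L2_set (g q) X + L2_set (\<lambda>x. \<Sum>p\<in>P. g p x) X"
    by (rule L2_set_triangle_ineq)
  finally show ?case using insert by simp
qed

definition displacement :: "nat \<Rightarrow> ((nat \<Rightarrow> nat) \<Rightarrow> real) \<Rightarrow> (nat \<Rightarrow> nat) \<Rightarrow> real"
  where "displacement n v p = L2_set (\<lambda>x. v (x \<circ> p) - v x) (Sym n)"

lemma L2_shift: "f permutes {1..n} \<Longrightarrow> L2_set (\<lambda>x. v (x \<circ> f)) (Sym n) = L2_set v (Sym n)"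
  unfolding L2_nsq by (simp only: nsq_shift)

lemma displacement_comp:
  assumes "p permutes {1..n}"
  shows "displacement n v (p \<circ> q) \<le> displacement n v q + displacement n v p"
proof -
  have "displacement n v (p \<circ> q) = L2_set (\<lambda>x. (v (x \<circ> p \<circ> q) - v (x \<circ> p)) + (v (x \<circ> p) - v x)) (Sym n)"
    by (simp add: displacement_def comp_assoc)
  also have "\<dots> \<le> L2_set (\<lambda>x. v (x \<circ> p \<circ> q) - v (x \<circ> p)) (Sym n) + displacement n v p"
    unfolding displacement_def by (rule L2_set_triangle_ineq)
  also have "L2_set (\<lambda>x. v (x \<circ> p \<circ> q) - v (x \<circ> p)) (Sym n) = displacement n v q"
    using L2_shift[OF assms, of "\<lambda>x. v (x \<circ> q) - v x"] by (simp add: displacement_def)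
  finally show ?thesis .
qed

lemma displacement_inv:
  assumes "p permutes {1..n}"
  shows "displacement n v (inv' p) = displacement n v p"
proof -
  have "displacement n v (inv' p) = L2_set (\<lambda>x. v (x \<circ> p \<circ> inv' p) - v (x \<circ> p)) (Sym n)"
    using L2_shift[OF assms, of "\<lambda>x. v (x \<circ> inv' p) - v x"] by (simp add: displacement_def)
  also have "\<dots> = L2_set (\<lambda>x. v x - v (x \<circ> p)) (Sym n)"
  proof -
    have "x \<circ> p \<circ> inv' p = x" for x :: "nat \<Rightarrow> nat" using permutes_inv_o(1)[OF assms] by (metis comp_assoc comp_id)
    then show ?thesis by (simp only:)
  qed
  finally show ?thesis by (simp add: displacement_def L2_set_def power2_commute)
qed

text \<open>Displacement is subadditive and invariant under inverses, three-cycles generate the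
  group, and two further points split a three-cycle into two genuine double transpositions.
  \<open>C\<close> is fixed before \<open>v\<close> and \<open>\<kappa>\<close>, so
  \<open>\<kappa>\<close> can later be taken small against it.\<close>

lemma displacement_bounded:
  assumes n: "5 \<le> n" and p: "p \<in> carrier (alt_group n)"
  shows "\<exists>C\<ge>0. \<forall>v \<kappa>. 0 \<le> \<kappa> \<longrightarrow>
    (\<forall>a b c d. distinct [a, b, c, d] \<longrightarrow> {a, b, c, d} \<subseteq> {1..n} \<longrightarrow> displacement n v (double_transposition a b c d) \<le> \<kappa>) \<longrightarrow>
    displacement n v p \<le> C * \<kappa>"
proof -
  let ?H = "\<lambda>v \<kappa>. 0 \<le> \<kappa> \<and> (\<forall>a b c d. distinct [a, b, c, d] \<longrightarrow> {a, b, c, d} \<subseteq> {1..n} \<longrightarrow>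
      displacement n v (double_transposition a b c d) \<le> \<kappa>)"
  let ?P = "\<lambda>p. \<exists>C\<ge>0. \<forall>v \<kappa>. ?H v \<kappa> \<longrightarrow> displacement n v p \<le> C * \<kappa>"
  have comp: "?P (p \<circ> q)" if p: "p permutes {1..n}" and P: "?P p" "?P q" for p q
  proof -
    obtain C where C: "0 \<le> C" "\<And>v \<kappa>. ?H v \<kappa> \<Longrightarrow> displacement n v p \<le> C * \<kappa>" using P(1) by blast
    obtain D where D: "0 \<le> D" "\<And>v \<kappa>. ?H v \<kappa> \<Longrightarrow> displacement n v q \<le> D * \<kappa>" using P(2) by blast
    have "displacement n v (p \<circ> q) \<le> (C + D) * \<kappa>" if H: "?H v \<kappa>" for v \<kappa>
      using displacement_comp[OF p, of v q] C(2)[OF H] D(2)[OF H] by (simp add: distrib_right)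
    then show ?thesis using C(1) D(1) by (intro exI[of _ "C + D"]) simp
  qed
  have dt: "?P (double_transposition a b c d)" if "distinct [a, b, c, d]" "{a, b, c, d} \<subseteq> {1..n}" for a b c d
    using that by (intro exI[of _ 1]) simp
  have dt_perm: "double_transposition a b c d permutes {1..n}" if "{a, b, c, d} \<subseteq> {1..n}" for a b c d
    unfolding double_transposition_def using that by (intro permutes_compose permutes_swap_id) auto
  have three: "h permutes {1..n} \<and> ?P h" if h: "h \<in> three_cycles n" for h
  proof -
    obtain cs where cs: "h = cycle_of_list cs" "cycle cs" "length cs = 3" "set cs \<subseteq> {1..n}" using h by auto
    obtain a b c where abc: "cs = [a, b, c]" using cs(3) by (auto simp: length_Suc_conv numeral_3_eq_3)
    have "card {a, b, c} \<le> 3" by (simp add: card_insert_le_m1)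
    then have "2 \<le> card ({1..n} - {a, b, c})"
      using n diff_card_le_card_Diff[of "{a, b, c}" "{1..n}"] by simp
    then obtain V where "V \<subseteq> {1..n} - {a, b, c}" "card V = 2" using obtain_subset_with_card_n by metis
    then obtain x y where xy: "{x, y} \<subseteq> {1..n} - {a, b, c}" "x \<noteq> y" by (auto simp: card_2_iff)
    have "h = transpose a b \<circ> transpose b c" by (simp add: cs(1) abc)
    also have "\<dots> = double_transposition a b b c" by (simp only: double_transposition_def)
    also have "\<dots> = double_transposition a b x y \<circ> double_transposition x y b c"
      by (rule double_transposition_chain[symmetric])
    finally have h2: "h = double_transposition a b x y \<circ> double_transposition x y b c" .
    have "{a, b, x, y} \<subseteq> {1..n}" "{x, y, b, c} \<subseteq> {1..n}" using cs abc xy by auto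
    note perm = this[THEN dt_perm]
    show ?thesis unfolding h2
    proof
      show "?P (double_transposition a b x y \<circ> double_transposition x y b c)"
        by (rule comp[OF perm(1) dt dt]) (use cs abc xy in auto)
    qed (rule permutes_compose[OF perm(2,1)])
  qed
  have "p permutes {1..n} \<and> ?P p" if "p \<in> generate (alt_group n) (three_cycles n)" for p
    using that
  proof (induction rule: generate.induct)
    case one
    have "displacement n v id \<le> 0 * \<kappa>" for v \<kappa> by (simp add: displacement_def L2_set_def)
    then have "?P id" by blast
    then show ?case unfolding alt_group_one using permutes_id by blast
  next
    case (incl h)
    then show ?case by (rule three)
  next
    case (inv h)
    have "h permutes {1..n}" "?P h" using three[OF inv] by auto
    moreover have "inv\<^bsub>alt_group n\<^esub> h = inv' h"
      using inv three_cycles_incl by (intro alt_group_inv_equality) auto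
    ultimately show ?case using permutes_inv by (simp only: displacement_inv) blast
  next
    case (eng h1 h2)
    from eng.IH(1) have 1: "h1 permutes {1..n}" "?P h1" by (rule conjunct1, rule conjunct2)
    from eng.IH(2) have 2: "h2 permutes {1..n}" "?P h2" by (rule conjunct1, rule conjunct2)
    show ?case unfolding alt_group_mult
      by (rule conjI[OF permutes_compose[OF 2(1) 1(1)] comp[OF 1 2(2)]])
  qed
  then have "?P p" using p alt_group_carrier_as_three_cycles[of n] by blast
  then obtain C where C: "0 \<le> C" "\<forall>v \<kappa>. ?H v \<kappa> \<longrightarrow> displacement n v p \<le> C * \<kappa>" by (elim exE conjE)
  show ?thesis
  proof (intro exI[of _ C] conjI allI impI)
    fix v \<kappa> assume "0 \<le> \<kappa>" "\<forall>a b c d. distinct [a, b, c, d] \<longrightarrow> {a, b, c, d} \<subseteq> {1..n} \<longrightarrow>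
      displacement n v (double_transposition a b c d) \<le> \<kappa>"
    then show "displacement n v p \<le> C * \<kappa>" by (intro C(2)[THEN spec, THEN spec, THEN mp] conjI)
  qed (rule C(1))
qed

text \<open>For mean zero, averaging \<open>v x - v (x \<circ> p)\<close> over \<open>p\<close>
  returns \<open>v x\<close>; the triangle inequality does the rest.\<close>

lemma norm_le_displacements:
  assumes v: "mean_zero n v"
  shows "card (carrier (alt_group n)) * L2_set v (Sym n) \<le> (\<Sum>p\<in>carrier (alt_group n). displacement n v p)"
proof -
  let ?G = "carrier (alt_group n)"
  have "card ?G * L2_set v (Sym n) = L2_set (\<lambda>x. card ?G * v x) (Sym n)"
    by (rule L2_set_right_distrib) simp
  also have "\<dots> = L2_set (\<lambda>x. \<Sum>p\<in>?G. v x - v (x \<circ> p)) (Sym n)"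
  proof (rule L2_set_cong[OF refl])
    fix x assume "x \<in> Sym n"
    then have "(\<Sum>p\<in>?G. v (x \<circ> p)) = 0" using v by (simp add: mean_zero_def)
    then show "card ?G * v x = (\<Sum>p\<in>?G. v x - v (x \<circ> p))" by (simp add: sum_subtractf)
  qed
  also have "\<dots> \<le> (\<Sum>p\<in>?G. L2_set (\<lambda>x. v x - v (x \<circ> p)) (Sym n))" by (rule L2_set_sum_le) simp
  finally show ?thesis by (simp add: displacement_def L2_set_def power2_commute)
qed

context symmetric_subset
begin

text \<open>Any double transposition is an even flip among \<open>2 * (n div 4)\<close> disjoint
  pairs. Half this number is the bound for the orbit length.\<close>

lemma flip_average_for:
  assumes n: "4 \<le> n" and d: "distinct [p, q, r, s]" "{p, q, r, s} \<subseteq> {1..n}"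
  shows "\<exists>c. flip_average n A ({..<n div 4} \<times> (UNIV :: bool set)) c (n div 4) \<and>
     flips ({..<n div 4} \<times> UNIV) c ({0} \<times> UNIV) = double_transposition p q r s"
proof -
  let ?I = "{..<n div 4}"
  define f :: "(nat \<times> bool) \<times> bool \<Rightarrow> nat"
    where "f = (\<lambda>((i, k), s'). if k then if s' then s else r else if s' then q else p)"
  let ?X = "({0} \<times> UNIV) \<times> UNIV :: ((nat \<times> bool) \<times> bool) set"
  have n0: "0 < n div 4" using n by simp
  have "inj_on f ?X"
  proof (rule inj_onI)
    fix x y assume "x \<in> ?X" "y \<in> ?X" "f x = f y"
    then show "x = y" using d(1) by (cases x; cases y) (auto simp: f_def split: if_splits)
  qed
  moreover have "f ` ?X \<subseteq> {1..n}"
  proof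
    fix y assume "y \<in> f ` ?X"
    then have "y \<in> {p, q, r, s}" by (auto simp: f_def split: if_splits)
    then show "y \<in> {1..n}" using d(2) by blast
  qed
  moreover have "?X \<subseteq> (?I \<times> UNIV) \<times> UNIV" using n0 by auto
  moreover have "finite ((?I \<times> (UNIV :: bool set)) \<times> (UNIV :: bool set))" by simp
  moreover have "card ((?I \<times> (UNIV :: bool set)) \<times> (UNIV :: bool set)) \<le> card {1..n}"
    by (simp add: card_cartesian_product)
  ultimately obtain c where c: "inj_on c ((?I \<times> UNIV) \<times> UNIV)" "c ` ((?I \<times> UNIV) \<times> UNIV) \<subseteq> {1..n}"
    "\<forall>x\<in>?X. c x = f x"
    using extend_injection[of "(?I \<times> (UNIV :: bool set)) \<times> (UNIV :: bool set)" ?X f "{1..n}"] by (meson finite_atLeastAtMost)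
  have "flips (?I \<times> UNIV) c ({0} \<times> UNIV) = double_transposition p q r s"
    using flips_single[OF c(1), of 0] n0 c(3) by (simp add: f_def)
  moreover have "flip_average n A (?I \<times> (UNIV :: bool set)) c (n div 4)"
  proof unfold_locales
    show "finite (?I \<times> (UNIV :: bool set))" by simp
    show "?I \<times> (UNIV :: bool set) \<noteq> {}" using n0 by auto
    show "2 * (n div 4) \<le> card (?I \<times> (UNIV :: bool set))" by (simp add: card_cartesian_product)
  qed (use c n0 in auto)
  ultimately show ?thesis by blast
qed

lemma nsq_avg_trivial: "nsq n (avg v) \<le> fact n * card A * nsq n v"
  using nsq_avg_le_family[of "{()}" "nsq n v" "\<lambda>_. v"] by simp

end

context symmetric_subset
begin

text \<open>If the supremum \<open>\<mu>\<close> of the Rayleigh quotients exceeded the bound for nontrivial components,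
  a near-maximizer would have almost no nontrivial component for any flip structure. It would then
  be almost invariant under all double transpositions, hence under the alternating group, which
  is impossible for a function of mean zero.\<close>

lemma nsq_avg_mean_zero:
  assumes n: "8 \<le> n" and v: "mean_zero n v"
  shows "nsq n (avg v) \<le> fact n * card A / (n div 4) * nsq n v"
proof -
  define \<Lambda> :: real where "\<Lambda> = fact n * card A / (n div 4)"
  let ?G = "carrier (alt_group n)"
  define R where "R = {nsq n (avg v) | v. mean_zero n v \<and> nsq n v \<le> 1}"
  define \<mu> where "\<mu> = Sup R"
  have \<Lambda>: "0 \<le> \<Lambda>" by (simp add: \<Lambda>_def)
  have bdd: "bdd_above R"
  proof (rule bdd_aboveI)
    fix y assume "y \<in> R"
    then obtain v where v: "y = nsq n (avg v)" "nsq n v \<le> 1" by (auto simp: R_def)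
    have "fact n * card A * nsq n v \<le> fact n * card A * (1 :: real)" using v by (intro mult_left_mono) auto
    then show "y \<le> fact n * card A" using nsq_avg_trivial[of v] v by linarith
  qed
  have zero: "mean_zero n (\<lambda>_. 0)" "nsq n (\<lambda>_. 0) = 0" by (simp_all add: mean_zero_def nsq_def)
  then have nonempty: "nsq n (avg (\<lambda>_. 0)) \<in> R" by (auto simp: R_def intro!: exI[of _ "\<lambda>_. 0"])
  have \<mu>0: "0 \<le> \<mu>" unfolding \<mu>_def using cSup_upper[OF nonempty bdd] by (rule order_trans[OF nsq_nonneg])
  have scale: "nsq n (avg v) \<le> \<mu> * nsq n v" if v: "mean_zero n v" for v
  proof (cases "nsq n v = 0")
    case True
    then show ?thesis using nsq_avg_trivial[of v] by simp
  next
    case False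
    define s where "s = sqrt (nsq n v)"
    have s: "s\<^sup>2 = nsq n v" "0 < nsq n v" using False nsq_nonneg[of n v] by (simp_all add: s_def less_le)
    let ?v = "\<lambda>x. v x / s"
    have "nsq n ?v = 1" using s by (simp add: nsq_def power_divide flip: sum_divide_distrib)
    moreover have "mean_zero n ?v" using v by (simp add: mean_zero_def flip: sum_divide_distrib)
    ultimately have "nsq n (avg ?v) \<le> \<mu>" unfolding \<mu>_def by (intro cSup_upper[OF _ bdd]) (auto simp: R_def)
    moreover have "nsq n (avg ?v) = nsq n (avg v) / nsq n v"
    proof -
      have "avg ?v x = avg v x / s" for x by (simp add: avg_def sum_divide_distrib)
      then show ?thesis using s by (simp add: nsq_def power_divide flip: sum_divide_distrib)
    qed
    ultimately show ?thesis using s by (simp add: field_simps)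
  qed
  have "\<mu> \<le> \<Lambda>"
  proof (rule ccontr)
    assume "\<not> \<mu> \<le> \<Lambda>"
    then have gap: "0 < \<mu> - \<Lambda>" "0 < \<mu>" using \<Lambda> by auto
    have "\<forall>p\<in>?G. \<exists>C\<ge>0. \<forall>v \<kappa>. 0 \<le> \<kappa> \<longrightarrow>
      (\<forall>a b c d. distinct [a, b, c, d] \<longrightarrow> {a, b, c, d} \<subseteq> {1..n} \<longrightarrow> displacement n v (double_transposition a b c d) \<le> \<kappa>) \<longrightarrow>
      displacement n v p \<le> C * \<kappa>"
      using n by (intro ballI displacement_bounded) auto
    from bchoice[OF this] obtain C where C: "\<forall>p\<in>?G. 0 \<le> C p \<and> (\<forall>v \<kappa>. 0 \<le> \<kappa> \<longrightarrow>
      (\<forall>a b c d. distinct [a, b, c, d] \<longrightarrow> {a, b, c, d} \<subseteq> {1..n} \<longrightarrow> displacement n v (double_transposition a b c d) \<le> \<kappa>) \<longrightarrow>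
      displacement n v p \<le> C p * \<kappa>)" by blast
    define D where "D = (\<Sum>p\<in>?G. C p)"
    have D0: "0 \<le> D" unfolding D_def using C by (intro sum_nonneg) auto
    \<comment> \<open>Small enough for the displacements to add up to less than one half, which
      forces \<open>nsq n v < 1 / 4\<close>.\<close>
    define \<kappa> where "\<kappa> = 1 / (2 * (D + 1))"
    have \<kappa>: "0 < \<kappa>" "D * \<kappa> < 1 / 2" using D0 by (auto simp: \<kappa>_def field_simps)
    \<comment> \<open>The first bound clashes with \<open>nsq n v < 1 / 4\<close> through
      \<open>scale\<close>. The second makes the nontrivial part at most
      \<open>\<kappa>\<^sup>2 / 4\<close>, which cancels the factor \<open>4\<close> of
      \<open>almost_invariant\<close>.\<close>
    define \<eta> where "\<eta> = min (\<mu> / 2) ((\<mu> - \<Lambda>) * (\<kappa>\<^sup>2 / 4))"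
    have \<eta>: "0 < \<eta>" "\<eta> \<le> \<mu> / 2" "\<eta> \<le> (\<mu> - \<Lambda>) * (\<kappa>\<^sup>2 / 4)"
      using gap \<kappa> by (auto simp: \<eta>_def)
    have "\<exists>y\<in>R. \<mu> - \<eta> < y" using less_cSupD[of R "\<mu> - \<eta>"] nonempty \<eta> unfolding \<mu>_def by auto
    then obtain v where v: "mean_zero n v" "nsq n v \<le> 1" "\<mu> - \<eta> < nsq n (avg v)" by (auto simp: R_def)
    have small: "displacement n v (double_transposition p q r s) \<le> \<kappa>"
      if pq: "distinct [p, q, r, s]" "{p, q, r, s} \<subseteq> {1..n}" for p q r s
    proof -
      let ?I = "{..<n div 4}" and ?K = "{..<n div 4} \<times> (UNIV :: bool set)"
      obtain c where c: "flip_average n A ?K c (n div 4)"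
        and dt: "flips ?K c ({0} \<times> UNIV) = double_transposition p q r s"
        using flip_average_for[OF _ pq] n by auto
      interpret flip_average n A ?K c "n div 4" by (rule c)
      have "nsq n (avg v) \<le> \<mu> * nsq n v - (\<mu> - \<Lambda>) * nontrivial_part v"
        unfolding \<Lambda>_def using scale mean_zero_component[OF v(1)] by (intro nsq_avg_le) auto
      moreover have "\<mu> * nsq n v \<le> \<mu> * 1" using v gap by (intro mult_left_mono) auto
      ultimately have "(\<mu> - \<Lambda>) * nontrivial_part v \<le> (\<mu> - \<Lambda>) * (\<kappa>\<^sup>2 / 4)" using v(3) \<eta>(3) by linarith
      then have nt: "nontrivial_part v \<le> \<kappa>\<^sup>2 / 4" using gap by simp
      have "{0} \<times> UNIV \<subseteq> ?K" using n by auto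
      moreover have "even (card ({0 :: nat} \<times> (UNIV :: bool set)))" by (simp add: card_cartesian_product)
      ultimately have "nsq n (\<lambda>x. v (x \<circ> flips ?K c ({0} \<times> UNIV)) - v x) \<le> 4 * nontrivial_part v"
        by (rule almost_invariant)
      then have "nsq n (\<lambda>x. v (x \<circ> double_transposition p q r s) - v x) \<le> \<kappa>\<^sup>2" using nt unfolding dt by linarith
      then show ?thesis unfolding displacement_def L2_nsq using \<kappa> by (intro real_le_lsqrt) auto
    qed
    have "card ?G * L2_set v (Sym n) \<le> (\<Sum>p\<in>?G. displacement n v p)" by (rule norm_le_displacements[OF v(1)])
    also have "\<dots> \<le> (\<Sum>p\<in>?G. C p * \<kappa>)"
    proof (rule sum_mono)
      fix p assume "p \<in> ?G"
      then show "displacement n v p \<le> C p * \<kappa>" using C small \<kappa> by (meson less_imp_le)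
    qed
    also have "\<dots> = D * \<kappa>" by (simp add: D_def sum_distrib_right)
    finally have "card ?G * L2_set v (Sym n) < 1 / 2" using \<kappa> by linarith
    moreover have "1 \<le> real (card ?G)"
    proof -
      have "?G \<noteq> {}" using alt_group_carrier permutes_id evenperm_id by (metis empty_iff)
      then show ?thesis by (simp add: Suc_le_eq card_gt_0_iff)
    qed
    then have "1 * L2_set v (Sym n) \<le> card ?G * L2_set v (Sym n)" by (intro mult_right_mono) auto
    ultimately have "sqrt (nsq n v) < 1 / 2" unfolding L2_nsq by linarith
    then have "nsq n v < 1 / 4" using real_less_rsqrt[of "1/2" "nsq n v"] 
      by (smt (verit) nsq_nonneg power_divide power_one real_sqrt_less_iff real_sqrt_four real_sqrt_divide real_sqrt_one)
    then have "\<mu> * nsq n v \<le> \<mu> * (1 / 4)" using gap by (intro mult_left_mono) auto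
    then show False using scale[OF v(1)] v(3) \<eta>(2) gap by linarith
  qed
  then have "\<mu> * nsq n v \<le> \<Lambda> * nsq n v" by (intro mult_right_mono) auto
  then show ?thesis using scale[OF v] unfolding \<Lambda>_def by linarith
qed

text \<open>If \<open>g\<close> is not a product of three elements, \<open>a \<circ> x\<close>
  avoids the translate of \<open>A\<close> by \<open>g\<close> for all \<open>a\<close>,
  \<open>x\<close> in \<open>A\<close>. So \<open>avg\<close> maps the balanced indicator of this
  translate to a constant on \<open>A\<close> that is too negative for the spectral bound.\<close>

theorem triple_product_covers:
  assumes n: "8 \<le> n" and even: "A \<subseteq> carrier (alt_group n)"
    and dense: "2 * real (card (carrier (alt_group n))) ^ 3 < real (card A) ^ 3 * (n div 4)"
  shows "carrier (alt_group n) \<subseteq> pw 3"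
proof
  fix g assume g: "g \<in> carrier (alt_group n)"
  let ?G = "carrier (alt_group n)"
  define e where "e = real (card ?G)"
  define \<alpha> where "\<alpha> = real (card A)"
  have "A \<noteq> {}" by (rule nonempty)
  then have \<alpha>: "0 < \<alpha>" "\<alpha> \<le> e" using finite_A card_mono[OF _ even] by (auto simp: \<alpha>_def e_def card_gt_0_iff)
  have "2 * card ?G = fact n" using n by (intro alt_group_card_carrier) simp
  then have "real (2 * card ?G) = fact n" by (metis of_nat_fact)
  then have e2: "fact n = 2 * e" by (simp add: e_def)
  show "g \<in> pw 3"
  proof (rule ccontr)
    assume g3: "g \<notin> pw 3"
    define B where "B = (\<lambda>a. g \<circ> a) ` A"
    have gp: "g permutes {1..n}" "evenperm g" using g by (auto simp: alt_group_carrier)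
    have inv_g: "inv' g \<circ> g = id" using permutes_inv_o[OF gp(1)] by auto
    have "inj_on (\<lambda>a. g \<circ> a) A" by (rule inj_on_inverseI[where g = "\<lambda>b. inv' g \<circ> b"]) (metis comp_assoc id_comp inv_g)
    then have cardB: "card B = card A" by (simp add: B_def card_image)
    have comp_mem: "p \<circ> q \<in> ?G" if "p \<in> ?G" "q \<in> ?G" for p q
      using group.is_monoid[OF alt_group_is_group] monoid.m_closed that alt_group_mult by metis
    have BG: "B \<subseteq> ?G" using even g comp_mem by (auto simp: B_def)
    have miss: "a \<circ> x \<notin> B" if "a \<in> A" "x \<in> A" for a x
    proof
      assume "a \<circ> x \<in> B"
      then obtain b where b: "b \<in> A" "a \<circ> x = g \<circ> b" by (auto simp: B_def)
      have "g = a \<circ> x \<circ> inv' b" using b permutes_inv_o(1)[OF permutes[OF b(1)]] by (metis comp_assoc comp_id)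
      moreover have "a \<circ> x \<circ> inv' b \<in> pw (1 + 1 + 1)"
        by (intro set_power_comp set_power_1 that inv_mem b)
      moreover have "1 + 1 + 1 = (3 :: nat)" by simp
      ultimately show False using g3 by metis
    qed
    \<comment> \<open>Balanced on the even permutations and zero on the odd ones, so the sums over
      both cosets vanish.\<close>
    define v where "v x = (if x \<in> ?G then of_bool (x \<in> B) - \<alpha> / e else 0)" for x
    have sum_v: "(\<Sum>p\<in>?G. v p) = 0"
    proof -
      have "(\<Sum>p\<in>?G. v p) = (\<Sum>p\<in>?G. of_bool (p \<in> B)) - e * (\<alpha> / e)" by (simp add: v_def sum_subtractf e_def)
      also have "(\<Sum>p\<in>?G. of_bool (p \<in> B)) = real (card (?G \<inter> B))" by (simp add: of_bool_def sum.If_cases)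
      also have "?G \<inter> B = B" using BG by auto
      finally show ?thesis using cardB \<alpha> by (simp add: \<alpha>_def)
    qed
    have mz: "mean_zero n v"
      unfolding mean_zero_def
    proof
      fix x assume x: "x \<in> Sym n"
      show "(\<Sum>p\<in>?G. v (x \<circ> p)) = 0"
      proof (cases "evenperm x")
        case True
        have "permutation x" using x permutation_permutes by auto
        then have "evenperm (inv' x)" using True by (simp add: evenperm_inv)
        then have xG: "x \<in> ?G" "inv' x \<in> ?G" using x True permutes_inv by (auto simp: alt_group_carrier)
        have "(\<Sum>p\<in>?G. v (x \<circ> p)) = (\<Sum>p\<in>?G. v p)"
        proof (rule sum.reindex_bij_witness[of _ "\<lambda>p. inv' x \<circ> p" "\<lambda>p. x \<circ> p"])
          fix p assume p: "p \<in> ?G"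
          have "x \<circ> inv' x = id" "inv' x \<circ> x = id" using x permutes_inv_o by auto
          then show "inv' x \<circ> (x \<circ> p) = p" "x \<circ> (inv' x \<circ> p) = p" by (metis comp_assoc id_comp)+
          show "x \<circ> p \<in> ?G" "inv' x \<circ> p \<in> ?G" using comp_mem xG p by auto
        qed simp
        then show ?thesis using sum_v by simp
      next
        case False
        have "v (x \<circ> p) = 0" if "p \<in> ?G" for p
        proof -
          have "permutation x" "permutation p" using x that permutation_permutes by (auto simp: alt_group_carrier)
          then have "\<not> evenperm (x \<circ> p)" using False that by (simp add: evenperm_comp alt_group_carrier)
          then have "x \<circ> p \<notin> ?G" by (metis alt_group_carrier)
          then show ?thesis by (simp add: v_def)
        qed
        then show ?thesis by simp
      qed
    qed
    have nv: "nsq n v \<le> \<alpha>"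
    proof -
      have "nsq n v = (\<Sum>x\<in>?G. (of_bool (x \<in> B) - \<alpha> / e)\<^sup>2)"
        unfolding nsq_def
        by (rule sum.mono_neutral_cong_right) (auto simp: v_def alt_group_carrier)
      also have "\<dots> = (\<Sum>x\<in>?G. of_bool (x \<in> B) * (1 - \<alpha> / e) - \<alpha> / e * v x)"
        by (intro sum.cong refl) (auto simp: v_def power2_eq_square algebra_simps)
      also have "\<dots> = (\<Sum>x\<in>?G. of_bool (x \<in> B)) * (1 - \<alpha> / e) - \<alpha> / e * (\<Sum>x\<in>?G. v x)"
        by (simp add: sum_subtractf sum_distrib_left sum_distrib_right)
      also have "(\<Sum>p\<in>?G. of_bool (p \<in> B)) = real (card (?G \<inter> B))" by (simp add: of_bool_def sum.If_cases)
      also have "?G \<inter> B = B" using BG by auto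
      finally have "nsq n v = \<alpha> * (1 - \<alpha> / e)" using sum_v cardB by (simp add: \<alpha>_def)
      also have "\<dots> \<le> \<alpha> * 1" using \<alpha> by (intro mult_left_mono) auto
      finally show ?thesis by simp
    qed
    have avg_val: "avg v x = - (\<alpha> * (\<alpha> / e))" if x: "x \<in> A" for x
    proof -
      have "v (a \<circ> x) = - (\<alpha> / e)" if "a \<in> A" for a
        using miss[OF that x] comp_mem[of a x] that x even by (auto simp: v_def)
      then show ?thesis by (simp add: avg_def \<alpha>_def)
    qed
    have "\<alpha> * (\<alpha> * (\<alpha> / e))\<^sup>2 = (\<Sum>x\<in>A. (avg v x)\<^sup>2)" by (simp add: avg_val \<alpha>_def)
    also have "\<dots> \<le> nsq n (avg v)" unfolding nsq_def using permutes by (intro sum_mono2) auto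
    also have "\<dots> \<le> fact n * card A / (n div 4) * nsq n v" by (rule nsq_avg_mean_zero[OF n mz])
    also have "\<dots> \<le> fact n * card A / (n div 4) * \<alpha>" using nv by (intro mult_left_mono) auto
    also have "\<dots> = 2 * e * \<alpha> / (n div 4) * \<alpha>" by (simp add: e2 \<alpha>_def)
    finally have "\<alpha> * (\<alpha> * (\<alpha> / e))\<^sup>2 \<le> 2 * e * \<alpha> / (n div 4) * \<alpha>" .
    moreover have "0 < e" "0 < real (n div 4)" using \<alpha> n by auto
    ultimately have "\<alpha>\<^sup>2 * (\<alpha> ^ 3 * real (n div 4)) \<le> \<alpha>\<^sup>2 * (2 * e ^ 3)"
      by (simp add: field_simps power2_eq_square power3_eq_cube)
    moreover have "0 < \<alpha>\<^sup>2" using \<alpha> by simp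
    ultimately have "\<alpha> ^ 3 * real (n div 4) \<le> 2 * e ^ 3" by (rule mult_left_le_imp_le)
    then show False using dense unfolding \<alpha>_def e_def by linarith
  qed
qed

end

section \<open>The covering number\<close>

text \<open>\<open>A\<close> and its translate by \<open>g\<close> both fill more than half of the
  group, so they meet. For small \<open>n\<close> the density hypothesis of the final theorem leaves
  only this case.\<close>

lemma (in symmetric_subset) large_set_square:
  assumes "A \<subseteq> carrier (alt_group n)" "card (carrier (alt_group n)) < 2 * card A"
  shows "carrier (alt_group n) \<subseteq> pw 2"
proof
  let ?G = "carrier (alt_group n)"
  fix g assume g: "g \<in> ?G"
  then have inv_g: "inv' g \<circ> g = id" using permutes_inv_o by (auto simp: alt_group_carrier)
  have "inj_on (\<lambda>a. g \<circ> a) A" by (rule inj_on_inverseI[where g = "\<lambda>b. inv' g \<circ> b"]) (metis comp_assoc id_comp inv_g)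
  then have card_image: "card ((\<lambda>a. g \<circ> a) ` A) = card A" by (rule card_image)
  have sub: "(\<lambda>a. g \<circ> a) ` A \<subseteq> ?G"
    using monoid.m_closed[OF group.is_monoid[OF alt_group_is_group[of n]] g] assms(1)
    by (auto simp: alt_group_mult)
  have "(\<lambda>a. g \<circ> a) ` A \<inter> A \<noteq> {}"
  proof
    assume "(\<lambda>a. g \<circ> a) ` A \<inter> A = {}"
    then have "card ((\<lambda>a. g \<circ> a) ` A \<union> A) = 2 * card A"
      using finite_A card_image by (simp add: card_Un_disjoint)
    moreover have "card ((\<lambda>a. g \<circ> a) ` A \<union> A) \<le> card ?G" using sub assms(1) by (intro card_mono) auto
    ultimately show False using assms(2) by simp
  qed
  then obtain a where a: "a \<in> A" "g \<circ> a \<in> A" by blast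
  have "g = (g \<circ> a) \<circ> inv' a" using permutes_inv_o(1)[OF permutes[OF a(1)]] by (metis comp_assoc comp_id)
  moreover have "(g \<circ> a) \<circ> inv' a \<in> pw (1 + 1)" by (intro set_power_comp set_power_1 a inv_mem)
  moreover have "1 + 1 = (2 :: nat)" by simp
  ultimately show "g \<in> pw 2" by metis
qed

lemma (in symmetric_subset) pw_subset:
  assumes "A \<subseteq> carrier (alt_group n)"
  shows "pw m \<subseteq> carrier (alt_group n)"
proof (induction m)
  case 0
  show ?case using permutes_id evenperm_id by (auto simp: set_power_0 alt_group_one alt_group_carrier)
next
  case (Suc m)
  have "a \<circ> y \<in> carrier (alt_group n)" if "a \<in> A" "y \<in> pw m" for a y
    using monoid.m_closed[OF group.is_monoid[OF alt_group_is_group[of n]], of a y] that assms Suc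
    by (auto simp: alt_group_mult)
  then show ?case by (auto simp: set_power_alt_Suc)
qed

lemma (in symmetric_subset) covering_number_le:
  assumes "A \<subseteq> carrier (alt_group n)" "0 < m" "carrier (alt_group n) \<subseteq> pw m"
  shows "is_covering_exponent (alt_group n) A m" "covering_number (alt_group n) A \<le> m"
proof -
  show "is_covering_exponent (alt_group n) A m"
    using assms pw_subset[OF assms(1), of m] by (auto simp: is_covering_exponent_def)
  then show "covering_number (alt_group n) A \<le> m" unfolding covering_number_def by (rule Least_le)
qed

lemma (in generating_symmetric_subset) covering_number_bound:
  "\<exists>m. 0 < m \<and> m \<le> 1000 * (a div j + 1)\<^sup>2 \<and> carrier (alt_group n) \<subseteq> pw m"
proof (intro exI conjI)
  let ?m = "4 * M + 2 * (\<beta> * M3) + 2 * M3" and ?r = "a div j"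
  show "0 < ?m" by (simp add: M)
  have "?m = 16 * ?r + 32 + (4 * ?r + 4) * (192 * ?r + 240)"
    unfolding M3_def by (simp add: M \<beta> algebra_simps)
  also have "\<dots> \<le> 40 * (?r + 1) * (?r + 1) + (4 * (?r + 1)) * (240 * (?r + 1))"
    by (intro add_mono mult_mono) (simp_all add: algebra_simps)
  also have "\<dots> = 1000 * (?r + 1)\<^sup>2" by (simp add: power2_eq_square algebra_simps)
  finally show "?m \<le> 1000 * (?r + 1)\<^sup>2" .
qed (simp add: power_covers)

text \<open>\<open>256 ^ j\<close> is a quarter of \<open>N\<^sup>2\<close>, which has to fit into
  \<open>n\<close> together with \<open>t\<close>. As \<open>256\<close> is below
  \<open>exp 8\<close>, \<open>j\<close> can be \<open>L / 8\<close> rounded up, and the rounding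
  costs one factor \<open>256\<close>.\<close>

lemma exponent_choice:
  fixes L x :: real
  assumes "1 < L"
  shows "\<exists>j::nat. 0 < j \<and> L / 8 \<le> j \<and> 256 ^ j \<le> 256 * exp L"
proof -
  define j where "j = nat \<lceil>L / 8\<rceil>"
  have j: "L / 8 \<le> j" "j < L / 8 + 1" using assms unfolding j_def by linarith+
  have "ln (256::real) = 8 * ln 2" using ln_realpow[of "2::real" 8] by simp
  moreover have "ln (2::real) \<le> 1" using ln_2_less_1 by simp
  ultimately have l: "ln (256::real) \<le> 8" "0 \<le> ln (256::real)" by auto
  have "(256::real) ^ j = exp (j * ln 256)" by (simp add: exp_of_nat_mult)
  also have "\<dots> \<le> exp ((L / 8 + 1) * ln 256)" using j l by (simp add: mult_right_mono)
  also have "\<dots> = 256 * exp (L / 8 * ln 256)" by (simp add: distrib_right exp_add)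
  also have "L / 8 * ln 256 \<le> L / 8 * 8" using l assms by (intro mult_left_mono) auto
  then have "256 * exp (L / 8 * ln 256) \<le> 256 * exp L" by simp
  finally have "256 ^ j \<le> 256 * exp L" .
  moreover have "0 < j" using j(1) assms by (cases "j = 0") auto
  ultimately show ?thesis using j by blast
qed

text \<open>The extra \<open>2\<close> is the index of the alternating group: the block argument
  measures density against \<open>fact n\<close>.\<close>

lemma density_exponent_choice:
  fixes t :: real
  assumes "1 \<le> t"
  shows "\<exists>a::nat. 2 * exp t \<le> 2 ^ a \<and> a \<le> 4 * t"
proof -
  have half: "1 / 2 \<le> ln (2::real)" using ln_le_minus_one[of "1/2"] by (simp add: ln_div)
  define a where "a = nat \<lceil>t / ln 2\<rceil> + 1"
  have "t / ln 2 \<le> t / (1 / 2)" using half assms by (intro divide_left_mono) auto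
  then have "t / ln 2 \<le> 2 * t" by simp
  moreover have "0 \<le> t / ln 2" using assms half by simp
  ultimately have a: "t / ln 2 \<le> real (a - 1)" "real a \<le> 2 * t + 2" unfolding a_def by linarith+
  have "t \<le> real (a - 1) * ln 2" using a(1) half by (simp add: field_simps)
  then have "exp t \<le> exp (real (a - 1) * ln 2)" by simp
  also have "\<dots> = 2 ^ (a - 1)" by (simp add: exp_of_nat_mult)
  finally have "2 * exp t \<le> 2 * 2 ^ (a - 1)" by simp
  also have "\<dots> = 2 ^ a" by (simp add: a_def)
  finally have "2 * exp t \<le> 2 ^ a" .
  moreover have "a \<le> 4 * t" using a(2) assms by linarith
  ultimately show ?thesis by blast
qed

lemma (in symmetric_subset) sparse_generating_set:
  fixes t L :: real
  assumes gen: "generate (alt_group n) A = carrier (alt_group n)"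
    and t: "1 \<le> t" "exp (- t) * card (carrier (alt_group n)) \<le> card A"
    and L: "1 < L" "L \<le> 6 * t" and room: "10240 * t * exp L \<le> n" and n: "2 \<le> n"
  shows "\<exists>m. 0 < m \<and> m \<le> 2000000 * (t / L)\<^sup>2 \<and> carrier (alt_group n) \<subseteq> pw m"
proof -
  let ?e = "real (card (carrier (alt_group n)))"
  obtain j :: nat where j: "0 < j" "L / 8 \<le> j" "256 ^ j \<le> 256 * exp L" using exponent_choice[OF L(1)] by blast
  obtain a :: nat where a: "2 * exp t \<le> 2 ^ a" "a \<le> 4 * t" using density_exponent_choice[OF t(1)] by blast
  have e2: "real (fact n) = 2 * ?e"
    using alt_group_card_carrier[OF n] by (metis of_nat_mult of_nat_numeral)
  have "exp t * (exp (- t) * ?e) = ?e" by (simp add: exp_minus)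
  moreover have "exp t * (exp (- t) * ?e) \<le> exp t * card A" using t(2) by (intro mult_left_mono) auto
  ultimately have "?e \<le> exp t * card A" by linarith
  then have "real (fact n) \<le> (2 * exp t) * card A" using e2 by simp
  also have "\<dots> \<le> 2 ^ a * real (card A)" using a by (intro mult_right_mono) auto
  finally have "real (fact n) \<le> real (card A * 2 ^ a)" by (simp add: mult.commute)
  then have dense: "fact n \<le> card A * 2 ^ a" by (simp only: of_nat_le_iff)
  define \<rho> where "\<rho> = a div j"
  have \<rho>: "real \<rho> \<le> 4 * t" "real \<rho> \<le> 32 * (t / L)"
  proof -
    have "\<rho> \<le> a" by (simp add: \<rho>_def)
    then show "real \<rho> \<le> 4 * t" using a(2) by linarith
    have "real \<rho> * j \<le> a" unfolding \<rho>_def by (simp flip: of_nat_mult)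
    moreover have "real \<rho> * (L / 8) \<le> real \<rho> * j" using j(2) by (intro mult_left_mono) auto
    ultimately have "real \<rho> * (L / 8) \<le> 4 * t" using a(2) by linarith
    then show "real \<rho> \<le> 32 * (t / L)" using L by (simp add: field_simps)
  qed
  \<comment> \<open>\<open>10240 = 10 * 4 * 256\<close>: the count \<open>\<beta> + 1\<close> is at
    most \<open>10 * t\<close>, \<open>N\<^sup>2\<close> is \<open>4 * 256 ^ j\<close>, and rounding
    \<open>j\<close> costs \<open>256\<close>.\<close>
  have "real ((2 * \<rho> + 1 + 1) * (2 * 16 ^ j)\<^sup>2) = (2 * real \<rho> + 2) * (4 * 256 ^ j)"
  proof -
    have "((2::real) * 16 ^ j)\<^sup>2 = 4 * 256 ^ j"
      by (simp add: power_mult_distrib flip: power_mult) (simp add: power_mult mult.commute[of j 2])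
    then show ?thesis by (simp add: algebra_simps)
  qed
  also have "\<dots> \<le> (10 * t) * (4 * (256 * exp L))"
    using \<rho>(1) t(1) j(3) by (intro mult_mono) auto
  also have "\<dots> \<le> n" using room by simp
  finally have room': "(2 * (a div j) + 1 + 1) * (2 * 16 ^ j)\<^sup>2 \<le> n" by (simp only: of_nat_le_iff \<rho>_def)
  interpret generating_symmetric_subset n A j a "2 * 16 ^ j" "4 * (a div j + 2)" "2 * (a div j) + 1"
    by unfold_locales (use j(1) dense room' gen in auto)
  obtain m where m: "0 < m" "m \<le> 1000 * (\<rho> + 1)\<^sup>2" "carrier (alt_group n) \<subseteq> pw m"
    using covering_number_bound unfolding \<rho>_def by blast
  have "real m \<le> real (1000 * (\<rho> + 1)\<^sup>2)" using m(2) by (simp only: of_nat_le_iff)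
  also have "\<dots> = 1000 * (real \<rho> + 1)\<^sup>2" by simp
  also have "\<dots> \<le> 1000 * (38 * (t / L))\<^sup>2"
  proof -
    \<comment> \<open>\<open>L \<le> 6 * t\<close> absorbs the additive one, giving
      \<open>32 + 6 = 38\<close>.\<close>
    have "1 \<le> 6 * (t / L)" using L by (simp add: field_simps)
    then have "real \<rho> + 1 \<le> 38 * (t / L)" using \<rho>(2) by linarith
    then show ?thesis by (intro mult_left_mono power_mono) auto
  qed
  also have "\<dots> = 1444000 * (t / L)\<^sup>2" by (simp add: power2_eq_square)
  also have "\<dots> \<le> 2000000 * (t / L)\<^sup>2" by (intro mult_right_mono) auto
  finally show ?thesis using m by blast
qed

theorem theorem1p1:
  shows "\<exists>c C :: real. c > 0 \<and> C > 0 \<and>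
    (\<forall>(n :: nat) (\<epsilon> :: real) (A :: (nat \<Rightarrow> nat) set).
       n \<ge> 3 \<longrightarrow>
       1 / ln (real n) < \<epsilon> \<longrightarrow> \<epsilon> \<le> 1 \<longrightarrow>
       A \<subseteq> carrier (alt_group n) \<longrightarrow>
       generate (alt_group n) A = carrier (alt_group n) \<longrightarrow>
       A = set_inv\<^bsub>alt_group n\<^esub> A \<longrightarrow>
       set_density (alt_group n) A \<ge> exp (- (c * real n powr (1 - \<epsilon>))) \<longrightarrow>
         (\<exists>m. is_covering_exponent (alt_group n) A m) \<and>
         real (covering_number (alt_group n) A)
           \<le> 8 / \<epsilon> + C / \<epsilon>\<^sup>2 * (log (real n) (1 / set_density (alt_group n) A))\<^sup>2)"
proof (rule exI[of _ "1 / 1000000"], rule exI[of _ 2000000], intro conjI allI impI)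
  \<comment> \<open>The constant \<open>1 / 1000000\<close> makes \<open>1000000 * t\<close> at most
    \<open>n powr (1 - \<epsilon>)\<close>. Outside the case of a set larger than half the group
    this forces \<open>n\<close> to be large; multiplied by \<open>n powr \<epsilon> = exp L\<close>
    it is the room needed for a sparse set.\<close>
  fix n :: nat and \<epsilon> :: real and A :: "(nat \<Rightarrow> nat) set"
  assume n: "n \<ge> 3" and \<epsilon>: "1 / ln (real n) < \<epsilon>" "\<epsilon> \<le> 1" and even: "A \<subseteq> carrier (alt_group n)"
    and gen: "generate (alt_group n) A = carrier (alt_group n)"
    and inv: "A = set_inv\<^bsub>alt_group n\<^esub> A"
    and dens: "set_density (alt_group n) A \<ge> exp (- (1 / 1000000 * real n powr (1 - \<epsilon>)))"
  let ?G = "carrier (alt_group n)"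
  define \<mu> where "\<mu> = set_density (alt_group n) A"
  define e where "e = real (card ?G)"
  have "exp (- (1 / 1000000 * real n powr (1 - \<epsilon>))) > 0" by simp
  then have \<mu>: "0 < \<mu>" using dens unfolding \<mu>_def by linarith
  have \<mu>e: "\<mu> = card A / e" by (simp add: \<mu>_def e_def set_density_def order_def)
  have e: "0 < e" using \<mu> \<mu>e by (cases "e = 0") (auto simp: e_def)
  have cardA: "card A = \<mu> * e" using \<mu>e e by simp
  have ne: "A \<noteq> {}" using \<mu> \<mu>e by auto
  interpret symmetric_subset n A
  proof
    fix b assume b: "b \<in> A"
    then show "b permutes {1..n}" using even by (auto simp: alt_group_carrier)
    have "inv\<^bsub>alt_group n\<^esub> b \<in> set_inv\<^bsub>alt_group n\<^esub> A" using b by (auto simp: SET_INV_def)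
    then have "inv\<^bsub>alt_group n\<^esub> b \<in> A" using inv by simp
    then show "inv' b \<in> A" using b even by (metis alt_group_inv_equality subsetD)
  qed (rule ne)
  have lnn: "0 < ln (real n)" using n by simp
  have \<epsilon>0: "0 < \<epsilon>" using \<epsilon>(1) lnn by (meson divide_pos_pos less_trans zero_less_one)
  define B where "B = 2000000 / \<epsilon>\<^sup>2 * (log (real n) (1 / \<mu>))\<^sup>2"
  have B0: "0 \<le> B" by (simp add: B_def)
  \<comment> \<open>The term \<open>8 / \<epsilon>\<close> has to pay for the cases with two or
    three factors; otherwise \<open>B\<close> alone suffices.\<close>
  have eight: "8 \<le> 8 / \<epsilon>" using \<epsilon> \<epsilon>0 by (simp add: field_simps)
  have "\<exists>m. 0 < m \<and> real m \<le> 8 / \<epsilon> + B \<and> ?G \<subseteq> pw m"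
  proof (cases "1 / 2 < \<mu>")
    case True
    then have "e < 2 * card A" using cardA e by simp
    then have "card ?G < 2 * card A" unfolding e_def by linarith
    then show ?thesis using large_set_square[OF even] eight B0 by (intro exI[of _ 2]) auto
  next
    case False
    define t where "t = ln (1 / \<mu>)"
    have exp_t: "exp (- t) = \<mu>" using \<mu> by (simp add: t_def ln_div)
    have "\<mu> \<le> 1 / 2" using False by simp
    then have "ln \<mu> \<le> ln (1 / 2)" using \<mu> by simp
    also have "\<dots> \<le> 1 / 2 - 1" by (rule ln_le_minus_one) simp
    finally have "1 / 2 \<le> t" using \<mu> by (simp add: t_def ln_div)
    have "ln (exp (- (1 / 1000000 * real n powr (1 - \<epsilon>)))) \<le> ln \<mu>"
      using dens \<mu> unfolding \<mu>_def by (subst ln_le_cancel_iff) auto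
    then have tn: "1000000 * t \<le> real n powr (1 - \<epsilon>)" using \<mu> by (simp add: t_def ln_div)
    have "real n powr (1 - \<epsilon>) \<le> real n powr 1" using n \<epsilon>0 by (intro powr_mono) auto
    then have big: "500000 \<le> real n" using tn \<open>1 / 2 \<le> t\<close> n by simp
    show ?thesis
    \<comment> \<open>Either three factors suffice, or \<open>n * \<mu> ^ 3\<close> is bounded. The
      latter makes \<open>t\<close> at least a multiple of \<open>ln n\<close>, so the quadratic
      term absorbs all constants.\<close>
    proof (cases "2 * e ^ 3 < real (card A) ^ 3 * (n div 4)")
      case True
      have "?G \<subseteq> pw 3" using big True even by (intro triple_product_covers) (auto simp: e_def)
      then show ?thesis using eight B0 by (intro exI[of _ 3]) auto
    next
      case False
      then have "e ^ 3 * (\<mu> ^ 3 * (n div 4)) \<le> e ^ 3 * 2" unfolding cardA by (simp add: power_mult_distrib mult_ac)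
      then have "\<mu> ^ 3 * (n div 4) \<le> 2" using e by simp
      moreover have "real n / 8 \<le> real (n div 4)" using big by linarith
      then have "\<mu> ^ 3 * (real n / 8) \<le> \<mu> ^ 3 * real (n div 4)" using \<mu> by (intro mult_left_mono) auto
      ultimately have "\<mu> ^ 3 * (real n / 8) \<le> 2" by (rule order_trans[rotated])
      then have "real n * \<mu> ^ 3 \<le> 16" by (simp add: mult.commute)
      then have "ln (real n * \<mu> ^ 3) \<le> ln 16" using \<mu> n by (subst ln_le_cancel_iff) auto
      moreover have "ln (real n * \<mu> ^ 3) = ln n - 3 * t"
        using \<mu> n by (simp add: ln_mult ln_realpow t_def ln_div)
      moreover have "2 * ln 16 \<le> ln (real n)"
      proof -
        have "2 * ln (16::real) = ln (16 ^ 2)" by (subst ln_realpow) auto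
        also have "\<dots> \<le> ln (real n)" using big by simp
        finally show ?thesis .
      qed
      \<comment> \<open>\<open>ln n - 3 * t\<close> is at most \<open>ln 16\<close>, hence at most
        half of \<open>ln n\<close>.\<close>
      ultimately have t6: "ln n \<le> 6 * t" by linarith
      have "6 \<le> ln (real n)"
      proof -
        have "exp (6::real) = exp 1 ^ 6" by (simp flip: exp_of_nat_mult)
        also have "\<dots> \<le> 3 ^ 6" using exp_le by (intro power_mono) auto
        also have "\<dots> \<le> real n" using big by simp
        finally show ?thesis using big by (subst ln_ge_iff) auto
      qed
      then have t1: "1 \<le> t" using t6 by linarith
      \<comment> \<open>The lower bound on \<open>\<epsilon>\<close> says exactly that
        \<open>L\<close> exceeds one.\<close>
      define L where "L = \<epsilon> * ln (real n)"
      have L1: "1 < L" using \<epsilon>(1) lnn by (simp add: L_def field_simps)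
      have "L \<le> 1 * ln n" unfolding L_def using \<epsilon>(2) lnn by (intro mult_right_mono) auto
      then have L6: "L \<le> 6 * t" using t6 by linarith
      have "10240 * t * exp L \<le> n"
      proof -
        have "exp L = real n powr \<epsilon>" using n by (simp add: L_def powr_def)
        then have "1000000 * t * exp L \<le> real n powr (1 - \<epsilon>) * real n powr \<epsilon>"
          using tn by (simp add: mult_right_mono)
        also have "\<dots> = real n" using n by (simp flip: powr_add)
        finally have "1000000 * (t * exp L) \<le> n" by simp
        moreover have "0 \<le> t * exp L" using t1 by simp
        ultimately show ?thesis by linarith
      qed
      then obtain m where m: "0 < m" "real m \<le> 2000000 * (t / L)\<^sup>2" "?G \<subseteq> pw m"
        using sparse_generating_set[OF gen t1 _ L1 L6] n cardA exp_t by (auto simp: e_def)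
      have "2000000 * (t / L)\<^sup>2 = B"
        by (simp add: B_def t_def L_def log_def power_divide power_mult_distrib)
      then have "real m \<le> 8 / \<epsilon> + B" using m(2) eight by linarith
      then show ?thesis using m by blast
    qed
  qed
  then obtain m where m: "0 < m" "real m \<le> 8 / \<epsilon> + B" "?G \<subseteq> pw m" by blast
  note cov = covering_number_le[OF even m(1,3)]
  show "\<exists>m. is_covering_exponent (alt_group n) A m" using cov(1) by blast
  show "real (covering_number (alt_group n) A)
           \<le> 8 / \<epsilon> + 2000000 / \<epsilon>\<^sup>2 * (log (real n) (1 / set_density (alt_group n) A))\<^sup>2"
    using cov(2) m(2) unfolding B_def \<mu>_def by linarith
qed simp_all

end
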